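(* Let $E:y^2=f(x)=x^3+ax^2+bx+c$ ($a,b,c\in K$) be an elliptic curve over $K$ with point at infinity $O$ as zero element, and let $T=(x_T,y_T)\in E(K)$ be a torsion point of order $n$. Let $\mathfrak{d}_T$ be a semi-reduced divisor on $E$ such that (i) $\mathfrak{d}_T-(\deg\mathfrak{d}_T)O\sim T-O$, and (ii) $[k]T\notin\mathrm{Supp}(\mathfrak{d}_T)$ for $1\le k\le n-1$. Let $(u,v)$ be the Mumford representation of $\mathfrak{d}_T$. Then: (1) For $1\le k\le n$, the divisor $k\mathfrak{d}_T+\iota^*\mathrm{r}(k\mathfrak{d}_T)$ is semi-reduced, where $\mathrm{r}(k\mathfrak{d}_T)=[k]T$ (to be read as the zero divisor for $k=n$, since $[n]T=O$), and $$\widetilde{I(k\mathfrak{d}_T)}=\langle u^k,\ u^{k-1}(y-v),\ \ldots,\ (y-v)^k,\ y^2-f\rangle\subset\overline{K}[x,y].$$ Let $\mathcal{G}_2$ be the reduced Gröbner basis of $\widetilde{I(k\mathfrak{d}_T)}$ with respect to $>_2$, and let $g_k$ be an element of $\mathcal{G}_2\setminus\{y^2-f\}$ with minimum multidegree with respect to $>_2$. Then $g_k$ is of the form $b_0+b_1y$ with $b_0,b_1\in\overline{K}[x]$, and $\mathrm{div}([g_k])=k\mathfrak{d}_T+[-k]T-(k\deg\mathfrak{d}_T+1)O$. (2) In particular, for $k=n$, putting $b_{n\mathfrak{d}_T}:=g_n=b_0+b_1y$, one has $\mathrm{div}([b_{n\mathfrak{d}_T}])=n\mathfrak{d}_T-(n\deg\mathfrak{d}_T)O$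 and $$b_0^2-b_1^2f=r\,u^n\quad\text{for some } r\in K^{\times}.$$ (3) Suppose $K=\mathbb{C}(t)$ and $a,b,c\in\mathbb{C}[t]$, let $\mathcal{B}_o\subset\mathbb{P}^2$ be the plane curve given by the affine equation $f=0$ (with $f\in\mathbb{C}[t,x]$), let $L_\infty$ be the line at infinity, and $\mathcal{B}=\mathcal{B}_o+L_\infty$. If $r\in\mathbb{C}^{\times}$ and $u,\,b_{n\mathfrak{d}_T}$ have coefficients such that $u,b_0,b_1\in\mathbb{C}[t,x]$, then either $\mathcal{B}_o$ or $\mathcal{B}$ satisfies a quasi-toric relation of type $(2,n,2)$.
   Context: $K$ is a field with $\mathrm{char}(K)\ne2$, $\overline{K}$ an algebraic closure; $f$ has no multiple roots in $\overline{K}$. $\iota:(x,y)\mapsto(x,-y)$. Divisors on $E$ are considered over $\overline{K}$, $\sim$ is linear equivalence, and $[k]T$ is the multiple of $T$ in the group law. For $h\in\overline{K}[x,y]$, $[h]$ is its class in $\overline{K}[E]=\overline{K}[x,y]/\langle y^2-f\rangle$. A semi-reduced divisor on $E$ is an effective divisor $\sum_Pe_PP$ supported in $E\setminus\{O\}$ such that $e_P=1$ if $e_P>0$ and $P=\iota(P)$, and $e_{\iota(P)}=0$ if $e_P>0$ and $P\ne\iota(P)$. For a divisor $\mathfrak{d}$, $\mathrm{r}(\mathfrak{d})$ is the unique semi-reduced divisor of degree at most $1$ with $\mathfrak{d}-(\deg\mathfrak{d})O\sim\mathrm{r}(\mathfrak{d})-(\deg\mathrm{r}(\mathfrak{d}))O$.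 The Mumford representation of a non-zero semi-reduced divisor $\sum_{i=1}^re_iP_i$ ($e_i>0$, $P_i=(x_i,y_i)$ distinct) is the unique pair $(u,v)$ of polynomials in $\overline{K}[x]$ with $u=\prod_i(x-x_i)^{e_i}$, $\deg v<\deg u$, $\mathrm{ord}_{P_i}([y-v])\ge e_i$ for all $i$, and $u\mid v^2-f$. For an effective divisor $\mathfrak{d}=\sum_Pe_PP$ supported in $E\setminus\{O\}$, $\widetilde{I(\mathfrak{d})}=\{h\in\overline{K}[x,y] : \mathrm{ord}_P([h])\ge e_P\ \forall P\in\mathrm{Supp}(\mathfrak{d})\}$. $>_2$ is the following monomial order on $\overline{K}[x,y]$: with $\mathrm{wdeg}(y^mx^l)=3m+2l$, $y^{m_1}x^{l_1}>_2y^{m_2}x^{l_2}$ iff $\mathrm{wdeg}(y^{m_1}x^{l_1})>\mathrm{wdeg}(y^{m_2}x^{l_2})$, or these weights are equal and $l_1<l_2$. The multidegree of a polynomial with respect to $>_2$ is the exponent of its leading monomial; multidegrees are compared via $>_2$. A plane curve $\mathcal{D}\subset\mathbb{P}^2$ satisfies a quasi-toric relation of type $(p,q,s)$ if there are non-zero homogeneous polynomials $F_1,F_2,F_3,h_1,h_2,h_3$ with $h_1^pF_1+h_2^qF_2+h_3^sF_3=0$ such that $\mathcal{D}$ is the curve given by $F_1F_2F_3=0$ (multiplicities of components of $F_1F_2F_3=0$ are disregarded). Here $\mathbb{P}^2$ has homogeneous coordinates $[T:X:Z]$ with $t=T/Z$, $x=X/Z$, and $L_\infty$ is $Z=0$.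
   Formalization: In (1), that k·d_T + ι*r(k·d_T) is semi-reduced is asserted only for k = 1 or when Supp(d_T) has no point P = ι(P); otherwise it is false (T = P_1, n = k = 2, d_T = P_2 + P_3 with P_i the 2-torsion points). *)

theory Defs
  imports
    "HOL-Algebra.Algebraic_Closure_Type"
    "HOL-Library.Poly_Mapping"
    "HOL-Library.Extended_Nat"
    "HOL-Computational_Algebra.Computational_Algebra"
begin

section \<open>Polynomials in two and three variables\<close>

text \<open>
  A polynomial in \<open>x, y\<close> is an element of \<^typ>\<open>'a poly poly\<close> with \<open>x\<close> the inner and \<open>y\<close> the
  outer variable: the coefficient of \<open>y ^ m * x ^ l\<close> in \<open>h\<close> is \<open>coeff (coeff h m) l\<close>.  So
  \<open>[:b0, b1:]\<close> is \<open>b0 + b1 * y\<close>.  Similarly, the innermost variable of \<^typ>\<open>'a poly poly poly\<close>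
  is the first homogeneous coordinate and the outermost variable is the third one.
\<close>

definition eval2 :: "'a::comm_ring_1 poly poly \<Rightarrow> 'a \<Rightarrow> 'a \<Rightarrow> 'a" where
  "eval2 h p q = poly (poly h [:q:]) p"

definition eval3 :: "'a::comm_ring_1 poly poly poly \<Rightarrow> 'a \<Rightarrow> 'a \<Rightarrow> 'a \<Rightarrow> 'a" where
  "eval3 F p q r = eval2 (poly F [:[:r:]:]) p q"

definition total_degree :: "'a::comm_ring_1 poly poly \<Rightarrow> nat" where
  "total_degree h = (MAX m\<in>{..degree h}. m + degree (coeff h m))"

definition homogenize :: "'a::comm_ring_1 poly poly \<Rightarrow> 'a poly poly poly" where
  "homogenize h =
     (\<Sum>m\<le>degree h. \<Sum>l\<le>degree (coeff h m).
        monom (monom (monom (coeff (coeff h m) l) l) m) (total_degree h - l - m))"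

definition homogeneous :: "'a::comm_ring_1 poly poly poly \<Rightarrow> bool" where
  "homogeneous F \<longleftrightarrow>
     (\<exists>d. \<forall>i j k. coeff (coeff (coeff F k) j) i \<noteq> 0 \<longrightarrow> i + j + k = d)"

definition ideal_gen :: "'a::comm_ring_1 set \<Rightarrow> 'a set" where
  "ideal_gen S = genideal ring_of_type_algebra S"


section \<open>The curve and its group law\<close>

datatype 'a point = Infinity | Affine (xcoord: 'a) (ycoord: 'a)

definition weierstrass :: "'a::comm_ring_1 \<Rightarrow> 'a \<Rightarrow> 'a \<Rightarrow> 'a poly" where
  "weierstrass a b c = [:c, b, a, 1:]"

definition curve_eq :: "'a::comm_ring_1 poly \<Rightarrow> 'a poly poly" where
  "curve_eq f = [:- f, 0, 1:]"

definition curve_points :: "'a::comm_ring_1 poly \<Rightarrow> 'a point set" where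
  "curve_points f = insert Infinity {Affine x y | x y. y ^ 2 = poly f x}"

fun iota :: "'a::comm_ring_1 point \<Rightarrow> 'a point" where
  "iota Infinity = Infinity"
| "iota (Affine x y) = Affine x (- y)"

text \<open>Chord-tangent addition on \<open>y\<^sup>2 = f(x)\<close>, for \<open>f\<close> a monic cubic in characteristic \<open>\<noteq> 2\<close>.\<close>

fun point_add :: "'a::field poly \<Rightarrow> 'a point \<Rightarrow> 'a point \<Rightarrow> 'a point" where
  "point_add f Infinity Q = Q"
| "point_add f P Infinity = P"
| "point_add f (Affine x1 y1) (Affine x2 y2) =
     (if x1 = x2 \<and> y1 = - y2 then Infinity
      else let s = (if x1 = x2 then poly (pderiv f) x1 / (2 * y1) else (y2 - y1) / (x2 - x1));
               x3 = s ^ 2 - coeff f 2 - x1 - x2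
           in Affine x3 (- (y1 + s * (x3 - x1))))"

definition point_mult :: "'a::field poly \<Rightarrow> nat \<Rightarrow> 'a point \<Rightarrow> 'a point" where
  "point_mult f k P = (point_add f P ^^ k) Infinity"

definition has_torsion_order :: "'a::field poly \<Rightarrow> 'a point \<Rightarrow> nat \<Rightarrow> bool" where
  "has_torsion_order f P n \<longleftrightarrow> 0 < n \<and> point_mult f n P = Infinity \<and>
     (\<forall>k. 0 < k \<and> k < n \<longrightarrow> point_mult f k P \<noteq> Infinity)"


section \<open>Order of vanishing\<close>

text \<open>
  \<open>local_ord C p q h\<close> is the order at the point \<open>(p, q)\<close> of the regular function on the affine
  plane curve \<open>C = 0\<close> induced by \<open>h\<close>, namely the largest \<open>d\<close> such that this function lies in
  the \<open>d\<close>-th power of the maximal ideal of the local ring at \<open>(p, q)\<close> (and \<open>\<infinity>\<close> if it is zero).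
  Membership is expressed with representatives: after multiplication by some \<open>s\<close> that does not
  vanish at \<open>(p, q)\<close>, \<open>h\<close> lies in the ideal generated by \<open>C\<close> and the \<open>d\<close>-th power of
  \<open>\<langle>x - p, y - q\<rangle>\<close>.
\<close>

definition local_ord :: "'a::field poly poly \<Rightarrow> 'a \<Rightarrow> 'a \<Rightarrow> 'a poly poly \<Rightarrow> enat" where
  "local_ord C p q h =
     Sup {enat d | d. \<exists>s. eval2 s p q \<noteq> 0 \<and>
       s * h \<in> ideal_gen (insert C {[:[:- p, 1:]:] ^ i * [:[:- q:], 1:] ^ (d - i) | i. i \<le> d})}"

definition affine_ord :: "'a::field poly \<Rightarrow> 'a point \<Rightarrow> 'a poly poly \<Rightarrow> enat" where
  "affine_ord f P h = local_ord (curve_eq f) (xcoord P) (ycoord P) h"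

text \<open>
  \<open>chart_Y h\<close> is the polynomial in \<open>w = X/Y\<close> (inner variable) and \<open>s = Z/Y\<close> (outer variable)
  obtained from the homogenization of \<open>h\<close>; \<open>O\<close> is the origin of this chart.  With \<open>d\<close> the total
  degree of \<open>h\<close> one has \<open>h = chart_Y h / s ^ d\<close>, which gives the order of \<open>h\<close> at \<open>O\<close>.
\<close>

definition chart_Y :: "'a::field poly poly \<Rightarrow> 'a poly poly" where
  "chart_Y h = map_poly (\<lambda>c. poly c 1) (homogenize h)"

definition ord_infinity :: "'a::field poly \<Rightarrow> 'a poly poly \<Rightarrow> int" where
  "ord_infinity f h =
     int (the_enat (local_ord (chart_Y (curve_eq f)) 0 0 (chart_Y h)))
     - int (total_degree h) * int (the_enat (local_ord (chart_Y (curve_eq f)) 0 0 [:0, 1:]))"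

text \<open>Only used for \<open>h\<close> that are non-zero on the curve.\<close>

definition ord_at :: "'a::field poly \<Rightarrow> 'a point \<Rightarrow> 'a poly poly \<Rightarrow> int" where
  "ord_at f P h =
     (if P = Infinity then ord_infinity f h else int (the_enat (affine_ord f P h)))"


section \<open>Divisors\<close>

type_synonym 'a divisor = "'a point \<Rightarrow>\<^sub>0 int"

definition is_divisor :: "'a::field poly \<Rightarrow> 'a divisor \<Rightarrow> bool" where
  "is_divisor f D \<longleftrightarrow> Poly_Mapping.keys D \<subseteq> curve_points f"

definition div_degree :: "'a divisor \<Rightarrow> int" where
  "div_degree D = (\<Sum>P\<in>Poly_Mapping.keys D. Poly_Mapping.lookup D P)"

definition div_of :: "'a::field poly \<Rightarrow> 'a poly poly \<Rightarrow> 'a divisor" where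
  "div_of f h = Abs_poly_mapping (\<lambda>P. if P \<in> curve_points f then ord_at f P h else 0)"

text \<open>
  Every non-zero rational function on the curve is \<open>g / h\<close> with \<open>g, h\<close> polynomials whose classes
  modulo \<open>y\<^sup>2 - f\<close> are non-zero, and its divisor is \<open>div_of f g - div_of f h\<close>.
\<close>

definition lin_equiv :: "'a::field poly \<Rightarrow> 'a divisor \<Rightarrow> 'a divisor \<Rightarrow> bool" where
  "lin_equiv f D D' \<longleftrightarrow>
     (\<exists>g h. \<not> curve_eq f dvd g \<and> \<not> curve_eq f dvd h \<and> D - D' = div_of f g - div_of f h)"

text \<open>Pullback of a divisor along the automorphism \<open>iota\<close>.\<close>

definition iota_pullback :: "'a::comm_ring_1 divisor \<Rightarrow> 'a divisor" where
  "iota_pullback D = Poly_Mapping.map_key iota D"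

text \<open>
  A fixed point of \<open>iota\<close> may occur only with multiplicity 1.  Hence no multiple \<open>k D\<close> with
  \<open>k > 1\<close> of a divisor containing such a point is semi-reduced.
\<close>

definition semi_reduced :: "'a::field poly \<Rightarrow> 'a divisor \<Rightarrow> bool" where
  "semi_reduced f D \<longleftrightarrow> is_divisor f D \<and> Infinity \<notin> Poly_Mapping.keys D \<and>
     (\<forall>P. 0 \<le> Poly_Mapping.lookup D P) \<and>
     (\<forall>P. 0 < Poly_Mapping.lookup D P \<longrightarrow>
        (if P = iota P then Poly_Mapping.lookup D P = 1
         else Poly_Mapping.lookup D (iota P) = 0))"

definition reduction :: "'a::field poly \<Rightarrow> 'a divisor \<Rightarrow> 'a divisor" where
  "reduction f D = (THE R. semi_reduced f R \<and> div_degree R \<le> 1 \<and>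
     lin_equiv f (D - frag_cmul (div_degree D) (frag_of Infinity))
                 (R - frag_cmul (div_degree R) (frag_of Infinity)))"

definition mumford_rep :: "'a::field poly \<Rightarrow> 'a divisor \<Rightarrow> 'a poly \<Rightarrow> 'a poly \<Rightarrow> bool" where
  "mumford_rep f D u v \<longleftrightarrow>
     u = (\<Prod>P\<in>Poly_Mapping.keys D. [:- xcoord P, 1:] ^ nat (Poly_Mapping.lookup D P)) \<and>
     degree v < degree u \<and>
     (\<forall>P\<in>Poly_Mapping.keys D.
        enat (nat (Poly_Mapping.lookup D P)) \<le> affine_ord f P [:- v, 1:]) \<and>
     u dvd v ^ 2 - f"

definition ideal_tilde :: "'a::field poly \<Rightarrow> 'a divisor \<Rightarrow> 'a poly poly set" where
  "ideal_tilde f D =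
     {h. \<forall>P\<in>Poly_Mapping.keys D. enat (nat (Poly_Mapping.lookup D P)) \<le> affine_ord f P h}"


section \<open>The monomial order and Groebner bases\<close>

text \<open>The exponent of \<open>y ^ m * x ^ l\<close> is written \<open>(l, m)\<close>.\<close>

fun wdeg :: "nat \<times> nat \<Rightarrow> nat" where
  "wdeg (l, m) = 3 * m + 2 * l"

definition mono_gt :: "nat \<times> nat \<Rightarrow> nat \<times> nat \<Rightarrow> bool" (infix \<open>>\<^sub>2\<close> 50) where
  "e1 >\<^sub>2 e2 \<longleftrightarrow> wdeg e1 > wdeg e2 \<or> (wdeg e1 = wdeg e2 \<and> fst e1 < fst e2)"

definition exponents :: "'a::comm_ring_1 poly poly \<Rightarrow> (nat \<times> nat) set" where
  "exponents h = {(l, m). coeff (coeff h m) l \<noteq> 0}"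

definition multidegree :: "'a::comm_ring_1 poly poly \<Rightarrow> nat \<times> nat" where
  "multidegree h = (THE e. e \<in> exponents h \<and> (\<forall>e'\<in>exponents h. e' = e \<or> e >\<^sub>2 e'))"

fun term2 :: "'a::comm_ring_1 \<Rightarrow> nat \<times> nat \<Rightarrow> 'a poly poly" where
  "term2 c (l, m) = monom (monom c l) m"

definition leading_coefficient :: "'a::comm_ring_1 poly poly \<Rightarrow> 'a" where
  "leading_coefficient h = coeff (coeff h (snd (multidegree h))) (fst (multidegree h))"

definition leading_term :: "'a::comm_ring_1 poly poly \<Rightarrow> 'a poly poly" where
  "leading_term h = term2 (leading_coefficient h) (multidegree h)"

definition groebner_basis :: "'a::field poly poly set \<Rightarrow> 'a poly poly set \<Rightarrow> bool" where
  "groebner_basis I G \<longleftrightarrow> finite G \<and> G \<subseteq> I \<and> 0 \<notin> G \<and>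
     ideal_gen (leading_term ` G) = ideal_gen (leading_term ` (I - {0}))"

definition reduced_groebner_basis :: "'a::field poly poly set \<Rightarrow> 'a poly poly set \<Rightarrow> bool" where
  "reduced_groebner_basis I G \<longleftrightarrow> groebner_basis I G \<and>
     (\<forall>g\<in>G. leading_coefficient g = 1 \<and>
        (\<forall>e\<in>exponents g. term2 1 e \<notin> ideal_gen (leading_term ` (G - {g}))))"

text \<open>
  \<open>min_groebner_element f D g\<close>: \<open>g\<close> is an element other than \<open>y\<^sup>2 - f\<close> of minimum multidegree of
  the reduced Groebner basis of \<open>ideal_tilde f D\<close>.
\<close>

definition min_groebner_element ::
    "'a::field poly \<Rightarrow> 'a divisor \<Rightarrow> 'a poly poly \<Rightarrow> bool" where
  "min_groebner_element f D g \<longleftrightarrow>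
     (\<exists>G. reduced_groebner_basis (ideal_tilde f D) G \<and> g \<in> G - {curve_eq f} \<and>
        (\<forall>g'\<in>G - {curve_eq f}. multidegree g' = multidegree g \<or> multidegree g' >\<^sub>2 multidegree g))"


section \<open>Torsion points with Mumford representations\<close>

text \<open>
  The curve \<open>y\<^sup>2 = x\<^sup>3 + a x\<^sup>2 + b x + c\<close> and the point \<open>T = (xT, yT)\<close> are defined over \<open>'k\<close>;
  the divisor \<open>D\<close> and its Mumford representation \<open>(u, v)\<close> are defined over the algebraic closure.
\<close>

definition weierstrass_ac :: "'k::field \<Rightarrow> 'k \<Rightarrow> 'k \<Rightarrow> 'k alg_closure poly" where
  "weierstrass_ac a b c = map_poly to_ac (weierstrass a b c)"

definition point_ac :: "'k::field \<Rightarrow> 'k \<Rightarrow> 'k alg_closure point" where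
  "point_ac x y = Affine (to_ac x) (to_ac y)"

definition torsion_data ::
    "'k::field \<Rightarrow> 'k \<Rightarrow> 'k \<Rightarrow> 'k \<Rightarrow> 'k \<Rightarrow> nat \<Rightarrow> 'k alg_closure divisor \<Rightarrow>
     'k alg_closure poly \<Rightarrow> 'k alg_closure poly \<Rightarrow> bool" where
  "torsion_data a b c xT yT n D u v \<longleftrightarrow>
     (let f = weierstrass_ac a b c; T = point_ac xT yT in
        CHAR('k) \<noteq> 2 \<and> rsquarefree f \<and>
        T \<in> curve_points f \<and> has_torsion_order f T n \<and>
        semi_reduced f D \<and>
        lin_equiv f (D - frag_cmul (div_degree D) (frag_of Infinity))
                    (frag_of T - frag_of Infinity) \<and>
        (\<forall>k. 1 \<le> k \<and> k \<le> n - 1 \<longrightarrow> point_mult f k T \<notin> Poly_Mapping.keys D) \<and>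
        mumford_rep f D u v)"


section \<open>Quasi-toric relations\<close>

text \<open>
  A plane curve is represented by its set of points, given by all their homogeneous coordinate
  vectors; this disregards the multiplicities of components.
\<close>

definition proj_curve :: "complex poly poly poly \<Rightarrow> (complex \<times> complex \<times> complex) set" where
  "proj_curve F = {(t, x, z). (t, x, z) \<noteq> (0, 0, 0) \<and> eval3 F t x z = 0}"

definition quasi_toric ::
    "nat \<Rightarrow> nat \<Rightarrow> nat \<Rightarrow> (complex \<times> complex \<times> complex) set \<Rightarrow> bool" where
  "quasi_toric p q s C \<longleftrightarrow>
     (\<exists>F1 F2 F3 h1 h2 h3. (\<forall>H\<in>{F1, F2, F3, h1, h2, h3}. H \<noteq> 0 \<and> homogeneous H) \<and>
        h1 ^ p * F1 + h2 ^ q * F2 + h3 ^ s * F3 = 0 \<and> C = proj_curve (F1 * F2 * F3))"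

definition line_at_infinity :: "(complex \<times> complex \<times> complex) set" where
  "line_at_infinity = proj_curve [:0, 1:]"

definition const_ac :: "complex poly \<Rightarrow> complex poly fract alg_closure" where
  "const_ac p = to_ac (to_fract p)"

end

theory Submission
  imports Defs
begin

text \<open>
  Modulo \<open>y\<^sup>2 - f\<close> every polynomial is uniquely \<open>b0 + b1 * y\<close>; its norm \<open>b0\<^sup>2 - f * b1\<^sup>2\<close>, a polynomial in
  \<open>x\<close>, controls its divisor: the order of the norm at \<open>x = p\<close> is the sum of the orders at the points
  above \<open>p\<close>, and the degree of the norm, which equals the weighted degree of the leading monomial for
  \<open>>\<^sub>2\<close>, is the pole order at \<open>O\<close>.  A principal divisor that is effective away from \<open>O\<close> is the divisor of
  some \<open>b0 + b1 * y\<close>; as norms never have degree 1, distinct points are not equivalent, and the divisors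
  of lines give \<open>k * (T - O) \<sim> [k]T - O\<close>.  Hence there is a function \<open>b0 + b1 * y\<close> with the divisor claimed
  for \<open>g\<^sub>k\<close>.  The ideal of \<open>k * D\<close> is generated locally at each point, and the generators are patched
  together by Bezout in \<open>K[x]\<close>.  Every norm from this ideal is divisible by \<open>u ^ k\<close>, and it can
  have the degree of \<open>u ^ k\<close> only if \<open>[k]T = O\<close>; so no reduced element has a smaller leading monomial than
  that function, and \<open>g\<^sub>k\<close> is proportional to it.  Finally, the norm equation
  \<open>b0\<^sup>2 - b1\<^sup>2 * f = r * u ^ n\<close> is homogenized by inserting powers of \<open>Z\<close>, which become the extra
  component \<open>L\<^sub>\<infinity>\<close>.
\<close>

section \<open>Ideals and orders of vanishing\<close>

text \<open>Parity stands in for the genus: \<open>b0 ^ 2\<close> and \<open>f * b1 ^ 2\<close> have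
  degrees of different parity, so the degree of the norm identifies the leading monomial and is
  never 1. Existence of functions rests on lines alone, because chords, tangents and verticals have
  explicit divisors. Two kinds of points need separate care. At a fixed point of \<open>iota\<close>
  the function \<open>x - p\<close> has order 2, the local parameter is \<open>y\<close>, and such a
  point occurs in \<open>D\<close> only with multiplicity 1. At \<open>O\<close> the order is
  defined through the homogenization of the given polynomial, not of its reduced form, so
  congruences modulo \<open>y ^ 2 - f\<close> have to be padded to a common degree first. The
  patching over \<open>K[x]\<close> succeeds because a semi-reduced divisor has at most one point
  above each \<open>x\<close>. For \<open>n = 2\<close> the function \<open>g_n\<close> may lack one
  of its two components; the quasi-toric relation then comes from an identity unrelated to the
  torsion point.\<close>

definition is_ideal :: "'a::comm_ring_1 set \<Rightarrow> bool" where
  "is_ideal I \<longleftrightarrow> 0 \<in> I \<and> (\<forall>a\<in>I. \<forall>b\<in>I. a + b \<in> I) \<and> (\<forall>a\<in>I. \<forall>r. r * a \<in> I)"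

text \<open>In a commutative ring the additive inverse is multiplication by \<open>-1\<close>, so
  closure under sums and multiples already yields a subgroup. Bounds on \<open>ideal_gen\<close>
  thus reduce to three closure conditions.\<close>

lemma is_ideal_iff: "is_ideal I \<longleftrightarrow> Ideal.ideal I (ring_of_type_algebra :: 'a::comm_ring_1 ring)"
proof
  assume I: "is_ideal I"
  have neg: "- a \<in> I" if "a \<in> I" for a
    using I that by (metis is_ideal_def mult_minus1)
  show "Ideal.ideal I (ring_of_type_algebra :: 'a ring)"
  proof (rule idealI)
    show "ring (ring_of_type_algebra :: 'a ring)"
      by (rule ring_from_type_algebra)
    have inv: "inv\<^bsub>add_monoid (ring_of_type_algebra :: 'a ring)\<^esub> a = - a" for a
    proof -
      interpret ring "ring_of_type_algebra :: 'a ring" by (rule ring_from_type_algebra)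
      have "\<ominus>\<^bsub>(ring_of_type_algebra :: 'a ring)\<^esub> a = - a"
        by (rule minus_equality) (auto simp: ring_of_type_algebra_def)
      thus ?thesis by (simp add: a_inv_def)
    qed
    show "subgroup I (add_monoid (ring_of_type_algebra :: 'a ring))"
    proof (rule group.subgroupI)
      show "Group.group (add_monoid (ring_of_type_algebra :: 'a ring))"
        using ring_from_type_algebra ring.is_abelian_group abelian_group.a_group by blast
      show "I \<noteq> {}" "I \<subseteq> carrier (add_monoid (ring_of_type_algebra :: 'a ring))"
        using I by (auto simp: is_ideal_def ring_of_type_algebra_def)
      show "inv\<^bsub>add_monoid (ring_of_type_algebra :: 'a ring)\<^esub> a \<in> I" if "a \<in> I" for a
        unfolding inv using neg that .
      show "a \<otimes>\<^bsub>add_monoid (ring_of_type_algebra :: 'a ring)\<^esub> b \<in> I" if "a \<in> I" "b \<in> I" for a b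
        using I that by (auto simp: is_ideal_def ring_of_type_algebra_def)
    qed
  qed (use I in \<open>auto simp: is_ideal_def ring_of_type_algebra_def mult.commute\<close>)
next
  assume "Ideal.ideal I (ring_of_type_algebra :: 'a ring)"
  then interpret I: Ideal.ideal I "ring_of_type_algebra :: 'a ring" .
  have "0 \<in> I"
    using additive_subgroup.zero_closed[OF I.is_additive_subgroup] by (simp add: ring_of_type_algebra_def)
  moreover have "a + b \<in> I" if "a \<in> I" "b \<in> I" for a b
    using additive_subgroup.a_closed[OF I.is_additive_subgroup that] by (simp add: ring_of_type_algebra_def)
  moreover have "r * a \<in> I" if "a \<in> I" for a r
    using I.I_l_closed[OF that, of r] by (simp add: ring_of_type_algebra_def)
  ultimately show "is_ideal I"
    unfolding is_ideal_def by blast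
qed

lemma ideal_gen_superset: "S \<subseteq> ideal_gen S"
  by (auto simp: ideal_gen_def genideal_def)

lemma ideal_gen_incl: "a \<in> S \<Longrightarrow> a \<in> ideal_gen S"
  using ideal_gen_superset by auto

lemma ideal_gen_least: "is_ideal I \<Longrightarrow> S \<subseteq> I \<Longrightarrow> ideal_gen S \<subseteq> I"
  by (auto simp: ideal_gen_def genideal_def is_ideal_iff)

lemma is_ideal_ideal_gen: "is_ideal (ideal_gen S)"
  unfolding ideal_gen_def genideal_def is_ideal_iff[symmetric] by (auto simp: is_ideal_def)

lemma is_ideal_0: "is_ideal I \<Longrightarrow> 0 \<in> I"
  and is_ideal_add: "is_ideal I \<Longrightarrow> a \<in> I \<Longrightarrow> b \<in> I \<Longrightarrow> a + b \<in> I"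
  and is_ideal_mult: "is_ideal I \<Longrightarrow> a \<in> I \<Longrightarrow> r * a \<in> I"
  by (auto simp: is_ideal_def mult.commute)

lemma is_ideal_uminus: "is_ideal I \<Longrightarrow> a \<in> I \<Longrightarrow> - a \<in> I"
  by (metis is_ideal_def mult_minus1)

lemma is_ideal_diff: "is_ideal I \<Longrightarrow> a \<in> I \<Longrightarrow> b \<in> I \<Longrightarrow> a - b \<in> I"
  by (metis is_ideal_add is_ideal_uminus diff_conv_add_uminus)

lemma is_ideal_dvd: "is_ideal I \<Longrightarrow> a \<in> I \<Longrightarrow> a dvd b \<Longrightarrow> b \<in> I"
  by (auto simp: is_ideal_def mult.commute elim!: dvdE)

lemma is_ideal_sum: "is_ideal I \<Longrightarrow> (\<And>i. i \<in> A \<Longrightarrow> g i \<in> I) \<Longrightarrow> sum g A \<in> I"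
  by (induction A rule: infinite_finite_induct) (auto simp: is_ideal_def)

lemma eval2_simps [simp]:
  "eval2 0 p q = 0" "eval2 1 p q = 1"
  "eval2 (g + h) p q = eval2 g p q + eval2 h p q"
  "eval2 (g - h) p q = eval2 g p q - eval2 h p q"
  "eval2 (- g) p q = - eval2 g p q"
  "eval2 (g * h) p q = eval2 g p q * eval2 h p q"
  "eval2 (g ^ n) p q = eval2 g p q ^ n"
  "eval2 (pCons c h) p q = poly c p + q * eval2 h p q"
  by (auto simp: eval2_def)

lemma eval2_smult: "eval2 (smult c h) p q = poly c p * eval2 h p q"
  by (simp add: eval2_def)

lemma eval2_dvd_0: "C dvd g \<Longrightarrow> eval2 C p q = 0 \<Longrightarrow> eval2 g p q = 0"
  by auto

lemma eval2_sum: "eval2 (sum g A) p q = (\<Sum>i\<in>A. eval2 (g i) p q)"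
  by (induction A rule: infinite_finite_induct) auto

text \<open>
  \<open>vanish C p q \<pi> n h\<close> says that \<open>h\<close> lies in \<open>\<langle>\<pi> ^ n\<rangle>\<close> in the local ring of \<open>C = 0\<close> at \<open>(p, q)\<close>,
  and \<open>exact\<close> that it is \<open>\<pi> ^ n\<close> times a unit.
\<close>

definition vanish :: "'a::field poly poly \<Rightarrow> 'a \<Rightarrow> 'a \<Rightarrow> 'a poly poly \<Rightarrow> nat \<Rightarrow> 'a poly poly \<Rightarrow> bool" where
  "vanish C p q \<pi> n h \<longleftrightarrow> (\<exists>s t. eval2 s p q \<noteq> 0 \<and> C dvd s * h - t * \<pi> ^ n)"

definition exact :: "'a::field poly poly \<Rightarrow> 'a \<Rightarrow> 'a \<Rightarrow> 'a poly poly \<Rightarrow> nat \<Rightarrow> 'a poly poly \<Rightarrow> bool" where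
  "exact C p q \<pi> n h \<longleftrightarrow> (\<exists>s t. eval2 s p q \<noteq> 0 \<and> eval2 t p q \<noteq> 0 \<and> C dvd s * h - t * \<pi> ^ n)"

lemma exactI: "eval2 s p q \<noteq> 0 \<Longrightarrow> eval2 t p q \<noteq> 0 \<Longrightarrow> C dvd s * h - t * \<pi> ^ n \<Longrightarrow> exact C p q \<pi> n h"
  by (auto simp: exact_def)

lemma vanishI: "eval2 s p q \<noteq> 0 \<Longrightarrow> C dvd s * h - t * \<pi> ^ n \<Longrightarrow> vanish C p q \<pi> n h"
  by (auto simp: vanish_def)

lemma exact_0: "eval2 h p q \<noteq> 0 \<Longrightarrow> exact C p q \<pi> 0 h"
  by (rule exactI[of 1 _ _ h]) auto

lemma vanish_mult: "vanish C p q \<pi> m g \<Longrightarrow> vanish C p q \<pi> n h \<Longrightarrow> vanish C p q \<pi> (m + n) (g * h)"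
proof -
  assume "vanish C p q \<pi> m g" "vanish C p q \<pi> n h"
  then obtain s t s' t' where "eval2 s p q \<noteq> 0" "C dvd s * g - t * \<pi> ^ m"
     "eval2 s' p q \<noteq> 0" "C dvd s' * h - t' * \<pi> ^ n"
    by (auto simp: vanish_def)
  moreover have "s * s' * (g * h) - t * t' * \<pi> ^ (m + n)
     = (s * g - t * \<pi> ^ m) * (s' * h) + (t * \<pi> ^ m) * (s' * h - t' * \<pi> ^ n)"
    by (simp add: algebra_simps power_add)
  ultimately show ?thesis
    by (intro vanishI[of "s * s'" _ _ _ _ "t * t'"]) (auto intro: dvd_add)
qed

lemma exact_mult: "exact C p q \<pi> m g \<Longrightarrow> exact C p q \<pi> n h \<Longrightarrow> exact C p q \<pi> (m + n) (g * h)"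
proof -
  assume "exact C p q \<pi> m g" "exact C p q \<pi> n h"
  then obtain s t s' t' where "eval2 s p q \<noteq> 0" "C dvd s * g - t * \<pi> ^ m" "eval2 t p q \<noteq> 0"
     "eval2 s' p q \<noteq> 0" "C dvd s' * h - t' * \<pi> ^ n" "eval2 t' p q \<noteq> 0"
    by (auto simp: exact_def)
  moreover have "s * s' * (g * h) - t * t' * \<pi> ^ (m + n)
     = (s * g - t * \<pi> ^ m) * (s' * h) + (t * \<pi> ^ m) * (s' * h - t' * \<pi> ^ n)"
    by (simp add: algebra_simps power_add)
  ultimately show ?thesis
    by (intro exactI[of "s * s'" _ _ "t * t'"]) (auto intro: dvd_add)
qed

lemma exact_power: "exact C p q \<pi> m g \<Longrightarrow> exact C p q \<pi> (k * m) (g ^ k)"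
proof (induction k)
  case (Suc k)
  with exact_mult[OF Suc.prems Suc.IH[OF Suc.prems]] show ?case by simp
qed (simp add: exact_0)

lemma exact_cong: "C dvd g - h \<Longrightarrow> exact C p q \<pi> n g \<Longrightarrow> exact C p q \<pi> n h"
proof -
  assume 1: "C dvd g - h" and "exact C p q \<pi> n g"
  then obtain s t where "eval2 s p q \<noteq> 0" "C dvd s * g - t * \<pi> ^ n" "eval2 t p q \<noteq> 0"
    by (auto simp: exact_def)
  moreover have "s * h - t * \<pi> ^ n = (s * g - t * \<pi> ^ n) - s * (g - h)"
    by (simp add: algebra_simps)
  ultimately show ?thesis using 1
    by (intro exactI[of s _ _ t]) (simp_all only: dvd_diff dvd_mult simp_thms)
qed

lemma is_ideal_vanish: "is_ideal {h. vanish C p q \<pi> n h}"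
  unfolding is_ideal_def
proof (intro conjI ballI allI)
  show "0 \<in> {h. vanish C p q \<pi> n h}"
    by (auto intro!: vanishI[of 1 _ _ _ _ 0])
next
  fix g h assume "g \<in> {h. vanish C p q \<pi> n h}" "h \<in> {h. vanish C p q \<pi> n h}"
  then obtain s t s' t' where "eval2 s p q \<noteq> 0" "C dvd s * g - t * \<pi> ^ n"
     "eval2 s' p q \<noteq> 0" "C dvd s' * h - t' * \<pi> ^ n"
    by (auto simp: vanish_def)
  moreover have "s * s' * (g + h) - (s' * t + s * t') * \<pi> ^ n
     = s' * (s * g - t * \<pi> ^ n) + s * (s' * h - t' * \<pi> ^ n)"
    by (simp add: algebra_simps)
  ultimately have "vanish C p q \<pi> n (g + h)"
    by (intro vanishI[of "s * s'" _ _ _ _ "s' * t + s * t'"]) (auto intro!: dvd_add)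
  thus "g + h \<in> {h. vanish C p q \<pi> n h}" by simp
next
  fix g r assume "g \<in> {h. vanish C p q \<pi> n h}"
  then obtain s t where "eval2 s p q \<noteq> 0" "C dvd s * g - t * \<pi> ^ n"
    by (auto simp: vanish_def)
  moreover have "s * (r * g) - (r * t) * \<pi> ^ n = r * (s * g - t * \<pi> ^ n)"
    by (simp add: algebra_simps)
  ultimately have "vanish C p q \<pi> n (r * g)"
    by (intro vanishI[of s _ _ _ _ "r * t"]) auto
  thus "r * g \<in> {h. vanish C p q \<pi> n h}" by simp
qed

lemma vanish_mult_left: "vanish C p q \<pi> n h \<Longrightarrow> vanish C p q \<pi> n (r * h)"
  using is_ideal_vanish[of C p q \<pi> n] by (auto simp: is_ideal_def)

lemma vanish_unit: "eval2 s p q \<noteq> 0 \<Longrightarrow> vanish C p q \<pi> n (s * h) \<Longrightarrow> vanish C p q \<pi> n h"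
proof -
  assume "eval2 s p q \<noteq> 0" "vanish C p q \<pi> n (s * h)"
  then obtain s' t where "eval2 s' p q \<noteq> 0" "C dvd s' * (s * h) - t * \<pi> ^ n"
    by (auto simp: vanish_def)
  thus ?thesis using \<open>eval2 s p q \<noteq> 0\<close>
    by (intro vanishI[of "s' * s" _ _ _ _ t]) (simp_all add: mult.assoc)
qed

lemma vanish_mono: "vanish C p q \<pi> n h \<Longrightarrow> m \<le> n \<Longrightarrow> vanish C p q \<pi> m h"
proof -
  assume "vanish C p q \<pi> n h" and mn: "m \<le> n"
  then obtain s t where "eval2 s p q \<noteq> 0" "C dvd s * h - t * \<pi> ^ n"
    by (auto simp: vanish_def)
  moreover have "\<pi> ^ n = \<pi> ^ (n - m) * \<pi> ^ m"
    using mn by (simp flip: power_add)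
  ultimately show ?thesis
    by (intro vanishI[of s _ _ _ _ "t * \<pi> ^ (n - m)"]) (simp_all add: mult.assoc)
qed

lemma exact_imp_vanish: "exact C p q \<pi> n h \<Longrightarrow> vanish C p q \<pi> n h"
  by (auto simp: exact_def vanish_def)

lemma vanish_power: "vanish C p q \<pi> m g \<Longrightarrow> vanish C p q \<pi> (k * m) (g ^ k)"
proof (induction k)
  case (Suc k)
  with vanish_mult[OF Suc.prems Suc.IH[OF Suc.prems]] show ?case by simp
qed (simp add: exact_imp_vanish exact_0)

text \<open>Abstracts what makes the local ring a discrete valuation ring: \<open>\<pi>\<close>
  generates the maximal ideal and is not a zero divisor modulo \<open>C\<close>. Affine points and
  \<open>O\<close> are both instances.\<close>

locale smooth_point =
  fixes C :: "'a::field poly poly" and p q :: 'a and \<pi> :: "'a poly poly"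
  assumes on_curve: "eval2 C p q = 0"
    and pi_cases: "\<pi> = [:[:- p, 1:]:] \<or> \<pi> = [:[:- q:], 1:]"
    and vanish_x: "vanish C p q \<pi> 1 [:[:- p, 1:]:]"
    and vanish_y: "vanish C p q \<pi> 1 [:[:- q:], 1:]"
    and regular: "\<And>h. C dvd \<pi> * h \<Longrightarrow> C dvd h"
begin

lemma eval2_pi: "eval2 \<pi> p q = 0"
  using pi_cases by auto

lemma regular_power: "C dvd \<pi> ^ n * h \<Longrightarrow> C dvd h"
proof (induction n)
  case (Suc n)
  from Suc.prems have "C dvd \<pi> * (\<pi> ^ n * h)" by (simp add: mult.assoc)
  thus ?case by (rule Suc.IH[OF regular])
qed simp

text \<open>Both coordinates are multiples of \<open>\<pi>\<close> in the local ring, so every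
  \<open>d\<close>-fold product of them is a multiple of \<open>\<pi> ^ d\<close>. Conversely
  \<open>\<pi>\<close> is one of the coordinates, so \<open>\<pi> ^ d\<close> is itself a
  generator.\<close>

lemma mem_gen_iff_vanish:
  "(\<exists>s. eval2 s p q \<noteq> 0 \<and>
       s * h \<in> ideal_gen (insert C {[:[:- p, 1:]:] ^ i * [:[:- q:], 1:] ^ (d - i) | i. i \<le> d}))
   \<longleftrightarrow> vanish C p q \<pi> d h" (is "?L \<longleftrightarrow> ?R")
proof
  assume ?L
  then obtain s where s: "eval2 s p q \<noteq> 0"
    "s * h \<in> ideal_gen (insert C {[:[:- p, 1:]:] ^ i * [:[:- q:], 1:] ^ (d - i) | i. i \<le> d})" by blast
  have "vanish C p q \<pi> d ([:[:- p, 1:]:] ^ i * [:[:- q:], 1:] ^ (d - i))" if "i \<le> d" for i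
    using vanish_mult[OF vanish_power[OF vanish_x, of i] vanish_power[OF vanish_y, of "d - i"]] that
    by simp
  hence "ideal_gen (insert C {[:[:- p, 1:]:] ^ i * [:[:- q:], 1:] ^ (d - i) | i. i \<le> d})
      \<subseteq> {h. vanish C p q \<pi> d h}"
    by (intro ideal_gen_least is_ideal_vanish) (auto intro: vanishI[of 1 _ _ _ _ 0])
  with s have "vanish C p q \<pi> d (s * h)" by blast
  with s(1) show ?R by (rule vanish_unit)
next
  assume ?R
  then obtain s t where st: "eval2 s p q \<noteq> 0" "C dvd s * h - t * \<pi> ^ d"
    by (auto simp: vanish_def)
  let ?I = "ideal_gen (insert C {[:[:- p, 1:]:] ^ i * [:[:- q:], 1:] ^ (d - i) | i. i \<le> d})"
  \<comment> \<open>\<open>i = d\<close> if \<open>\<pi>\<close> is \<open>x - p\<close>, and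
    \<open>i = 0\<close> if it is \<open>y - q\<close>.\<close>
  have "\<exists>i\<le>d. \<pi> ^ d = [:[:- p, 1:]:] ^ i * [:[:- q:], 1:] ^ (d - i)"
    using pi_cases by (elim disjE) (force intro: exI[of _ d], force intro: exI[of _ 0])
  hence "\<pi> ^ d \<in> ?I" by (intro ideal_gen_incl) auto
  moreover have "C \<in> ?I" by (intro ideal_gen_incl) auto
  ultimately have "t * \<pi> ^ d + (s * h - t * \<pi> ^ d) \<in> ?I"
    using st by (intro is_ideal_add is_ideal_ideal_gen)
       (auto intro: is_ideal_mult is_ideal_dvd is_ideal_ideal_gen)
  thus ?L using st(1) by (auto intro!: exI[of _ s])
qed

lemma local_ord_eq: "local_ord C p q h = Sup {enat d | d. vanish C p q \<pi> d h}"
  by (simp only: local_ord_def mem_gen_iff_vanish)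

text \<open>The supremum is attained because vanishing is downward closed in the exponent: if
  \<open>n\<close> fails, all admissible exponents are at most \<open>n - 1\<close>, and
  \<open>n\<close> is positive since exponent 0 never fails.\<close>

lemma local_ord_ge_iff: "enat n \<le> local_ord C p q h \<longleftrightarrow> vanish C p q \<pi> n h"
proof
  assume "vanish C p q \<pi> n h"
  thus "enat n \<le> local_ord C p q h"
    unfolding local_ord_eq by (intro Sup_upper) auto
next
  assume *: "enat n \<le> local_ord C p q h"
  show "vanish C p q \<pi> n h"
  proof (rule ccontr)
    assume no: "\<not> vanish C p q \<pi> n h"
    have n0: "n \<noteq> 0"
      using no by (metis vanishI cancel_comm_monoid_add_class.diff_cancel dvd_0_right eval2_simps(2)
          mult.right_neutral mult_1 one_neq_zero power_0)
    have "Sup {enat d | d. vanish C p q \<pi> d h} \<le> enat (n - 1)"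
    proof (rule Sup_least)
      fix x assume "x \<in> {enat d | d. vanish C p q \<pi> d h}"
      then obtain d where d: "x = enat d" "vanish C p q \<pi> d h" by auto
      hence "\<not> n \<le> d" using no vanish_mono by blast
      thus "x \<le> enat (n - 1)" using d by auto
    qed
    hence "enat n \<le> enat (n - 1)" using * unfolding local_ord_eq by (rule order.trans[rotated])
    thus False using n0 by simp
  qed
qed

text \<open>Eliminating \<open>h\<close> between the two relations and cancelling
  \<open>\<pi> ^ m\<close> leaves \<open>C dvd s' * t - s * t' * \<pi>\<close>; at the point the
  first summand is non-zero and \<open>\<pi>\<close> vanishes.\<close>

lemma exact_not_vanish:
  assumes "exact C p q \<pi> m h" "m < n"
  shows "\<not> vanish C p q \<pi> n h"
proof
  assume "vanish C p q \<pi> n h"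
  hence "vanish C p q \<pi> (Suc m) h" using assms(2) by (auto intro: vanish_mono)
  then obtain s t s' t' where h: "eval2 s p q \<noteq> 0" "C dvd s * h - t * \<pi> ^ m" "eval2 t p q \<noteq> 0"
     "eval2 s' p q \<noteq> 0" "C dvd s' * h - t' * \<pi> ^ Suc m"
    using assms(1) by (auto simp: vanish_def exact_def)
  have "\<pi> ^ m * (s' * t - s * t' * \<pi>) = s * (s' * h - t' * \<pi> ^ Suc m) - s' * (s * h - t * \<pi> ^ m)"
    by (simp add: algebra_simps)
  hence "C dvd \<pi> ^ m * (s' * t - s * t' * \<pi>)" using h by (auto intro!: dvd_diff)
  hence "C dvd s' * t - s * t' * \<pi>" by (rule regular_power)
  hence "eval2 (s' * t - s * t' * \<pi>) p q = 0" using on_curve eval2_dvd_0 by blast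
  thus False using h by (simp add: eval2_pi)
qed

lemma local_ord_exact: "exact C p q \<pi> n h \<Longrightarrow> local_ord C p q h = enat n"
proof (rule antisym)
  assume e: "exact C p q \<pi> n h"
  show "local_ord C p q h \<le> enat n"
    using exact_not_vanish[OF e, of "Suc n"]
    by (metis enat_ord_simps(2) lessI local_ord_ge_iff not_le_imp_less order_less_imp_le
        enat_ile ileI1 eSuc_enat)
  show "enat n \<le> local_ord C p q h"
    using e by (simp add: local_ord_ge_iff exact_imp_vanish)
qed

end

section \<open>The affine curve\<close>

lemma root_factor: "poly b (p::'a::comm_ring_1) = 0 \<Longrightarrow> \<exists>c. b = [:- p, 1:] * c"
  by (simp only: poly_eq_0_iff_dvd dvd_def)

lemma dvd_diff_swap: "(a::'a::comm_ring_1) dvd x - y \<Longrightarrow> a dvd y - x"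
  by (metis dvd_minus_iff minus_diff_eq)

lemma const_poly_mult: "[:a:] * [:b:] = [:a * b :: 'a::comm_ring_1:]"
  by simp

locale elliptic =
  fixes f :: "'a::alg_closed_field poly"
  assumes two_neq_0: "(2::'a) \<noteq> 0"
    and degree_f: "degree f = 3"
    and coeff_f: "coeff f 3 = 1"
    and squarefree_f: "rsquarefree f"
begin

definition C :: "'a poly poly" where "C = curve_eq f"

lemma C_eq: "C = [:- f, 0, 1:]"
  by (simp add: C_def curve_eq_def)

lemma f_neq_0: "f \<noteq> 0"
  using degree_f by auto

lemma C_dvd_deg1: "C dvd [:b0, b1:] \<longleftrightarrow> b0 = 0 \<and> b1 = 0"
proof
  assume d: "C dvd [:b0, b1:]"
  have "[:b0, b1:] = 0"
  proof (rule ccontr)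
    assume "[:b0, b1:] \<noteq> 0"
    with d have "degree C \<le> degree [:b0, b1:]" by (rule dvd_imp_degree_le)
    thus False by (simp add: C_eq split: if_splits)
  qed
  thus "b0 = 0 \<and> b1 = 0" by simp
qed auto

text \<open>Multiplication by \<open>y\<close> turns \<open>b0 + b1 * y\<close> into
  \<open>f * b1 + b0 * y\<close> modulo the curve.\<close>

lemma reduced_form: "\<exists>b0 b1. C dvd h - [:b0, b1:]"
proof (induction h)
  case 0
  show ?case by (intro exI[of _ 0]) simp
next
  case (pCons c h)
  then obtain b0 b1 where "C dvd h - [:b0, b1:]" by blast
  hence "C dvd [:0, 1:] * (h - [:b0, b1:]) + [:b1:] * C" 
    by (simp only: dvd_add dvd_mult dvd_refl)
  moreover have "[:0, 1:] * (h - [:b0, b1:]) + [:b1:] * C = pCons c h - [:c + f * b1, b0:]"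
    by (simp add: C_eq algebra_simps)
  ultimately show ?case by metis
qed

section \<open>The norm to \<open>K[x]\<close>\<close>

definition redform :: "'a poly poly \<Rightarrow> 'a poly \<times> 'a poly" where
  "redform h = (SOME B. C dvd h - [:fst B, snd B:])"

definition nrm :: "'a poly poly \<Rightarrow> 'a poly" where
  "nrm h = fst (redform h) ^ 2 - f * snd (redform h) ^ 2"

lemma redform: "C dvd h - [:fst (redform h), snd (redform h):]"
  unfolding redform_def by (rule someI_ex) (use reduced_form[of h] in auto)

lemma redform_eq:
  assumes "C dvd h - [:b0, b1:]"
  shows "redform h = (b0, b1)"
proof -
  have "C dvd (h - [:b0, b1:]) - (h - [:fst (redform h), snd (redform h):])"
    using assms redform by (rule dvd_diff)
  hence "C dvd [:fst (redform h) - b0, snd (redform h) - b1:]" by simp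
  thus ?thesis by (simp add: C_dvd_deg1 prod_eq_iff)
qed

lemma nrm_eq: "C dvd h - [:b0, b1:] \<Longrightarrow> nrm h = b0 ^ 2 - f * b1 ^ 2"
  by (simp add: nrm_def redform_eq)

lemma nrm_reduced [simp]: "nrm [:b0, b1:] = b0 ^ 2 - f * b1 ^ 2"
  by (rule nrm_eq) simp

lemma nrm_const [simp]: "nrm [:b:] = b ^ 2"
  using nrm_reduced[of b 0] by simp

lemma C_dvd_trans: "C dvd g - h \<Longrightarrow> C dvd h - k \<Longrightarrow> C dvd g - k"
  using dvd_add[of C "g - h" "h - k"] by simp

lemma nrm_cong: "C dvd g - h \<Longrightarrow> nrm g = nrm h"
  using redform[of h] C_dvd_trans nrm_eq by (metis nrm_def)

lemma nrm_mult: "nrm (g * h) = nrm g * nrm h"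
proof -
  obtain a0 a1 where g: "C dvd g - [:a0, a1:]" using reduced_form by blast
  obtain b0 b1 where h: "C dvd h - [:b0, b1:]" using reduced_form by blast
  have "g * h - [:a0 * b0 + f * a1 * b1, a0 * b1 + a1 * b0:]
     = (g - [:a0, a1:]) * h + [:a0, a1:] * (h - [:b0, b1:]) + [:a1 * b1:] * C"
    by (simp add: C_eq algebra_simps)
  also have "C dvd \<dots>" using g h by (simp only: dvd_add dvd_mult dvd_mult2 dvd_refl)
  finally have "nrm (g * h) = (a0 * b0 + f * a1 * b1) ^ 2 - f * (a0 * b1 + a1 * b0) ^ 2"
    by (rule nrm_eq)
  also have "\<dots> = (a0 ^ 2 - f * a1 ^ 2) * (b0 ^ 2 - f * b1 ^ 2)"
    by (simp add: power2_eq_square algebra_simps)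
  finally show ?thesis using g h by (simp add: nrm_eq)
qed

text \<open>The two squares have leading terms in degrees of different parity.\<close>

lemma nrm_degree_reduced:
  "b1 = 0 \<Longrightarrow> degree (b0 ^ 2 - f * b1 ^ 2) = 2 * degree b0"
  "b1 \<noteq> 0 \<Longrightarrow> 2 * degree b0 < 3 + 2 * degree b1 \<Longrightarrow> degree (b0 ^ 2 - f * b1 ^ 2) = 3 + 2 * degree b1"
  "b1 \<noteq> 0 \<Longrightarrow> 2 * degree b0 > 3 + 2 * degree b1 \<Longrightarrow> degree (b0 ^ 2 - f * b1 ^ 2) = 2 * degree b0"
proof -
  have b0: "degree (b0 ^ 2) = 2 * degree b0" by (cases "b0 = 0") (simp_all add: degree_power_eq)
  {assume b1: "b1 \<noteq> 0"
  hence d: "degree (f * b1 ^ 2) = 3 + 2 * degree b1"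
    using f_neq_0 by (simp add: degree_mult_eq degree_power_eq degree_f)
  show "2 * degree b0 < 3 + 2 * degree b1 \<Longrightarrow> degree (b0 ^ 2 - f * b1 ^ 2) = 3 + 2 * degree b1"
    using b0 d degree_add_eq_right[of "b0 ^ 2" "- (f * b1 ^ 2)"] by simp
  show "2 * degree b0 > 3 + 2 * degree b1 \<Longrightarrow> degree (b0 ^ 2 - f * b1 ^ 2) = 2 * degree b0"
    using b0 d degree_add_eq_left[of "- (f * b1 ^ 2)" "b0 ^ 2"] by simp }
  show "b1 = 0 \<Longrightarrow> degree (b0 ^ 2 - f * b1 ^ 2) = 2 * degree b0"
    using b0 by simp
qed

lemma parity_cases:
  fixes b0 b1 :: "'a poly"
  obtains "b1 = 0" | "b1 \<noteq> 0" "2 * degree b0 < 3 + 2 * degree b1"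
    | "b1 \<noteq> 0" "2 * degree b0 > 3 + 2 * degree b1"
proof -
  have "2 * degree b0 \<noteq> 3 + 2 * degree b1" by presburger
  hence "2 * degree b0 < 3 + 2 * degree b1 \<or> 2 * degree b0 > 3 + 2 * degree b1" by linarith
  thus ?thesis using that by blast
qed

text \<open>By parity the norm has positive degree as soon as \<open>b1\<close> is non-zero;
  otherwise it is the square \<open>b0 ^ 2\<close>.\<close>

lemma nrm_eq_0_iff: "nrm h = 0 \<longleftrightarrow> C dvd h"
proof -
  obtain b0 b1 where h: "C dvd h - [:b0, b1:]" using reduced_form by blast
  have "b0 ^ 2 - f * b1 ^ 2 = 0 \<longleftrightarrow> b0 = 0 \<and> b1 = 0"
  proof
    assume *: "b0 ^ 2 - f * b1 ^ 2 = 0"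
    show "b0 = 0 \<and> b1 = 0"
    proof (cases rule: parity_cases[where ?b0.0 = b0 and ?b1.0 = b1])
      case 1 with * show ?thesis by simp
    next
      case 2 with nrm_degree_reduced(2)[OF this] * show ?thesis by simp
    next
      case 3 with nrm_degree_reduced(3)[OF this] * show ?thesis by simp
    qed
  qed auto
  hence "nrm h = 0 \<longleftrightarrow> C dvd [:b0, b1:]" using h by (simp add: nrm_eq C_dvd_deg1)
  also have "\<dots> \<longleftrightarrow> C dvd h"
    using h by (metis dvd_add_right_iff diff_add_cancel)
  finally show ?thesis .
qed

text \<open>The norm is multiplicative with values in a domain and vanishes exactly on the multiples
  of \<open>C\<close>.\<close>

lemma C_prime: "C dvd g * h \<longleftrightarrow> C dvd g \<or> C dvd h"
  by (simp flip: nrm_eq_0_iff add: nrm_mult)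

lemma C_not_dvd_1: "\<not> C dvd 1"
  using C_dvd_deg1[of 1 0] by (simp add: one_pCons)

lemma C_dvd_const [simp]: "C dvd [:b:] \<longleftrightarrow> b = 0"
  using C_dvd_deg1[of b 0] by simp

section \<open>Conjugation, the counterpart of \<open>iota\<close> on functions\<close>

definition cj :: "'a poly poly \<Rightarrow> 'a poly poly" where
  "cj h = pcompose h [:0, -1:]"

lemma cj_simps [simp]:
  "cj (g * h) = cj g * cj h" "cj (g + h) = cj g + cj h" "cj (g - h) = cj g - cj h"
  "cj (g ^ n) = cj g ^ n" "cj [:b0, b1:] = [:b0, - b1:]" "cj [:b0:] = [:b0:]"
  by (simp_all add: cj_def pcompose_mult pcompose_add pcompose_diff pcompose_pCons)
   (induction n; simp add: pcompose_mult pcompose_1)+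

lemma cj_C: "cj C = C"
  by (simp add: C_eq cj_def pcompose_pCons)

lemma cj_dvd: "C dvd h \<Longrightarrow> C dvd cj h"
  by (metis cj_C cj_simps(1) dvd_def)

lemma eval2_cj: "eval2 (cj h) p q = eval2 h p (- q)"
  by (simp add: eval2_def cj_def poly_pcompose)

lemma mult_cj: "C dvd h * cj h - [:nrm h:]"
proof -
  obtain b0 b1 where h: "C dvd h - [:b0, b1:]" using reduced_form by blast
  from cj_dvd[OF h] have h': "C dvd cj h - [:b0, - b1:]" by simp
  have "h * cj h - [:nrm h:] = (h - [:b0, b1:]) * cj h + [:b0, b1:] * (cj h - [:b0, - b1:]) + [:- (b1 ^ 2):] * C"
    using h by (simp add: nrm_eq C_eq algebra_simps power2_eq_square)
  also have "C dvd \<dots>" using h h' by (simp only: dvd_add dvd_mult dvd_mult2 dvd_refl)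
  finally show ?thesis .
qed

lemma nrm_cj: "nrm (cj h) = nrm h"
proof -
  obtain b0 b1 where h: "C dvd h - [:b0, b1:]" using reduced_form by blast
  from cj_dvd[OF h] have "C dvd cj h - [:b0, - b1:]" by simp
  with h show ?thesis by (simp add: nrm_eq)
qed

lemma not_dvd_cj: "\<not> C dvd h \<Longrightarrow> \<not> C dvd cj h"
  by (simp flip: nrm_eq_0_iff add: nrm_cj)

text \<open>Where \<open>q = 0\<close> the tangent is vertical and \<open>y\<close> is a local
  parameter; elsewhere \<open>x - p\<close> is one.\<close>

definition unif :: "'a \<Rightarrow> 'a \<Rightarrow> 'a poly poly" where
  "unif p q = (if q = 0 then [:0, 1:] else [:[:- p, 1:]:])"

lemma eval2_C: "eval2 C p q = q ^ 2 - poly f p"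
  by (simp add: C_eq power2_eq_square)

lemma f_factor:
  assumes "poly f p = 0"
  obtains f1 where "f = [:- p, 1:] * f1" "poly f1 p \<noteq> 0"
proof -
  from assms obtain f1 where f1: "f = [:- p, 1:] * f1"
    using root_factor by blast
  have "poly f1 p \<noteq> 0"
  proof
    assume "poly f1 p = 0"
    then obtain f2 where f2: "f1 = [:- p, 1:] * f2"
      using root_factor by blast
    have "f = [:- p, 1:] ^ 2 * f2"
      using f1 unfolding f2 by (simp only: power2_eq_square mult.assoc)
    hence "[:- p, 1:] ^ 2 dvd f" by (rule dvdI)
    hence "2 \<le> Polynomial.order p f" using f_neq_0 by (simp only: order_divides simp_thms)
    thus False using squarefree_f by (auto simp: rsquarefree_def dest!: spec[of _ p])
  qed
  with f1 show ?thesis by (rule that)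
qed

text \<open>For \<open>q = 0\<close> the curve reads \<open>y ^ 2 = (x - p) * f1\<close> with
  \<open>f1\<close> a unit at \<open>p\<close>, since \<open>p\<close> is a simple root of
  \<open>f\<close>. Otherwise \<open>(y + q) * (y - q) = f - f(p)\<close> is a multiple of
  \<open>x - p\<close>, and \<open>y + q\<close> is a unit because \<open>2 * q\<close> is non-zero;
  here the characteristic enters.\<close>

lemma smooth:
  assumes "q ^ 2 = poly f p"
  shows "smooth_point C p q (unif p q)"
proof (cases "q = 0")
  case True
  then obtain f1 where f1: "f = [:- p, 1:] * f1" "poly f1 p \<noteq> 0"
    using f_factor[of p] assms by auto
  show ?thesis
  proof
    show "eval2 C p q = 0" using assms by (simp add: eval2_C)
    show "unif p q = [:[:- p, 1:]:] \<or> unif p q = [:[:- q:], 1:]"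
      by (simp add: unif_def True)
    have "[:f1:] * [:[:- p, 1:]:] - [:0, 1:] * [:0, 1:] = - C"
      unfolding const_poly_mult mult.commute[of f1] f1(1)[symmetric] by (simp add: C_eq)
    thus "vanish C p q (unif p q) 1 [:[:- p, 1:]:]"
      using f1(2) True by (intro vanishI[of "[:f1:]" _ _ _ _ "[:0, 1:]"]) (auto simp: unif_def)
    show "vanish C p q (unif p q) 1 [:[:- q:], 1:]"
      by (intro vanishI[of 1 _ _ _ _ 1]) (auto simp: unif_def True)
    show "C dvd h" if "C dvd unif p q * h" for h
    proof -
      from that have "C dvd [:0, 1:] \<or> C dvd h" by (simp only: unif_def True C_prime if_True simp_thms)
      thus ?thesis by (simp add: C_dvd_deg1)
    qed
  qed
next
  case False
  have "poly (f - [:poly f p:]) p = 0" by simp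
  from root_factor[OF this] obtain g where g: "f - [:poly f p:] = [:- p, 1:] * g" by blast
  show ?thesis
  proof
    show "eval2 C p q = 0" using assms by (simp add: eval2_C)
    show "unif p q = [:[:- p, 1:]:] \<or> unif p q = [:[:- q:], 1:]"
      by (simp add: unif_def False)
    show "vanish C p q (unif p q) 1 [:[:- p, 1:]:]"
      by (intro vanishI[of 1 _ _ _ _ 1]) (auto simp: unif_def False)
    have "[:[:q:], 1:] * [:[:- q:], 1:] - [:g:] * [:[:- p, 1:]:] = [:[:- (q * q):] - [:- p, 1:] * g, 0, 1:]"
      by (simp add: mult.commute)
    also have "\<dots> = C" using assms unfolding g[symmetric] by (simp add: C_eq power2_eq_square)
    finally show "vanish C p q (unif p q) 1 [:[:- q:], 1:]"
      using False two_neq_0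
      by (intro vanishI[of "[:[:q:], 1:]" _ _ _ _ "[:g:]"]) (auto simp: unif_def simp flip: mult_2)
    show "C dvd h" if "C dvd unif p q * h" for h
      using that C_dvd_const[of "[:- p, 1:]"] by (simp only: unif_def False C_prime if_False) simp
  qed
qed

text \<open>Meaningful when \<open>C\<close> does not divide \<open>h\<close>; then
  \<open>xct_ex\<close> shows that the order is finite.\<close>

definition ao :: "'a \<Rightarrow> 'a \<Rightarrow> 'a poly poly \<Rightarrow> nat" where
  "ao p q h = the_enat (local_ord C p q h)"

abbreviation xct :: "'a \<Rightarrow> 'a \<Rightarrow> nat \<Rightarrow> 'a poly poly \<Rightarrow> bool" where
  "xct p q \<equiv> exact C p q (unif p q)"

text \<open>The factor 2 is the ramification of the \<open>x\<close>-coordinate at fixed points of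
  \<open>iota\<close>, where \<open>x - p\<close> is \<open>y ^ 2\<close> up to a unit.\<close>

lemma xct_const:
  assumes "q ^ 2 = poly f p" "b \<noteq> 0"
  shows "xct p q ((if q = 0 then 2 else 1) * Polynomial.order p b) [:b:]"
proof -
  obtain b' where b': "b = [:- p, 1:] ^ Polynomial.order p b * b'" "\<not> [:- p, 1:] dvd b'"
    using order_decomp[OF assms(2)] by blast
  hence b'p: "eval2 [:b':] p q \<noteq> 0" by (simp add: poly_eq_0_iff_dvd)
  have "xct p q (if q = 0 then 2 else 1) [:[:- p, 1:]:]"
  proof (cases "q = 0")
    case True
    then obtain f1 where f1: "f = [:- p, 1:] * f1" "poly f1 p \<noteq> 0"
      using f_factor[of p] assms by auto
    have "[:f1:] * [:[:- p, 1:]:] - 1 * [:0, 1:] ^ 2 = - C"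
      unfolding const_poly_mult mult.commute[of f1] f1(1)[symmetric] by (simp add: C_eq power2_eq_square)
    thus ?thesis
      using f1(2) True by (intro exactI[of "[:f1:]" _ _ 1]) (auto simp: unif_def)
  next
    case False
    thus ?thesis by (intro exactI[of 1 _ _ 1]) (auto simp: unif_def)
  qed
  from exact_mult[OF exact_power[OF this] exact_0[OF b'p]]
  have "xct p q (Polynomial.order p b * (if q = 0 then 2 else 1)) ([:[:- p, 1:]:] ^ Polynomial.order p b * [:b':])"
    by simp
  also have "[:[:- p, 1:]:] ^ Polynomial.order p b * [:b':] = [:b:]"
    by (simp only: poly_const_pow const_poly_mult b'(1)[symmetric])
  finally show ?thesis by (simp add: mult.commute)
qed

lemma xct_cj:
  assumes "xct p q n h"
  shows "xct p (- q) n (cj h)"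
proof -
  from assms obtain s t where st: "eval2 s p q \<noteq> 0" "eval2 t p q \<noteq> 0" "C dvd s * h - t * unif p q ^ n"
    by (auto simp: exact_def)
  from cj_dvd[OF st(3)] have d: "C dvd cj s * cj h - cj t * cj (unif p q) ^ n" by simp
  have "cj (unif p q) = (if q = 0 then -1 else 1) * unif p (- q)"
    by (simp add: unif_def)
  hence "cj (unif p q) ^ n = (if q = 0 then -1 else 1) ^ n * unif p (- q) ^ n"
    by (metis power_mult_distrib)
  with d have "C dvd cj s * cj h - cj t * (if q = 0 then -1 else 1) ^ n * unif p (- q) ^ n"
    by (simp add: mult.assoc)
  thus ?thesis using st by (intro exactI[of "cj s" _ _ "cj t * (if q = 0 then -1 else 1) ^ n"])
    (auto simp: eval2_cj)
qed

text \<open>Suppose the function vanishes at the point. If \<open>q = 0\<close>, then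
  \<open>b0\<close> vanishes at \<open>p\<close> and contributes order at least 2, while
  \<open>b1 * y\<close> has order exactly 1. If \<open>q \<noteq> 0\<close>, the conjugate has the
  value \<open>- 2 * q * b1(p)\<close> and is a unit, so the order is that of the norm, a polynomial
  in \<open>x\<close>.\<close>

lemma xct_primitive:
  assumes c: "q ^ 2 = poly f p" and nz: "\<not> (poly b0 p = 0 \<and> poly b1 p = 0)"
  shows "\<exists>n. xct p q n [:b0, b1:]"
proof (cases "eval2 [:b0, b1:] p q = 0")
  case False
  thus ?thesis using exact_0 by blast
next
  case True
  hence e: "poly b0 p + q * poly b1 p = 0" by simp
  hence b1: "poly b1 p \<noteq> 0" using nz by auto
  show ?thesis
  proof (cases "q = 0")
    case q: True
    then obtain f1 where f1: "f = [:- p, 1:] * f1" "poly f1 p \<noteq> 0"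
      using f_factor[of p] c by auto
    from e q obtain b where b: "b0 = [:- p, 1:] * b" using root_factor[of b0 p] by auto
    have "f1 * b0 = f * b" unfolding b mult.assoc[symmetric] mult.commute[of f1] f1(1)[symmetric] ..
    hence "[:f1:] * [:b0, b1:] - [:f1 * b1, b:] * [:0, 1:] = [:- b:] * C"
      by (simp add: C_eq mult.commute)
    hence "xct p q 1 [:b0, b1:]"
      using f1(2) b1 q by (intro exactI[of "[:f1:]" _ _ "[:f1 * b1, b:]"]) (auto simp: unif_def dvd_smult)
    thus ?thesis ..
  next
    case q: False
    let ?N = "nrm [:b0, b1:]"
    have N: "?N \<noteq> 0" unfolding nrm_eq_0_iff C_dvd_deg1 using b1 by auto
    from xct_const[OF c N] obtain n where n: "xct p q n [:?N:]" by blast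
    have "xct p q n ([:b0, b1:] * [:b0, - b1:])"
      by (rule exact_cong[OF _ n]) (rule dvd_diff_swap, rule mult_cj[of "[:b0, b1:]", unfolded cj_simps])
    then obtain s t where st: "eval2 s p q \<noteq> 0" "eval2 t p q \<noteq> 0"
        "C dvd s * ([:b0, b1:] * [:b0, - b1:]) - t * unif p q ^ n"
      by (auto simp: exact_def)
    have "poly b0 p = - (q * poly b1 p)" using e by (simp add: eq_neg_iff_add_eq_0)
    hence "eval2 [:b0, - b1:] p q = - (2 * q * poly b1 p)" by simp
    hence nz2: "eval2 [:b0, - b1:] p q \<noteq> 0" using q b1 two_neq_0 by (simp del: eval2_simps)
    with st nz2 have "xct p q n [:b0, b1:]"
      by (intro exactI[of "s * [:b0, - b1:]" _ _ t])
         (simp_all only: eval2_simps(6) mult_eq_0_iff mult.assoc mult.commute[of "[:b0, b1:]"] simp_thms)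
    thus ?thesis ..
  qed
qed

text \<open>Common factors \<open>x - p\<close> are split off until \<open>b0\<close> or
  \<open>b1\<close> is non-zero at \<open>p\<close>. The sum of the degrees drops even if one of the
  two polynomials is zero.\<close>

lemma xct_reduced:
  assumes c: "q ^ 2 = poly f p" and "b0 \<noteq> 0 \<or> b1 \<noteq> 0"
  shows "\<exists>n. xct p q n [:b0, b1:]"
  using assms(2)
proof (induction "degree b0 + degree b1" arbitrary: b0 b1 rule: less_induct)
  case less
  show ?case
  proof (cases "poly b0 p = 0 \<and> poly b1 p = 0")
    case False
    thus ?thesis by (rule xct_primitive[OF c])
  next
    case True
    then obtain c0 c1 where c01: "b0 = [:- p, 1:] * c0" "b1 = [:- p, 1:] * c1"
      using root_factor by blast
    have d: "degree ([:- p, 1:] * c') = Suc (degree c')" if "c' \<noteq> 0" for c' :: "'a poly"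
      using that by (subst degree_mult_eq) auto
    have nz: "c0 \<noteq> 0 \<or> c1 \<noteq> 0" using less.prems c01 by auto
    hence "degree c0 + degree c1 < degree b0 + degree b1"
      using d[of c0] d[of c1] unfolding c01 by (cases "c0 = 0"; cases "c1 = 0") auto
    then obtain n where n: "xct p q n [:c0, c1:]" using less.hyps nz by blast
    have "[:b0, b1:] = [:[:- p, 1:]:] * [:c0, c1:]" by (simp add: c01)
    moreover obtain m where "xct p q m [:[:- p, 1:]:]" using xct_const[OF c, of "[:- p, 1:]"] by auto
    ultimately show ?thesis using exact_mult n by metis
  qed
qed

lemma xct_ex:
  assumes "q ^ 2 = poly f p" "\<not> C dvd h"
  shows "\<exists>n. xct p q n h"
proof -
  obtain b0 b1 where h: "C dvd h - [:b0, b1:]" using reduced_form by blast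
  hence "\<not> C dvd [:b0, b1:]" using assms(2) by (metis dvd_add_right_iff diff_add_cancel)
  hence "b0 \<noteq> 0 \<or> b1 \<noteq> 0" by auto
  then obtain n where "xct p q n [:b0, b1:]" using xct_reduced[OF assms(1)] by blast
  moreover have "C dvd [:b0, b1:] - h" using h by (rule dvd_diff_swap)
  ultimately show ?thesis using exact_cong by blast
qed

lemma local_ord_xct: "q ^ 2 = poly f p \<Longrightarrow> xct p q n h \<Longrightarrow> local_ord C p q h = enat n"
  using smooth smooth_point.local_ord_exact by blast

lemma ao_eq: "q ^ 2 = poly f p \<Longrightarrow> xct p q n h \<Longrightarrow> ao p q h = n"
  by (simp add: ao_def local_ord_xct)

lemma xct_ao: "q ^ 2 = poly f p \<Longrightarrow> \<not> C dvd h \<Longrightarrow> xct p q (ao p q h) h"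
  using xct_ex ao_eq by metis

lemma local_ord_ao: "q ^ 2 = poly f p \<Longrightarrow> \<not> C dvd h \<Longrightarrow> local_ord C p q h = enat (ao p q h)"
  using xct_ao local_ord_xct by metis

lemma vanish_iff: "q ^ 2 = poly f p \<Longrightarrow> enat n \<le> local_ord C p q h \<longleftrightarrow> vanish C p q (unif p q) n h"
  using smooth smooth_point.local_ord_ge_iff by blast

context
  fixes p q assumes c: "q ^ 2 = poly f p"
begin

lemma ao_mult: "\<not> C dvd g \<Longrightarrow> \<not> C dvd h \<Longrightarrow> ao p q (g * h) = ao p q g + ao p q h"
  by (intro ao_eq c exact_mult xct_ao)

lemma ao_power: "\<not> C dvd g \<Longrightarrow> ao p q (g ^ n) = n * ao p q g"
  by (intro ao_eq c exact_power xct_ao)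

lemma ao_cong: "C dvd g - h \<Longrightarrow> \<not> C dvd g \<Longrightarrow> ao p q g = ao p q h"
  using ao_eq[OF c exact_cong[OF _ xct_ao[OF c]]] by metis

lemma ao_const: "b \<noteq> 0 \<Longrightarrow> ao p q [:b:] = (if q = 0 then 2 else 1) * Polynomial.order p b"
  by (rule ao_eq[OF c xct_const[OF c]])

lemma ao_cj: "\<not> C dvd h \<Longrightarrow> ao p (- q) (cj h) = ao p q h"
  by (rule ao_eq[OF _ xct_cj]) (auto simp: c intro: xct_ao[OF c])

lemma ao_eq_0_iff: 
  assumes h: "\<not> C dvd h"
  shows "ao p q h = 0 \<longleftrightarrow> eval2 h p q \<noteq> 0"
proof
  assume "ao p q h = 0"
  with xct_ao[OF c h] obtain s t where "eval2 t p q \<noteq> 0" "C dvd s * h - t"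
    by (auto simp: exact_def)
  moreover have "eval2 C p q = 0" by (simp add: eval2_C c)
  ultimately show "eval2 h p q \<noteq> 0" using eval2_dvd_0 by fastforce
qed (auto intro: ao_eq c exact_0)

end

text \<open>The norm is \<open>h\<close> times its conjugate, and the conjugate has at one point the
  order that \<open>h\<close> has at the opposite point. For \<open>q = 0\<close> the two summands
  coincide, in accordance with the factor 2 in \<open>ao_const\<close>.\<close>

lemma ao_nrm:
  assumes c: "q ^ 2 = poly f p" and h: "\<not> C dvd h"
  shows "ao p q h + ao p (- q) h = ao p q [:nrm h:]"
proof -
  have "ao p q h + ao p q (cj h) = ao p q (h * cj h)"
    using ao_mult[OF c h not_dvd_cj[OF h]] by simp
  also have "\<dots> = ao p q [:nrm h:]"
    by (rule ao_cong[OF c mult_cj]) (simp add: C_prime h not_dvd_cj)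
  also have "ao p q (cj h) = ao p (- q) h"
    using ao_cj[OF _ h, of "- q" p] c by simp
  finally show ?thesis .
qed

end

section \<open>Homogenization\<close>

definition is_hom :: "('a::comm_ring_1 \<Rightarrow> 'b::comm_ring_1) \<Rightarrow> bool" where
  "is_hom \<phi> \<longleftrightarrow> \<phi> 0 = 0 \<and> \<phi> 1 = 1 \<and> (\<forall>x y. \<phi> (x + y) = \<phi> x + \<phi> y) \<and> (\<forall>x y. \<phi> (x * y) = \<phi> x * \<phi> y)"

lemma is_homD:
  assumes "is_hom \<phi>"
  shows "\<phi> 0 = 0" "\<phi> 1 = 1" "\<phi> (x + y) = \<phi> x + \<phi> y" "\<phi> (x * y) = \<phi> x * \<phi> y"
  using assms by (auto simp: is_hom_def)

lemma is_hom_sum: "is_hom \<phi> \<Longrightarrow> \<phi> (sum g A) = (\<Sum>i\<in>A. \<phi> (g i))"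
  by (induction A rule: infinite_finite_induct) (auto simp: is_homD)

lemma is_hom_power: "is_hom \<phi> \<Longrightarrow> \<phi> (x ^ n) = \<phi> x ^ n"
  by (induction n) (auto simp: is_homD)

lemma is_hom_diff: "is_hom \<phi> \<Longrightarrow> \<phi> (x - y) = \<phi> x - \<phi> y"
  by (metis diff_add_cancel add_diff_cancel is_homD(3))

lemma is_hom_map_poly: "is_hom \<phi> \<Longrightarrow> is_hom (map_poly \<phi>)"
  unfolding is_hom_def[of "map_poly \<phi>"]
proof (intro conjI allI)
  assume h: "is_hom \<phi>"
  fix p q :: "'a poly"
  show "map_poly \<phi> (p + q) = map_poly \<phi> p + map_poly \<phi> q"
    by (rule poly_eqI) (simp add: coeff_map_poly is_homD[OF h])
  show "map_poly \<phi> (p * q) = map_poly \<phi> p * map_poly \<phi> q"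
    by (rule poly_eqI) (simp add: coeff_map_poly coeff_mult is_hom_sum[OF h] is_homD[OF h])
qed (simp_all add: is_homD)

lemma is_hom_poly: "is_hom (\<lambda>p. poly p x)"
  by (simp add: is_hom_def)

lemma is_hom_comp: "is_hom \<phi> \<Longrightarrow> is_hom \<psi> \<Longrightarrow> is_hom (\<lambda>x. \<psi> (\<phi> x))"
  by (simp add: is_hom_def)

lemma is_hom_to_fract: "is_hom to_fract"
  by (simp add: is_hom_def)

lemma is_hom_const: "is_hom (\<lambda>a. [:a:])"
  by (simp add: is_hom_def one_pCons)

lemma monom_eq_const_mult: "monom c n = [:c:] * [:0, 1:] ^ n"
  by (simp add: monom_altdef)

lemma is_hom_poly_map_poly: "is_hom \<phi> \<Longrightarrow> is_hom (\<lambda>p. poly (map_poly \<phi> p) x)"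
  by (rule is_hom_comp[OF is_hom_map_poly is_hom_poly])

lemma poly_map_poly_altdef:
  assumes "is_hom \<phi>"
  shows "poly (map_poly \<phi> p) x = (\<Sum>i\<le>degree p. \<phi> (coeff p i) * x ^ i)"
proof -
  have "poly (map_poly \<phi> p) x = poly (map_poly \<phi> (\<Sum>i\<le>degree p. monom (coeff p i) i)) x"
    by (simp add: poly_as_sum_of_monoms)
  also have "\<dots> = (\<Sum>i\<le>degree p. \<phi> (coeff p i) * x ^ i)"
    using is_homD[OF assms] by (simp add: is_hom_sum[OF is_hom_poly_map_poly[OF assms]] map_poly_monom poly_monom)
  finally show ?thesis .
qed

text \<open>Substitutes \<open>T/Z\<close> and \<open>X/Z\<close> in the fraction field.
  Homogenization is not additive, but this substitution is a ring homomorphism, so identities are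
  transported by it and multiplied by powers of \<open>Z\<close> afterwards.\<close>

definition dehom :: "'a::field poly poly \<Rightarrow> 'a poly poly poly fract" where
  "dehom h = poly (map_poly (\<lambda>c. poly (map_poly (\<lambda>a. to_fract [:[:[:a:]:]:]) c)
       (to_fract [:[:[:0, 1:]:]:] / to_fract [:0, 1:])) h) (to_fract [:[:0, 1:]:] / to_fract [:0, 1:])"

lemma is_hom_const3: "is_hom (\<lambda>a::'a::field. to_fract [:[:[:a:]:]:])"
  by (rule is_hom_comp[OF is_hom_comp[OF is_hom_comp[OF is_hom_const is_hom_const] is_hom_const] is_hom_to_fract])

lemma is_hom_dehom: "is_hom dehom"
  unfolding dehom_def by (intro is_hom_poly_map_poly is_hom_const3)

lemma total_degree_ge: "m \<le> degree h \<Longrightarrow> l \<le> degree (coeff h m) \<Longrightarrow> l + m \<le> total_degree h"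
proof -
  assume "m \<le> degree h" "l \<le> degree (coeff h m)"
  moreover have "m + degree (coeff h m) \<le> total_degree h"
    unfolding total_degree_def using \<open>m \<le> degree h\<close> by (intro Max_ge) auto
  ultimately show ?thesis by simp
qed

lemma coeff_coeff_nz: "coeff (coeff h m) l \<noteq> 0 \<Longrightarrow> m \<le> degree h \<and> l \<le> degree (coeff h m)"
  by (metis coeff_0 le_degree)

lemma to_fract_homogenize:
  "to_fract (homogenize h) = to_fract [:0, 1:] ^ total_degree h * dehom h"
proof -
  let ?T = "to_fract [:[:[:0, 1:]:]:] :: 'a poly poly poly fract"
  let ?X = "to_fract [:[:0, 1:]:] :: 'a poly poly poly fract"
  let ?Z = "to_fract [:0, 1:] :: 'a poly poly poly fract"
  let ?k = "\<lambda>a :: 'a. to_fract [:[:[:a:]:]:]"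
  have Z: "?Z \<noteq> 0" by simp
  have "dehom h = (\<Sum>m\<le>degree h. \<Sum>l\<le>degree (coeff h m). ?k (coeff (coeff h m) l) * (?T / ?Z) ^ l * (?X / ?Z) ^ m)"
    unfolding dehom_def
    by (subst poly_map_poly_altdef[OF is_hom_poly_map_poly[OF is_hom_const3]],
        subst poly_map_poly_altdef[OF is_hom_const3]) (simp add: sum_distrib_right)
  hence "?Z ^ total_degree h * dehom h = (\<Sum>m\<le>degree h. \<Sum>l\<le>degree (coeff h m).
     ?Z ^ total_degree h * (?k (coeff (coeff h m) l) * (?T / ?Z) ^ l * (?X / ?Z) ^ m))"
    by (simp add: sum_distrib_left)
  also have "\<dots> = (\<Sum>m\<le>degree h. \<Sum>l\<le>degree (coeff h m).
     to_fract (monom (monom (monom (coeff (coeff h m) l) l) m) (total_degree h - l - m)))"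
  proof (intro sum.cong refl)
    fix m l assume "m \<in> {..degree h}" "l \<in> {..degree (coeff h m)}"
    hence "l + m \<le> total_degree h" by (intro total_degree_ge) auto
    hence e: "?Z ^ total_degree h = ?Z ^ (total_degree h - l - m) * ?Z ^ l * ?Z ^ m"
      by (simp flip: power_add)
    have m: "monom (monom (monom (coeff (coeff h m) l) l) m) (total_degree h - l - m)
       = [:[:[:coeff (coeff h m) l:]:]:] * [:[:[:0, 1:]:]:] ^ l * [:[:0, 1:]:] ^ m * [:0, 1:] ^ (total_degree h - l - m)"
      by (simp only: monom_eq_const_mult is_hom_power[OF is_hom_const] is_homD[OF is_hom_const])
    show "?Z ^ total_degree h * (?k (coeff (coeff h m) l) * (?T / ?Z) ^ l * (?X / ?Z) ^ m)
        = to_fract (monom (monom (monom (coeff (coeff h m) l) l) m) (total_degree h - l - m))"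
      unfolding m e is_homD(4)[OF is_hom_to_fract] is_hom_power[OF is_hom_to_fract]
      using Z by (simp only: power_divide) (simp add: field_simps)
  qed
  also have "\<dots> = to_fract (homogenize h)"
    unfolding homogenize_def by (simp add: is_hom_sum[OF is_hom_to_fract])
  finally show ?thesis ..
qed

text \<open>Homogenization in a prescribed degree \<open>d \<ge> total_degree h\<close>, so that
  polynomials of different total degree can be added.\<close>

definition hpad :: "nat \<Rightarrow> 'a::field poly poly \<Rightarrow> 'a poly poly poly" where
  "hpad d h = [:0, 1:] ^ (d - total_degree h) * homogenize h"

lemma to_fract_hpad: "total_degree h \<le> d \<Longrightarrow> to_fract (hpad d h) = to_fract [:0, 1:] ^ d * dehom h"
  unfolding hpad_def
  by (simp add: to_fract_homogenize is_hom_power[OF is_hom_to_fract] flip: mult.assoc power_add)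

lemma chart_Y_sum:
  "chart_Y h = (\<Sum>m\<le>degree h. \<Sum>l\<le>degree (coeff h m).
     monom (monom (coeff (coeff h m) l) l) (total_degree h - l - m))"
proof -
  have h: "is_hom (map_poly (\<lambda>c :: 'a poly poly. poly c 1))"
    by (intro is_hom_map_poly is_hom_poly)
  show ?thesis
    unfolding chart_Y_def homogenize_def is_hom_sum[OF h]
    by (simp add: map_poly_monom poly_monom)
qed

definition chart_pad :: "nat \<Rightarrow> 'a::field poly poly \<Rightarrow> 'a poly poly" where
  "chart_pad d h = [:0, 1:] ^ (d - total_degree h) * chart_Y h"

lemma map_poly_hpad: "map_poly (\<lambda>c. poly c 1) (hpad d h) = chart_pad d h"
proof -
  have h: "is_hom (map_poly (\<lambda>c :: 'a poly poly. poly c 1))"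
    by (intro is_hom_map_poly is_hom_poly)
  show ?thesis
    unfolding chart_pad_def hpad_def is_homD(4)[OF h] is_hom_power[OF h] chart_Y_def
    by (simp add: map_poly_pCons)
qed

section \<open>The point at infinity\<close>

lemma diff_dvd_power_diff: "(x - y :: 'a::comm_ring_1) dvd x ^ n - y ^ n"
proof (induction n)
  case (Suc n)
  have "x ^ Suc n - y ^ Suc n = x * (x ^ n - y ^ n) + (x - y) * y ^ n" by (simp add: algebra_simps)
  thus ?case using Suc by (metis dvd_add dvd_mult dvd_triv_left)
qed simp

text \<open>Evaluation at the point excludes \<open>m > n\<close>, since a unit would then be
  congruent to a multiple of \<open>\<pi>\<close>. At \<open>O\<close> this removes the powers of
  \<open>s\<close> introduced by padding.\<close>

lemma (in smooth_point) exact_cancel: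
  assumes "exact C p q \<pi> n (g * h)" "exact C p q \<pi> m g"
  shows "m \<le> n \<and> exact C p q \<pi> (n - m) h"
proof -
  from assms obtain s1 t1 s2 t2 where
    1: "eval2 s1 p q \<noteq> 0" "eval2 t1 p q \<noteq> 0" "C dvd s1 * (g * h) - t1 * \<pi> ^ n" and
    2: "eval2 s2 p q \<noteq> 0" "eval2 t2 p q \<noteq> 0" "C dvd s2 * g - t2 * \<pi> ^ m"
    by (auto simp: exact_def)
  have "s1 * t2 * \<pi> ^ m * h - s2 * t1 * \<pi> ^ n
      = s2 * (s1 * (g * h) - t1 * \<pi> ^ n) - (s1 * h) * (s2 * g - t2 * \<pi> ^ m)"
    by (simp add: algebra_simps)
  hence d: "C dvd s1 * t2 * \<pi> ^ m * h - s2 * t1 * \<pi> ^ n"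
    using 1 2 by (simp only: dvd_diff dvd_mult)
  show ?thesis
  proof (cases "m \<le> n")
    case True
    hence "\<pi> ^ n = \<pi> ^ m * \<pi> ^ (n - m)" by (simp flip: power_add)
    hence "s1 * t2 * \<pi> ^ m * h - s2 * t1 * \<pi> ^ n = \<pi> ^ m * (s1 * t2 * h - s2 * t1 * \<pi> ^ (n - m))"
      by (simp add: algebra_simps)
    with d have "C dvd s1 * t2 * h - s2 * t1 * \<pi> ^ (n - m)" by (metis regular_power)
    with 1 2 True show ?thesis by (auto intro!: exactI[of "s1 * t2" _ _ "s2 * t1"])
  next
    case False
    hence e: "\<pi> ^ m = \<pi> ^ n * \<pi> ^ (m - n)" by (simp flip: power_add)
    have "s1 * t2 * \<pi> ^ m * h - s2 * t1 * \<pi> ^ n = \<pi> ^ n * (s1 * t2 * \<pi> ^ (m - n) * h - s2 * t1)"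
      unfolding e by (simp add: algebra_simps)
    with d have "C dvd s1 * t2 * \<pi> ^ (m - n) * h - s2 * t1" by (metis regular_power)
    hence "eval2 (s1 * t2 * \<pi> ^ (m - n) * h - s2 * t1) p q = 0" using on_curve eval2_dvd_0 by blast
    with 1 2 False show ?thesis by (simp add: eval2_pi zero_power)
  qed
qed

context elliptic
begin

text \<open>The curve in the chart \<open>Y = 1\<close>:
  \<open>s - w^3 - a*w^2*s - b*w*s^2 - c*s^3\<close>, where \<open>a, b, c\<close> are the lower
  coefficients of \<open>f\<close>.\<close>

definition Cinf :: "'a poly poly" where
  "Cinf = [:[:0, 0, 0, -1:], [:1, 0, - coeff f 2:], [:0, - coeff f 1:], [:- coeff f 0:]:]"

text \<open>The cofactor of \<open>s\<close> in the chart equation. Its value at the origin is 1, so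
  \<open>s\<close> has order 3 there.\<close>

definition einf :: "'a poly poly" where
  "einf = [:[:1, 0, - coeff f 2:], [:0, - coeff f 1:], [:- coeff f 0:]:]"

abbreviation w :: "'a poly poly" where "w \<equiv> [:[:0, 1:]:]"

lemma Cinf_eq: "Cinf = einf * [:0, 1:] - w ^ 3"
  by (simp add: Cinf_def einf_def power3_eq_cube)

lemma total_degree_C: "total_degree C = 3"
proof -
  have "{..degree C} = {0, 1, 2}" by (auto simp: C_eq)
  thus ?thesis unfolding total_degree_def by (simp add: C_eq degree_f numeral_2_eq_2)
qed

lemma chart_Y_C: "chart_Y C = Cinf"
proof -
  have "{..degree C} = {0, 1, 2}" by (auto simp: C_eq)
  moreover have "{..3::nat} = {0, 1, 2, 3}" by auto
  ultimately show ?thesis unfolding chart_Y_sum total_degree_C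
    by (simp add: C_eq degree_f numeral_2_eq_2 numeral_3_eq_3 Cinf_def monom_Suc monom_0 coeff_f[unfolded numeral_3_eq_3])
qed

text \<open>The relation \<open>einf * s = w ^ 3\<close> makes \<open>s\<close> a multiple of
  \<open>w\<close>. Regularity holds because \<open>w\<close> is prime and does not divide
  \<open>Cinf\<close>, whose coefficient of \<open>s\<close> is 1 at \<open>w = 0\<close>.\<close>

lemma smooth_inf: "smooth_point Cinf 0 0 w"
proof
  show "eval2 Cinf 0 0 = 0" by (simp add: Cinf_def)
  show "w = [:[:- 0, 1:]:] \<or> w = [:[:- 0:], 1:]" by simp
  show "vanish Cinf 0 0 w 1 [:[:- 0, 1:]:]"
    by (intro vanishI[of 1 _ _ _ _ 1]) auto
  show "vanish Cinf 0 0 w 1 [:[:- 0:], 1:]"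
    by (intro vanishI[of einf _ _ _ _ "w ^ 2"]) (auto simp: Cinf_eq einf_def power2_eq_square power3_eq_cube)
  show "Cinf dvd h" if "Cinf dvd w * h" for h
  proof -
    from that obtain k where k: "w * h = Cinf * k" by (elim dvdE)
    have "prime_elem w"
      by (intro lift_prime_elem_poly prime_elem_linear_field_poly) simp
    moreover have "w dvd Cinf * k" by (metis k dvd_triv_left)
    ultimately have "w dvd Cinf \<or> w dvd k" by (rule prime_elem_dvd_multD)
    moreover have "\<not> w dvd Cinf"
    proof
      assume "w dvd Cinf"
      hence "[:0, 1:] dvd coeff Cinf 1" by (simp only: const_poly_dvd_iff)
      hence "poly (coeff Cinf 1) 0 = 0" by (simp only: poly_eq_0_iff_dvd minus_zero)
      thus False by (simp add: Cinf_def)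
    qed
    ultimately have "w dvd k" by blast
    then obtain k' where "k = w * k'" by (elim dvdE)
    with k have "w * h = w * (Cinf * k')" by (simp only: mult_ac)
    hence "h = Cinf * k'" by (subst (asm) mult_cancel_left) simp
    thus ?thesis by simp
  qed
qed

abbreviation xinf :: "nat \<Rightarrow> 'a poly poly \<Rightarrow> bool" where
  "xinf \<equiv> exact Cinf 0 0 w"

lemma xinf_s: "xinf 3 [:0, 1:]"
  by (intro exactI[of einf _ _ 1]) (auto simp: Cinf_eq einf_def)

text \<open>
  On the curve \<open>s * e = w ^ 3\<close>, so \<open>e ^ d\<close> times the chart of a monomial \<open>x ^ l * y ^ m\<close> is
  \<open>e ^ (l + m) * w ^ (3 * d - 2 * l - 3 * m)\<close>.
\<close>

lemma xinf_chart:
  assumes le: "\<And>l m. coeff (coeff h m) l \<noteq> 0 \<Longrightarrow> 2 * l + 3 * m \<le> 2 * l0 + 3 * m0"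
    and uniq: "\<And>l m. coeff (coeff h m) l \<noteq> 0 \<Longrightarrow> 2 * l + 3 * m = 2 * l0 + 3 * m0 \<Longrightarrow> l = l0 \<and> m = m0"
    and nz: "coeff (coeff h m0) l0 \<noteq> 0"
  shows "2 * l0 + 3 * m0 \<le> 3 * total_degree h \<and> xinf (3 * total_degree h - (2 * l0 + 3 * m0)) (chart_Y h)"
proof
  let ?d = "total_degree h" and ?M = "2 * l0 + 3 * m0"
  have "l0 + m0 \<le> ?d" using coeff_coeff_nz[OF nz] by (intro total_degree_ge) auto
  thus M: "?M \<le> 3 * ?d" by simp
  \<comment> \<open>The unit cofactor: at the origin only the term of \<open>(l0, m0)\<close>
    survives, as every other non-zero term carries a positive power of \<open>w\<close>.\<close>
  define t where "t = (\<Sum>m\<le>degree h. \<Sum>l\<le>degree (coeff h m).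
      [:[:coeff (coeff h m) l:]:] * einf ^ (l + m) * w ^ (?M - (2 * l + 3 * m)))"
  show "xinf (3 * ?d - ?M) (chart_Y h)"
  proof (rule exactI)
    show "eval2 (einf ^ ?d) 0 0 \<noteq> 0" by (simp add: einf_def)
    have "eval2 t 0 0 = (\<Sum>m\<le>degree h. \<Sum>l\<le>degree (coeff h m).
        if l = l0 \<and> m = m0 then coeff (coeff h m0) l0 else 0)"
      unfolding t_def eval2_sum
    proof (intro sum.cong refl)
      fix m l
      show "eval2 ([:[:coeff (coeff h m) l:]:] * einf ^ (l + m) * w ^ (?M - (2 * l + 3 * m))) 0 0
        = (if l = l0 \<and> m = m0 then coeff (coeff h m0) l0 else 0)"
      proof (cases "coeff (coeff h m) l = 0")
        case False
        hence "2 * l + 3 * m < ?M \<or> l = l0 \<and> m = m0" using le[of m l] uniq[of m l] by force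
        moreover have "eval2 einf 0 0 = 1" by (simp add: einf_def)
        ultimately show ?thesis by (auto simp: eval2_smult)
      qed (use nz in auto)
    qed
    also have "\<dots> = (\<Sum>m\<le>degree h. if m = m0 then coeff (coeff h m0) l0 else 0)"
    proof (intro sum.cong refl)
      fix m
      show "(\<Sum>l\<le>degree (coeff h m). if l = l0 \<and> m = m0 then coeff (coeff h m0) l0 else 0)
         = (if m = m0 then coeff (coeff h m0) l0 else 0)"
        using coeff_coeff_nz[OF nz] by (cases "m = m0") simp_all
    qed
    also have "\<dots> = coeff (coeff h m0) l0"
      using coeff_coeff_nz[OF nz] by simp
    finally show "eval2 t 0 0 \<noteq> 0" using nz by simp
    have "einf ^ ?d * chart_Y h - t * w ^ (3 * ?d - ?M) = (\<Sum>m\<le>degree h. \<Sum>l\<le>degree (coeff h m).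
        einf ^ ?d * monom (monom (coeff (coeff h m) l) l) (total_degree h - l - m)
        - [:[:coeff (coeff h m) l:]:] * einf ^ (l + m) * w ^ (?M - (2 * l + 3 * m)) * w ^ (3 * ?d - ?M))"
      unfolding t_def chart_Y_sum by (simp only: sum_distrib_left sum_distrib_right sum_subtractf)
    also have "Cinf dvd \<dots>"
    proof (intro dvd_sum)
      fix m l assume ml: "m \<in> {..degree h}" "l \<in> {..degree (coeff h m)}"
      let ?c = "[:[:coeff (coeff h m) l:]:]"
      let ?j = "?d - l - m"
      show "Cinf dvd einf ^ ?d * monom (monom (coeff (coeff h m) l) l) ?j
        - ?c * einf ^ (l + m) * w ^ (?M - (2 * l + 3 * m)) * w ^ (3 * ?d - ?M)"
      proof (cases "coeff (coeff h m) l = 0")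
        case False
        have ld: "l + m \<le> ?d" using ml by (intro total_degree_ge) auto
        have mm: "monom (monom (coeff (coeff h m) l) l) ?j = ?c * w ^ l * [:0, 1:] ^ ?j"
          by (simp only: monom_eq_const_mult is_hom_power[OF is_hom_const] is_homD[OF is_hom_const])
        have e: "einf ^ ?d = einf ^ (l + m) * einf ^ ?j"
          using ld by (simp flip: power_add)
        have w: "w ^ (?M - (2 * l + 3 * m)) * w ^ (3 * ?d - ?M) = w ^ l * (w ^ 3) ^ ?j"
        proof -
          have "(?M - (2 * l + 3 * m)) + (3 * ?d - ?M) = l + 3 * ?j"
            using le[OF False] M ld by linarith
          thus ?thesis by (simp only: power_add[symmetric] power_mult[symmetric])
        qed
        have "einf ^ ?d * (?c * w ^ l * [:0, 1:] ^ ?j) - ?c * einf ^ (l + m) * w ^ (?M - (2 * l + 3 * m)) * w ^ (3 * ?d - ?M)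
          = ?c * einf ^ (l + m) * w ^ l * ((einf * [:0, 1:]) ^ ?j - (w ^ 3) ^ ?j)"
          unfolding mult.assoc w unfolding e power_mult_distrib right_diff_distrib by (simp only: mult_ac)
        also have "Cinf dvd \<dots>"
          unfolding Cinf_eq by (intro dvd_mult diff_dvd_power_diff)
        finally show ?thesis unfolding mm .
      qed simp
    qed
    finally show "Cinf dvd einf ^ ?d * chart_Y h - t * w ^ (3 * ?d - ?M)" .
  qed
qed

text \<open>The leading monomials of \<open>b0\<close> and \<open>b1 * y\<close> have weights
  \<open>2 * degree b0\<close> and \<open>3 + 2 * degree b1\<close> of different parity, so the
  heavier one is unique. The sign in the last claim tells whether \<open>b0 ^ 2\<close> or
  \<open>- f * b1 ^ 2\<close> dominates.\<close>

lemma reduced_leading: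
  assumes "\<not> C dvd [:b0, b1:]"
  obtains l0 m0 where "degree (nrm [:b0, b1:]) = 2 * l0 + 3 * m0" "coeff (coeff [:b0, b1:] m0) l0 \<noteq> 0"
    "\<And>l m. coeff (coeff [:b0, b1:] m) l \<noteq> 0 \<Longrightarrow> 2 * l + 3 * m \<le> 2 * l0 + 3 * m0"
    "\<And>l m. coeff (coeff [:b0, b1:] m) l \<noteq> 0 \<Longrightarrow> 2 * l + 3 * m = 2 * l0 + 3 * m0 \<Longrightarrow> l = l0 \<and> m = m0"
    "lead_coeff (nrm [:b0, b1:]) = coeff (coeff [:b0, b1:] m0) l0 ^ 2
     \<or> lead_coeff (nrm [:b0, b1:]) = - (coeff (coeff [:b0, b1:] m0) l0 ^ 2)"
proof -
  have c: "(m = 0 \<and> l \<le> degree b0) \<or> (m = 1 \<and> b1 \<noteq> 0 \<and> l \<le> degree b1)"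
    if "coeff (coeff [:b0, b1:] m) l \<noteq> 0" for m l
    using that le_degree by (cases m; cases "m - 1") (auto simp: coeff_pCons split: nat.splits)
  have sq: "coeff (b0 ^ 2) (2 * degree b0) = lead_coeff b0 ^ 2"
    by (cases "b0 = 0") (simp_all add: lead_coeff_power[symmetric] degree_power_eq)
  show ?thesis
  proof (cases rule: parity_cases[where ?b0.0 = b0 and ?b1.0 = b1])
    case 1
    hence "b0 \<noteq> 0" using assms by auto
    with 1 c sq nrm_degree_reduced(1)[OF 1, of b0] show ?thesis
      by (intro that[of "degree b0" 0]) fastforce+
  next
    case 2
    have d: "degree (b0 ^ 2 - f * b1 ^ 2) = 3 + 2 * degree b1" by (rule nrm_degree_reduced(2)[OF 2])
    have "degree (f * b1 ^ 2) = 3 + 2 * degree b1"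
      using f_neq_0 2 by (simp add: degree_mult_eq degree_power_eq degree_f)
    hence "coeff (f * b1 ^ 2) (3 + 2 * degree b1) = lead_coeff (f * b1 ^ 2)" by simp
    also have "\<dots> = lead_coeff b1 ^ 2" by (simp add: lead_coeff_mult lead_coeff_power degree_f coeff_f)
    finally have 3: "coeff (f * b1 ^ 2) (3 + 2 * degree b1) = lead_coeff b1 ^ 2" .
    have "degree (b0 ^ 2) \<le> 2 * degree b0" by (cases "b0 = 0") (simp_all add: degree_power_eq)
    with 2 have "coeff (b0 ^ 2) (3 + 2 * degree b1) = 0" by (intro coeff_eq_0) linarith
    with 2 3 c d show ?thesis
      by (intro that[of "degree b1" 1]) fastforce+
  next
    case 3
    have d: "degree (b0 ^ 2 - f * b1 ^ 2) = 2 * degree b0" by (rule nrm_degree_reduced(3)[OF 3])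
    have "degree (f * b1 ^ 2) = 3 + 2 * degree b1"
      using f_neq_0 3 by (simp add: degree_mult_eq degree_power_eq degree_f)
    with 3 have "coeff (f * b1 ^ 2) (2 * degree b0) = 0" by (intro coeff_eq_0) linarith
    moreover have "b0 \<noteq> 0" using 3 by auto
    ultimately show ?thesis using 3 c d sq
      by (intro that[of "degree b0" 0]) fastforce+
  qed
qed

lemma xinf_reduced:
  assumes "\<not> C dvd [:b0, b1:]"
  shows "degree (nrm [:b0, b1:]) \<le> 3 * total_degree [:b0, b1:] \<and>
    xinf (3 * total_degree [:b0, b1:] - degree (nrm [:b0, b1:])) (chart_Y [:b0, b1:])"
  using reduced_leading[OF assms]
proof cases
  case (1 l0 m0)
  show ?thesis unfolding 1(1) by (rule xinf_chart[OF 1(3,4,2)])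
qed

text \<open>With \<open>h = C * k + b\<close> and \<open>b\<close> reduced, the identity is padded
  to degree \<open>d\<close> and read in the chart at \<open>O\<close>, where the term with
  \<open>C\<close> becomes a multiple of \<open>Cinf\<close>. Each padding factor \<open>s\<close>
  and each unit of total degree counts 3; these contributions cancel, and minus the norm degree
  remains.\<close>

lemma ord_infinity_eq:
  assumes "\<not> C dvd h"
  shows "ord_infinity f h = - int (degree (nrm h))"
proof -
  obtain b0 b1 where "C dvd h - [:b0, b1:]" using reduced_form by blast
  then obtain k where k: "h - [:b0, b1:] = C * k" by (elim dvdE)
  let ?b = "[:b0, b1:]" and ?s = "[:0, 1:] :: 'a poly poly"
  have h: "h = C * k + ?b" using k by (metis diff_add_cancel)
  have nb: "\<not> C dvd ?b" using assms h by (metis dvd_add dvd_triv_left)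
  have nrm: "nrm h = nrm ?b" using k by (intro nrm_cong) simp
  \<comment> \<open>A common degree that dominates all terms; \<open>3 + total_degree k\<close>
    takes care of the product \<open>C * k\<close>.\<close>
  define d where "d = total_degree h + 3 + total_degree k + total_degree ?b"
  have "hpad d h = hpad 3 C * hpad (d - 3) k + hpad d ?b"
  proof -
    have "d = 3 + (d - 3)" by (simp add: d_def)
    hence p: "to_fract [:0, 1:] ^ d = to_fract [:0, 1:] ^ 3 * (to_fract [:0, 1:] ^ (d - 3) :: 'a poly poly poly fract)"
      by (metis power_add)
    have "to_fract (hpad d h) = to_fract [:0, 1:] ^ d * (dehom C * dehom k + dehom ?b)"
      by (subst to_fract_hpad) (simp add: d_def, simp only: arg_cong[OF h, of dehom] is_homD[OF is_hom_dehom])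
    also have "\<dots> = to_fract (hpad 3 C) * to_fract (hpad (d - 3) k) + to_fract (hpad d ?b)"
    proof -
      have "to_fract (hpad 3 C) = to_fract [:0, 1:] ^ 3 * dehom C"
        by (rule to_fract_hpad) (simp add: total_degree_C)
      moreover have "to_fract (hpad (d - 3) k) = to_fract [:0, 1:] ^ (d - 3) * dehom k"
        by (rule to_fract_hpad) (simp add: d_def)
      moreover have "to_fract (hpad d ?b) = to_fract [:0, 1:] ^ d * dehom ?b"
        by (rule to_fract_hpad) (simp add: d_def)
      ultimately show ?thesis unfolding distrib_left p by (simp only: mult_ac)
    qed
    finally have "to_fract (hpad d h) = to_fract (hpad 3 C * hpad (d - 3) k + hpad d ?b)"
      by (simp only: to_fract_add to_fract_mult)
    thus ?thesis by (simp only: to_fract_eq_iff)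
  qed
  note hpad = this
  have hm: "is_hom (map_poly (\<lambda>c :: 'a poly poly. poly c 1))"
    by (intro is_hom_map_poly is_hom_poly)
  have "chart_pad d h = chart_pad 3 C * chart_pad (d - 3) k + chart_pad d ?b"
    unfolding map_poly_hpad[symmetric] hpad is_homD[OF hm] ..
  moreover have "chart_pad 3 C = Cinf" by (simp add: chart_pad_def total_degree_C chart_Y_C)
  ultimately have dvd: "Cinf dvd chart_pad d ?b - chart_pad d h" by simp
  let ?M = "degree (nrm h)"
  have b: "?M \<le> 3 * total_degree ?b" "xinf (3 * total_degree ?b - ?M) (chart_Y ?b)"
    using xinf_reduced[OF nb] nrm by auto
  from exact_mult[OF exact_power[OF xinf_s, of "d - total_degree ?b"] b(2)]
  have "xinf ((d - total_degree ?b) * 3 + (3 * total_degree ?b - ?M)) (chart_pad d ?b)"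
    by (simp only: chart_pad_def)
  also have "(d - total_degree ?b) * 3 + (3 * total_degree ?b - ?M) = 3 * d - ?M"
    using b(1) by (simp add: d_def)
  finally have x: "xinf (3 * d - ?M) ([:0, 1:] ^ (d - total_degree h) * chart_Y h)"
    using exact_cong[OF dvd] by (simp only: chart_pad_def)
  have "(d - total_degree h) * 3 \<le> 3 * d - ?M \<and> xinf (3 * d - ?M - (d - total_degree h) * 3) (chart_Y h)"
    by (rule smooth_point.exact_cancel[OF smooth_inf x exact_power[OF xinf_s]])
  hence o: "(d - total_degree h) * 3 \<le> 3 * d - ?M"
     "local_ord Cinf 0 0 (chart_Y h) = enat (3 * d - ?M - (d - total_degree h) * 3)"
    using smooth_point.local_ord_exact[OF smooth_inf] by blast+
  have os: "local_ord Cinf 0 0 [:0, 1:] = enat 3"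
    by (rule smooth_point.local_ord_exact[OF smooth_inf xinf_s])
  have "total_degree h \<le> d" "?M \<le> 3 * d" using b(1) by (auto simp: d_def)
  thus ?thesis
    using o(1) unfolding ord_infinity_def C_def[symmetric] chart_Y_C o(2) os
    by (simp add: of_nat_diff algebra_simps)
qed

end

section \<open>Divisors of functions\<close>

lemma degree_linear_mult: "(g :: 'a::idom poly) \<noteq> 0 \<Longrightarrow> degree ([:- p, 1:] * g) = Suc (degree g)"
  by (subst degree_mult_eq) auto

context elliptic
begin

abbreviation pinf :: "'a divisor" where "pinf \<equiv> frag_of Infinity"

lemma affine_on_curve [simp]: "Affine p q \<in> curve_points f \<longleftrightarrow> q ^ 2 = poly f p"
  and infinity_on_curve [simp]: "Infinity \<in> curve_points f"
  by (auto simp: curve_points_def)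

lemma curve_cases:
  assumes "P \<in> curve_points f"
  obtains "P = Infinity" | p q where "P = Affine p q" "q ^ 2 = poly f p"
  using assms by (auto simp: curve_points_def)

lemma affine_ord_Affine: "affine_ord f (Affine p q) h = local_ord C p q h"
  by (simp add: affine_ord_def C_def)

lemma ord_at_affine: "ord_at f (Affine p q) h = int (ao p q h)"
  by (simp add: ord_at_def ao_def affine_ord_Affine)

lemma ord_at_infinity: "\<not> C dvd h \<Longrightarrow> ord_at f Infinity h = - int (degree (nrm h))"
  by (simp add: ord_at_def ord_infinity_eq)

lemma ao_nz_imp_root:
  assumes c: "q ^ 2 = poly f p" and "\<not> C dvd h" "ao p q h \<noteq> 0"
  shows "poly (nrm h) p = 0"
proof -
  have "nrm h \<noteq> 0" using assms by (simp add: nrm_eq_0_iff)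
  moreover from ao_nrm[OF assms(1,2)] assms(3) have "ao p q [:nrm h:] \<noteq> 0" by simp
  ultimately show ?thesis by (auto simp: ao_const[OF c] order_root)
qed

text \<open>Zeros lie above roots of the norm. Finiteness is what makes
  \<open>Abs_poly_mapping\<close> in \<open>div_of\<close> return the given function.\<close>

lemma finite_support:
  assumes "\<not> C dvd h"
  shows "finite {P. (if P \<in> curve_points f then ord_at f P h else 0) \<noteq> 0}"
proof (rule finite_subset)
  have sq: "finite {q. q ^ 2 = poly f p}" for p
  proof -
    have "{q. q ^ 2 = poly f p} = {q. poly [:- poly f p, 0, 1:] q = 0}"
      by (auto simp: power2_eq_square)
    thus ?thesis by (simp only:) (rule poly_roots_finite, simp)
  qed
  have "finite {p. poly (nrm h) p = 0}"
    using assms by (intro poly_roots_finite) (simp add: nrm_eq_0_iff)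
  thus "finite (insert Infinity (\<Union>p\<in>{p. poly (nrm h) p = 0}. Affine p ` {q. q ^ 2 = poly f p}))"
    using sq by auto
  show "{P. (if P \<in> curve_points f then ord_at f P h else 0) \<noteq> 0}
     \<subseteq> insert Infinity (\<Union>p\<in>{p. poly (nrm h) p = 0}. Affine p ` {q. q ^ 2 = poly f p})"
  proof
    fix P assume "P \<in> {P. (if P \<in> curve_points f then ord_at f P h else 0) \<noteq> 0}"
    hence P: "P \<in> curve_points f" "ord_at f P h \<noteq> 0" by (auto split: if_splits)
    from P(1) show "P \<in> insert Infinity (\<Union>p\<in>{p. poly (nrm h) p = 0}. Affine p ` {q. q ^ 2 = poly f p})"
    proof (cases rule: curve_cases)
      case (2 p q)
      with P(2) ao_nz_imp_root[OF 2(2) assms] have "poly (nrm h) p = 0" by (simp add: ord_at_affine)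
      with 2 show ?thesis by blast
    qed simp
  qed
qed

lemma lookup_div_of:
  assumes "\<not> C dvd h"
  shows "Poly_Mapping.lookup (div_of f h) P = (if P \<in> curve_points f then ord_at f P h else 0)"
  unfolding div_of_def by (subst lookup_Abs_poly_mapping) (use finite_support[OF assms] in auto)

lemma lookup_div_affine:
  "\<not> C dvd h \<Longrightarrow> Poly_Mapping.lookup (div_of f h) (Affine p q) = (if q ^ 2 = poly f p then int (ao p q h) else 0)"
  by (simp add: lookup_div_of ord_at_affine)

lemma lookup_div_infinity:
  "\<not> C dvd h \<Longrightarrow> Poly_Mapping.lookup (div_of f h) Infinity = - int (degree (nrm h))"
  by (simp add: lookup_div_of ord_at_infinity)

lemma divisor_eqI:
  assumes "Poly_Mapping.lookup D Infinity = Poly_Mapping.lookup D' Infinity"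
    and "\<And>p q. Poly_Mapping.lookup D (Affine p q) = Poly_Mapping.lookup D' (Affine p q)"
  shows "D = D'"
proof (rule poly_mapping_eqI)
  fix P show "Poly_Mapping.lookup D P = Poly_Mapping.lookup D' P"
    using assms by (cases P) auto
qed

lemma div_of_mult:
  assumes "\<not> C dvd g" "\<not> C dvd h"
  shows "div_of f (g * h) = div_of f g + div_of f h"
proof -
  have gh: "\<not> C dvd g * h" using assms by (simp add: C_prime)
  have "nrm g \<noteq> 0" "nrm h \<noteq> 0" using assms by (simp_all add: nrm_eq_0_iff)
  thus ?thesis using assms gh
    by (intro divisor_eqI)
       (simp_all add: lookup_add lookup_div_affine lookup_div_infinity ao_mult nrm_mult degree_mult_eq)
qed

lemma div_of_cong:
  assumes "C dvd g - h" "\<not> C dvd g"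
  shows "div_of f g = div_of f h"
proof -
  have h: "\<not> C dvd h" using assms by (metis dvd_add diff_add_cancel)
  show ?thesis using assms h ao_cong[OF _ assms] nrm_cong[OF assms(1)]
    by (intro divisor_eqI) (simp_all add: lookup_div_affine lookup_div_infinity)
qed

lemma div_of_1: "div_of f 1 = 0"
  using div_of_mult[of 1 1] C_not_dvd_1 by simp

section \<open>Principal divisors\<close>

definition princ :: "'a divisor \<Rightarrow> bool" where
  "princ D \<longleftrightarrow> (\<exists>g h. \<not> C dvd g \<and> \<not> C dvd h \<and> D = div_of f g - div_of f h)"

lemma lin_equiv_iff: "lin_equiv f D D' \<longleftrightarrow> princ (D - D')"
  by (simp add: lin_equiv_def princ_def C_def)

lemma princ_div_of: "\<not> C dvd g \<Longrightarrow> princ (div_of f g)"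
  unfolding princ_def using C_not_dvd_1 div_of_1 by (intro exI[of _ g] exI[of _ 1]) simp

lemma princ_0: "princ 0"
  using princ_div_of[OF C_not_dvd_1] by (simp add: div_of_1)

lemma princ_uminus: "princ D \<Longrightarrow> princ (- D)"
  unfolding princ_def by (metis minus_diff_eq)

lemma princ_add: "princ D \<Longrightarrow> princ E \<Longrightarrow> princ (D + E)"
proof -
  assume "princ D" "princ E"
  then obtain g h g' h' where *: "\<not> C dvd g" "\<not> C dvd h" "D = div_of f g - div_of f h"
     "\<not> C dvd g'" "\<not> C dvd h'" "E = div_of f g' - div_of f h'" by (auto simp: princ_def)
  hence "D + E = div_of f (g * g') - div_of f (h * h')"
    by (simp add: div_of_mult)
  thus ?thesis unfolding princ_def using * C_prime by blast
qed

lemma princ_diff: "princ D \<Longrightarrow> princ E \<Longrightarrow> princ (D - E)"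
  using princ_add[of D "- E"] princ_uminus[of E] by simp

lemma princ_cmul: "princ D \<Longrightarrow> princ (frag_cmul (int k) D)"
  by (induction k) (simp_all add: princ_0 princ_add frag_cmul_distrib)

text \<open>Amounts to: a rational function without affine poles is a polynomial in \<open>x\<close>
  and \<open>y\<close>. Roots \<open>p\<close> of \<open>N\<close> are removed one by one. If
  \<open>q \<noteq> 0\<close>, vanishing at both points above \<open>p\<close> gives
  \<open>B0(p) + q * B1(p) = B0(p) - q * B1(p) = 0\<close>. If \<open>q = 0\<close>, the order is at
  least 2, and so is that of \<open>B0\<close> once \<open>B0(p) = 0\<close>; hence
  \<open>B1 * y\<close> has order at least 2, which forces \<open>B1(p) = 0\<close>.\<close>

lemma poly_dvd_pair:
  assumes "N \<noteq> 0" "\<not> C dvd [:B0, B1:]"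
    and "\<And>p q. q ^ 2 = poly f p \<Longrightarrow> ao p q [:N:] \<le> ao p q [:B0, B1:]"
  shows "\<exists>c0 c1. B0 = N * c0 \<and> B1 = N * c1"
  using assms
proof (induction "degree N" arbitrary: N B0 B1)
  case 0
  then obtain n where n: "N = [:n:]" "n \<noteq> 0" by (metis degree_eq_zeroE pCons_0_0)
  thus ?case by (intro exI[of _ "smult (inverse n) B0"] exI[of _ "smult (inverse n) B1"]) simp
next
  case (Suc d)
  then obtain p where p: "poly N p = 0" using alg_closed_imp_poly_has_root[of N] by auto
  then obtain N' where N': "N = [:- p, 1:] * N'" using root_factor by blast
  have "degree [:- poly f p, 0, 1:] > 0" by simp
  from alg_closed_imp_poly_has_root[OF this] obtain q where q: "q ^ 2 = poly f p"
    by (auto simp: power2_eq_square)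
  have ordN: "Polynomial.order p N \<ge> 1" using p Suc.prems(1) by (metis order_root not_one_le_zero not_less_eq_eq One_nat_def le_zero_eq not_le less_one)
  have "poly B0 p = 0 \<and> poly B1 p = 0"
  proof (cases "q = 0")
    case False
    have "ao p q [:B0, B1:] \<noteq> 0" "ao p (- q) [:B0, B1:] \<noteq> 0"
      using Suc.prems(3)[of q p] Suc.prems(3)[of "- q" p] q ordN False Suc.prems(1)
      by (auto simp: ao_const)
    hence 1: "poly B0 p + q * poly B1 p = 0" "poly B0 p - q * poly B1 p = 0"
      using Suc.prems(2) q by (auto simp: ao_eq_0_iff)
    hence "2 * (q * poly B1 p) = 0" by (simp add: algebra_simps)
    with False two_neq_0 have "poly B1 p = 0" by simp
    with 1 show ?thesis by simp
  next
    case True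
    have ge: "2 \<le> ao p q [:B0, B1:]"
    proof -
      have "ao p q [:N:] = 2 * Polynomial.order p N" using ao_const[OF q Suc.prems(1)] True by simp
      with Suc.prems(3)[OF q] ordN show ?thesis by linarith
    qed
    hence "ao p q [:B0, B1:] \<noteq> 0" by simp
    hence "eval2 [:B0, B1:] p q = 0" using ao_eq_0_iff[OF q Suc.prems(2)] by metis
    hence b0: "poly B0 p = 0" by (simp add: True)
    then obtain c where c: "B0 = [:- p, 1:] * c" using root_factor by blast
    have "vanish C p q (unif p q) 2 [:B0, B1:]"
      using exact_imp_vanish[OF xct_ao[OF q Suc.prems(2)]] ge vanish_mono by blast
    moreover have "vanish C p q (unif p q) 2 [:B0:]"
    proof -
      have "xct p q (2 * Polynomial.order p [:- p, 1:]) [:[:- p, 1:]:]"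
        using xct_const[OF q, of "[:- p, 1:]"] True by simp
      moreover have "Polynomial.order p [:- p, 1:] = 1"
        using order_power_n_n[of p 1] by simp
      ultimately have "vanish C p q (unif p q) 2 ([:c:] * [:[:- p, 1:]:])"
        by (intro vanish_mult_left exact_imp_vanish) simp
      thus ?thesis unfolding const_poly_mult by (simp only: c mult.commute)
    qed
    ultimately have v: "vanish C p q (unif p q) 2 ([:B0, B1:] - [:B0:])"
      using is_ideal_diff[OF is_ideal_vanish] by blast
    have "poly B1 p = 0"
    proof (rule ccontr)
      assume "poly B1 p \<noteq> 0"
      hence "xct p q 1 [:0, B1:]"
        using True by (intro exactI[of 1 _ _ "[:B1:]"]) (auto simp: unif_def)
      from smooth_point.exact_not_vanish[OF smooth[OF q] this, of 2] v show False by simp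
    qed
    with b0 show ?thesis by simp
  qed
  then obtain B0' B1' where B': "B0 = [:- p, 1:] * B0'" "B1 = [:- p, 1:] * B1'"
    using root_factor by blast
  have e: "[:B0, B1:] = [:[:- p, 1:]:] * [:B0', B1':]" "[:N:] = [:[:- p, 1:]:] * [:N':]"
    by (simp_all add: B' N')
  have N'0: "N' \<noteq> 0" using Suc.prems(1) N' by auto
  have nb: "\<not> C dvd [:B0', B1':]" using Suc.prems(2) unfolding e by (metis dvd_mult)
  have "degree N = Suc (degree N')" unfolding N' using N'0 by (subst degree_mult_eq) auto
  hence "d = degree N'" using Suc.hyps(2) by simp
  moreover have "ao p' q' [:N':] \<le> ao p' q' [:B0', B1':]" if "q' ^ 2 = poly f p'" for p' q'
    using Suc.prems(3)[OF that] unfolding e using nb N'0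
    by (subst (asm) ao_mult[OF that], simp, simp, subst (asm) ao_mult[OF that]) simp_all
  ultimately obtain c0 c1 where "B0' = N' * c0" "B1' = N' * c1"
    using Suc.hyps(1)[OF _ N'0 nb] by blast
  thus ?case using B' N' by (metis mult.assoc)
qed

text \<open>Rationalizing the denominator, \<open>g / h = g * cj h / nrm h\<close>, turns
  effectivity into a comparison with a polynomial in \<open>x\<close>, to which
  \<open>poly_dvd_pair\<close> applies.\<close>

lemma princ_effective:
  assumes "princ D" "\<And>P. P \<noteq> Infinity \<Longrightarrow> 0 \<le> Poly_Mapping.lookup D P"
  obtains b0 b1 where "\<not> C dvd [:b0, b1:]" "D = div_of f [:b0, b1:]"
proof -
  from assms(1) obtain g h where gh: "\<not> C dvd g" "\<not> C dvd h" "D = div_of f g - div_of f h"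
    by (auto simp: princ_def)
  obtain B0 B1 where B: "C dvd g * cj h - [:B0, B1:]" using reduced_form by blast
  have n: "\<not> C dvd cj h" "\<not> C dvd g * cj h" "\<not> C dvd h * cj h"
    using gh not_dvd_cj by (auto simp: C_prime)
  have nB: "\<not> C dvd [:B0, B1:]" using B n(2) by (metis dvd_add diff_add_cancel)
  have N: "nrm h \<noteq> 0" using gh by (simp add: nrm_eq_0_iff)
  have "div_of f g + div_of f (cj h) = div_of f [:B0, B1:]"
    using div_of_mult[OF gh(1) n(1)] div_of_cong[OF B n(2)] by simp
  moreover have "div_of f h + div_of f (cj h) = div_of f [:nrm h:]"
    using div_of_mult[OF gh(2) n(1)] div_of_cong[OF mult_cj n(3)] by simp
  ultimately have D: "D = div_of f [:B0, B1:] - div_of f [:nrm h:]"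
    using gh(3) by (metis add_diff_cancel_right)
  have "ao p q [:nrm h:] \<le> ao p q [:B0, B1:]" if "q ^ 2 = poly f p" for p q
    using assms(2)[of "Affine p q"] nB N that unfolding D by (simp add: lookup_minus lookup_div_affine)
  from poly_dvd_pair[OF N nB this] obtain c0 c1 where c: "B0 = nrm h * c0" "B1 = nrm h * c1" by blast
  hence e: "[:B0, B1:] = [:nrm h:] * [:c0, c1:]" by simp
  hence nc: "\<not> C dvd [:c0, c1:]" using nB by (metis dvd_mult)
  have "div_of f [:B0, B1:] = div_of f [:nrm h:] + div_of f [:c0, c1:]"
    unfolding e by (rule div_of_mult) (use N nc in auto)
  hence "D = div_of f [:c0, c1:]" using D by simp
  with nc show ?thesis by (rule that)
qed

lemma div_of_vertical:
  assumes c: "q ^ 2 = poly f p"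
  shows "div_of f [:[:- p, 1:]:] = frag_of (Affine p q) + frag_of (Affine p (- q)) - frag_cmul 2 pinf"
proof (rule divisor_eqI)
  show "Poly_Mapping.lookup (div_of f [:[:- p, 1:]:]) Infinity =
    Poly_Mapping.lookup (frag_of (Affine p q) + frag_of (Affine p (- q)) - frag_cmul 2 pinf) Infinity"
    by (simp add: lookup_div_infinity lookup_add lookup_minus degree_power_eq del: degree_power_le)
next
  fix p' q'
  have o: "Polynomial.order p' [:- p, 1:] = (if p' = p then 1 else 0)"
    using order_power_n_n[of p 1] by (auto intro: order_0I)
  have "q' = q \<or> q' = - q" if "q' ^ 2 = poly f p"
    using that c power2_eq_iff[of q' q] by simp
  moreover have "q = - q \<longleftrightarrow> q = 0" using two_neq_0 by (metis add.inverse_neutral eq_neg_iff_add_eq_0 mult_2 mult_eq_0_iff)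
  ultimately show "Poly_Mapping.lookup (div_of f [:[:- p, 1:]:]) (Affine p' q') =
    Poly_Mapping.lookup (frag_of (Affine p q) + frag_of (Affine p (- q)) - frag_cmul 2 pinf) (Affine p' q')"
    using c by (auto simp: lookup_div_affine lookup_add lookup_minus ao_const o)
qed

lemma not_princ_point_infinity:
  assumes "q ^ 2 = poly f p"
  shows "\<not> princ (frag_of (Affine p q) - pinf)"
proof
  assume "princ (frag_of (Affine p q) - pinf)"
  then obtain b0 b1 where b: "\<not> C dvd [:b0, b1:]" "frag_of (Affine p q) - pinf = div_of f [:b0, b1:]"
    by (rule princ_effective) (auto simp: lookup_minus)
  from arg_cong[OF b(2), of "\<lambda>D. Poly_Mapping.lookup D Infinity"] b(1)
  have "degree (nrm [:b0, b1:]) = 1" by (simp add: lookup_minus lookup_div_infinity)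
  thus False
    using nrm_degree_reduced[of b1 b0] by (cases rule: parity_cases[where ?b0.0 = b0 and ?b1.0 = b1]) auto
qed

text \<open>The vertical line through the second point trades \<open>- (p', q')\<close> for
  \<open>+ (p', -q')\<close> and gives a function whose norm has degree 2. Such a function is a
  linear polynomial in \<open>x\<close>, so the two points have the same
  \<open>x\<close>-coordinate.\<close>

lemma princ_point_point:
  assumes c: "q ^ 2 = poly f p" "q' ^ 2 = poly f p'"
    and "princ (frag_of (Affine p q) - frag_of (Affine p' q'))"
  shows "Affine p q = Affine p' q'"
proof -
  let ?D = "frag_of (Affine p q) + frag_of (Affine p' (- q')) - frag_cmul 2 pinf"
  have "princ ((frag_of (Affine p q) - frag_of (Affine p' q')) + div_of f [:[:- p', 1:]:])"
    by (rule princ_add[OF assms(3) princ_div_of]) simp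
  also have "(frag_of (Affine p q) - frag_of (Affine p' q')) + div_of f [:[:- p', 1:]:] = ?D"
    unfolding div_of_vertical[OF c(2)] by simp
  finally have "princ ?D" .
  then obtain b0 b1 where b: "\<not> C dvd [:b0, b1:]" "?D = div_of f [:b0, b1:]"
    by (rule princ_effective) (auto simp: lookup_minus lookup_add)
  from arg_cong[OF b(2), of "\<lambda>D. Poly_Mapping.lookup D Infinity"] b(1)
  have d: "degree (nrm [:b0, b1:]) = 2" by (simp add: lookup_minus lookup_add lookup_div_infinity)
  have b1: "b1 = 0 \<and> degree b0 = 1"
    using d nrm_degree_reduced[of b1 b0] by (cases rule: parity_cases[where ?b0.0 = b0 and ?b1.0 = b1]) auto
  hence b0: "b0 \<noteq> 0" by auto
  have l: "int (ao r s [:b0:]) = (if r = p \<and> s = q then 1 else 0) + (if r = p' \<and> s = - q' then 1 else 0)"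
    if "s ^ 2 = poly f r" for r s
    using arg_cong[OF b(2), of "\<lambda>D. Poly_Mapping.lookup D (Affine r s)"] b(1) b1 that
    by (simp add: lookup_minus lookup_add lookup_div_affine)
  have "ao p q [:b0:] \<noteq> 0" "ao p' (- q') [:b0:] \<noteq> 0"
  proof -
    have "int (ao p q [:b0:]) \<ge> 1" using l[OF c(1)] by simp
    moreover have "int (ao p' (- q') [:b0:]) \<ge> 1" using l[of "- q'" p'] c(2) by simp
    ultimately show "ao p q [:b0:] \<noteq> 0" "ao p' (- q') [:b0:] \<noteq> 0" by linarith+
  qed
  hence roots: "poly b0 p = 0" "poly b0 p' = 0" using c b0 by (auto simp: ao_eq_0_iff)
  obtain u v where uv: "b0 = [:u, v:]" "v \<noteq> 0"
    using b1 by (metis degree1_coeffs)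
  have "v * (p - p') = poly b0 p - poly b0 p'" by (simp add: uv algebra_simps)
  hence "v * (p - p') = 0" using roots by simp
  hence pp: "p = p'" using uv by simp
  hence "q = q' \<or> q = - q'" using c power2_eq_iff[of q q'] by simp
  \<comment> \<open>For opposite points with \<open>q \<noteq> 0\<close> the divisor would count
    \<open>(p, q)\<close> twice, but a linear \<open>b0\<close> has only a simple root.\<close>
  moreover have "q = 0" if "q = - q'"
  proof (rule ccontr)
    assume "q \<noteq> 0"
    hence "ao p q [:b0:] = Polynomial.order p b0" using ao_const[OF c(1) b0] by simp
    moreover have "int (ao p q [:b0:]) = 2" using l[OF c(1)] that pp by simp
    ultimately have "Polynomial.order p b0 = 2" by linarith
    thus False using order_degree[OF b0, of p] b1 by simp
  qed
  ultimately show ?thesis using pp by auto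
qed

subsection \<open>The group law\<close>

text \<open>The orders at \<open>(p, q)\<close> and \<open>(p, -q)\<close> add up to that of the
  norm \<open>L ^ 2 - f\<close>. The line misses one of the two points unless \<open>q = 0\<close>,
  where they coincide and the factor 2 cancels.\<close>

lemma ao_line:
  assumes c: "q ^ 2 = poly f p"
  shows "ao p q [:- L, 1:] = (if q = poly L p then Polynomial.order p (L ^ 2 - f) else 0)"
proof (cases "q = poly L p")
  case False
  thus ?thesis by (simp add: ao_eq_0_iff[OF c] C_dvd_deg1)
next
  case True
  have nC: "\<not> C dvd [:- L, 1:]" by (simp add: C_dvd_deg1)
  have N: "nrm [:- L, 1:] = L ^ 2 - f" by simp
  have N0: "L ^ 2 - f \<noteq> 0" using nC unfolding nrm_eq_0_iff[symmetric] N .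
  have s: "ao p q [:- L, 1:] + ao p (- q) [:- L, 1:] = (if q = 0 then 2 else 1) * Polynomial.order p (L ^ 2 - f)"
    using ao_nrm[OF c nC] N0 unfolding N by (simp add: ao_const[OF c])
  show ?thesis
  proof (cases "q = 0")
    case q: True
    thus ?thesis using s True by simp
  next
    case q: False
    have "q = - q \<longleftrightarrow> q = 0" using two_neq_0 by (metis add.inverse_neutral eq_neg_iff_add_eq_0 mult_2 mult_eq_0_iff)
    hence "ao p (- q) [:- L, 1:] = 0" using nC c q True by (subst ao_eq_0_iff) auto
    thus ?thesis using s True q by simp
  qed
qed

lemma div_of_line:
  assumes L: "L ^ 2 - f = - ([:- x1, 1:] * [:- x2, 1:] * [:- x3, 1:])"
  shows "div_of f [:- L, 1:] = frag_of (Affine x1 (poly L x1)) + frag_of (Affine x2 (poly L x2))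
     + frag_of (Affine x3 (poly L x3)) - frag_cmul 3 pinf" (is "_ = ?R")
proof (rule divisor_eqI)
  have nC: "\<not> C dvd [:- L, 1:]" by (simp add: C_dvd_deg1)
  have on: "poly L x ^ 2 = poly f x" if "x = x1 \<or> x = x2 \<or> x = x3" for x
  proof -
    have "poly (L ^ 2 - f) x = 0" unfolding L poly_minus poly_mult using that by auto
    thus ?thesis by simp
  qed
  {
    have "degree (L ^ 2 - f) = 3" unfolding L degree_minus
      by (subst degree_mult_eq, simp, simp, subst degree_mult_eq) simp_all
    thus "Poly_Mapping.lookup (div_of f [:- L, 1:]) Infinity = Poly_Mapping.lookup ?R Infinity"
      using nC by (simp add: lookup_div_infinity lookup_add lookup_minus)
  next
    fix p q :: 'a
    have o: "Polynomial.order p [:- x, 1:] = (if p = x then 1 else 0)" for x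
      using order_power_n_n[of x 1] by (auto intro: order_0I)
    have "Polynomial.order p (L ^ 2 - f) = (if p = x1 then 1 else 0) + (if p = x2 then 1 else 0) + (if p = x3 then 1 else 0)"
      unfolding L order_uminus by (subst order_mult, simp, subst order_mult) (simp_all add: o del: mult_pCons_left mult_pCons_right)
    thus "Poly_Mapping.lookup (div_of f [:- L, 1:]) (Affine p q) = Poly_Mapping.lookup ?R (Affine p q)"
      using nC on[of p] by (auto simp: lookup_div_affine lookup_add lookup_minus ao_line)
  }
qed

text \<open>\<open>f - L ^ 2\<close> is a monic cubic with roots \<open>x1\<close> and
  \<open>x2\<close>; its third root is read off the coefficient of \<open>x ^ 2\<close>, which is
  the formula in \<open>point_add\<close>. In the tangent case the slope is such that the derivative
  vanishes at \<open>x1\<close>.\<close>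

lemma chord_tangent_cubic:
  assumes c: "y1 ^ 2 = poly f x1" "y2 ^ 2 = poly f x2" and ne: "\<not> (x1 = x2 \<and> y1 = - y2)"
    and s: "s = (if x1 = x2 then poly (pderiv f) x1 / (2 * y1) else (y2 - y1) / (x2 - x1))"
    and L: "L = [:y1 - s * x1, s:]"
  shows "L ^ 2 - f = - ([:- x1, 1:] * [:- x2, 1:] * [:- (s ^ 2 - coeff f 2 - x1 - x2), 1:])"
    and "poly L x1 = y1" "poly L x2 = y2"
proof -
  show L1: "poly L x1 = y1" by (simp add: L)
  have same: "y1 = y2 \<and> y1 \<noteq> 0" if "x1 = x2"
    using c ne that power2_eq_iff[of y1 y2] by auto
  show L2: "poly L x2 = y2"
  proof (cases "x1 = x2")
    case True thus ?thesis using L1 same by simp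
  next
    case False
    hence "s * (x2 - x1) = y2 - y1" unfolding s by simp
    thus ?thesis unfolding L by (simp add: algebra_simps)
  qed
  let ?g = "f - L ^ 2"
  have Lsq: "L ^ 2 = [:(y1 - s * x1) ^ 2, 2 * s * (y1 - s * x1), s ^ 2:]"
    by (simp add: L power2_eq_square algebra_simps)
  have "coeff (L ^ 2) 3 = 0" "coeff (L ^ 2) 2 = s ^ 2"
    unfolding Lsq by (simp_all add: numeral_3_eq_3 coeff_pCons split: nat.splits)
  hence cg: "coeff ?g 3 = 1" and cg2: "coeff ?g 2 = coeff f 2 - s ^ 2"
    using coeff_f by simp_all
  have "degree (L ^ 2) \<le> 2" unfolding Lsq by (simp add: degree_pCons_le le_SucI)
  hence dg: "degree ?g = 3"
    using degree_add_eq_left[of "- (L ^ 2)" f] degree_f by simp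
  obtain g1 where g1: "?g = [:- x1, 1:] * g1"
    using root_factor[of ?g x1] c L1 by auto
  have "poly g1 x2 = 0"
  proof (cases "x1 = x2")
    case False
    have "poly ?g x2 = (x2 - x1) * poly g1 x2" unfolding g1 by (simp add: algebra_simps)
    thus ?thesis using c L2 False by simp
  next
    case True
    have "poly (pderiv ?g) x1 = poly g1 x1"
      unfolding g1 pderiv_mult by (simp add: pderiv_pCons)
    moreover have "poly (pderiv ?g) x1 = poly (pderiv f) x1 - 2 * y1 * s"
      using L1 by (simp add: pderiv_diff power2_eq_square pderiv_mult) (simp add: L pderiv_pCons algebra_simps)
    moreover have "2 * y1 * s = poly (pderiv f) x1"
      using True same two_neq_0 by (auto simp: s)
    ultimately show ?thesis using True by simp
  qed
  then obtain g2 where g2: "g1 = [:- x2, 1:] * g2" using root_factor by blast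
  have "g1 \<noteq> 0" using dg g1 by auto
  moreover from this have "g2 \<noteq> 0" using g2 by auto
  ultimately have "degree ?g = 2 + degree g2"
    using g1 g2 degree_linear_mult[of g1 x1] degree_linear_mult[of g2 x2] by simp
  hence "degree g2 = 1" using dg by simp
  then obtain u v where g2': "g2 = [:u, v:]" by (metis degree1_coeffs)
  have e: "?g = [:- x1, 1:] * ([:- x2, 1:] * [:u, v:])" using g1 g2 g2' by simp
  have "coeff ?g 3 = v" unfolding e by (simp add: numeral_3_eq_3)
  hence v: "v = 1" using cg by simp
  have "coeff ?g 2 = u - v * x1 - v * x2" unfolding e by (simp add: numeral_2_eq_2 algebra_simps)
  hence u: "u = - (s ^ 2 - coeff f 2 - x1 - x2)" using cg2 v by (simp add: algebra_simps)
  have "L ^ 2 - f = - ?g" by simp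
  also have "?g = [:- x1, 1:] * [:- x2, 1:] * [:- (s ^ 2 - coeff f 2 - x1 - x2), 1:]"
    using e unfolding u v by (simp only: mult.assoc)
  finally show "L ^ 2 - f = - ([:- x1, 1:] * [:- x2, 1:] * [:- (s ^ 2 - coeff f 2 - x1 - x2), 1:])" .
qed

text \<open>The witness is the chord or tangent divided by the vertical line through its third
  intersection point. For opposite points it is the vertical line alone.\<close>

lemma point_add_princ:
  assumes "P \<in> curve_points f" "Q \<in> curve_points f"
  shows "point_add f P Q \<in> curve_points f \<and> princ (frag_of P + frag_of Q - frag_of (point_add f P Q) - pinf)"
  using assms(1)
proof (cases rule: curve_cases)
  case 1
  thus ?thesis using assms by (simp add: princ_0)
next
  case P: (2 x1 y1)
  show ?thesis using assms(2)
  proof (cases rule: curve_cases)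
    case 1
    thus ?thesis using assms P by (simp add: princ_0)
  next
    case Q: (2 x2 y2)
    show ?thesis
    proof (cases "x1 = x2 \<and> y1 = - y2")
      case True
      have "princ (div_of f [:[:- x2, 1:]:])" by (rule princ_div_of) simp
      thus ?thesis using P Q True unfolding div_of_vertical[OF Q(2)]
        by (simp add: frag_cmul_distrib[of 1 1, simplified] algebra_simps)
    next
      case False
      define s where "s = (if x1 = x2 then poly (pderiv f) x1 / (2 * y1) else (y2 - y1) / (x2 - x1))"
      define x3 where "x3 = s ^ 2 - coeff f 2 - x1 - x2"
      define L where "L = [:y1 - s * x1, s:]"
      note ct = chord_tangent_cubic[OF P(2) Q(2) False s_def L_def, folded x3_def]
      have a: "point_add f P Q = Affine x3 (- poly L x3)"
      proof -
        have "point_add f P Q = Affine x3 (- (y1 + s * (x3 - x1)))"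
          using False by (simp only: P(1) Q(1) point_add.simps if_False Let_def s_def x3_def)
        thus ?thesis by (simp add: L_def algebra_simps)
      qed
      have on3: "poly L x3 ^ 2 = poly f x3"
      proof -
        have "poly (L ^ 2 - f) x3 = 0" unfolding ct(1) poly_minus poly_mult by simp
        thus ?thesis by simp
      qed
      have "princ (div_of f [:- L, 1:] - div_of f [:[:- x3, 1:]:])"
        by (intro princ_diff princ_div_of) (simp_all add: C_dvd_deg1)
      also have "div_of f [:- L, 1:] - div_of f [:[:- x3, 1:]:]
          = frag_of P + frag_of Q - frag_of (point_add f P Q) - pinf"
        unfolding a unfolding div_of_line[OF ct(1)] div_of_vertical[OF on3] ct(2,3) P(1) Q(1)
        by (rule divisor_eqI) (auto simp: lookup_add lookup_minus)
      finally show ?thesis using on3 by (simp add: a)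
    qed
  qed
qed

lemma point_mult_princ:
  assumes "T \<in> curve_points f"
  shows "point_mult f k T \<in> curve_points f
    \<and> princ (frag_cmul (int k) (frag_of T - pinf) - (frag_of (point_mult f k T) - pinf))"
proof (induction k)
  case 0
  show ?case by (simp add: point_mult_def princ_0)
next
  case (Suc k)
  have e: "point_mult f (Suc k) T = point_add f T (point_mult f k T)" by (simp add: point_mult_def)
  have 1: "point_add f T (point_mult f k T) \<in> curve_points f"
     "princ (frag_of T + frag_of (point_mult f k T) - frag_of (point_add f T (point_mult f k T)) - pinf)"
    using point_add_princ[OF assms, of "point_mult f k T"] Suc by auto
  from princ_add[OF conjunct2[OF Suc] this(2)]
  have "princ (frag_cmul (int (Suc k)) (frag_of T - pinf) - (frag_of (point_add f T (point_mult f k T)) - pinf))"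
    by (simp add: frag_cmul_distrib algebra_simps)
  with 1 show ?case unfolding e by blast
qed

end

section \<open>Mumford representations and ideals\<close>

lemma poly_poly_eval2: "poly (poly s v) p = eval2 s p (poly v p)"
  by (induction s) (auto simp: eval2_def)

lemma div_degree_cmul: "div_degree (frag_cmul k D) = k * div_degree D"
proof (cases "k = 0")
  case False
  hence "Poly_Mapping.keys (frag_cmul k D) = Poly_Mapping.keys D" by auto
  thus ?thesis by (simp add: div_degree_def sum_distrib_left)
qed (simp add: div_degree_def)

text \<open>A principal ideal argument: a generator of the ideal of all \<open>w\<close> has no root.\<close>

lemma one_mem_ideal_if_no_common_root:
  fixes W :: "'a::alg_closed_field poly set"
  assumes W: "is_ideal W" and w0: "w0 \<in> W" "w0 \<noteq> 0"
    and roots: "\<And>p. poly w0 p = 0 \<Longrightarrow> \<exists>w\<in>W. poly w p \<noteq> 0"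
  shows "1 \<in> W"
proof -
  define m where "m = arg_min degree (\<lambda>w. w \<in> W \<and> w \<noteq> 0)"
  have m: "m \<in> W" "m \<noteq> 0"
    using arg_min_natI[of "\<lambda>w. w \<in> W \<and> w \<noteq> 0" w0 degree] w0 by (auto simp: m_def)
  have min: "degree m \<le> degree w" if "w \<in> W" "w \<noteq> 0" for w
    using arg_min_nat_le[of "\<lambda>w. w \<in> W \<and> w \<noteq> 0" w degree] that by (auto simp: m_def)
  have dvd: "m dvd w" if "w \<in> W" for w
  proof (rule ccontr)
    assume "\<not> m dvd w"
    hence nz: "w mod m \<noteq> 0" by (simp add: dvd_eq_mod_eq_0)
    have "w mod m = w - w div m * m" by (simp add: minus_div_mult_eq_mod)
    hence "w mod m \<in> W" using W that m by (auto intro: is_ideal_diff is_ideal_mult)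
    with min nz have "degree m \<le> degree (w mod m)" by blast
    moreover have "degree (w mod m) < degree m" using degree_mod_less[OF m(2), of w] nz by auto
    ultimately show False by simp
  qed
  have "degree m = 0"
  proof (rule ccontr)
    assume "degree m \<noteq> 0"
    then obtain p where p: "poly m p = 0" using alg_closed_imp_poly_has_root[of m] by auto
    hence "poly w p = 0" if "w \<in> W" for w using dvd[OF that] by auto
    with roots[of p] w0 show False by blast
  qed
  then obtain c where c: "m = [:c:]" "c \<noteq> 0" using m(2) by (metis degree_eq_zeroE pCons_0_0)
  have "[:inverse c:] * m \<in> W" using W m(1) by (rule is_ideal_mult)
  moreover have "[:inverse c:] * m = 1" using c by (simp add: one_pCons)
  ultimately show ?thesis by simp
qed

context elliptic
begin

lemma vanish_eval2_eq_0:
  assumes "q ^ 2 = poly f p" "vanish C p q (unif p q) n h" "n > 0"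
  shows "eval2 h p q = 0"
proof -
  from assms(2) obtain s t where st: "eval2 s p q \<noteq> 0" "C dvd s * h - t * unif p q ^ n"
    by (auto simp: vanish_def)
  have "eval2 C p q = 0" by (simp add: eval2_C assms(1))
  hence "eval2 (s * h - t * unif p q ^ n) p q = 0" using st(2) eval2_dvd_0 by blast
  moreover have "eval2 (unif p q) p q = 0" by (simp add: unif_def)
  ultimately show ?thesis using st(1) assms(3) by (simp add: zero_power)
qed

lemma vanish_ao: "q ^ 2 = poly f p \<Longrightarrow> \<not> C dvd h \<Longrightarrow> vanish C p q (unif p q) n h \<longleftrightarrow> n \<le> ao p q h"
  using vanish_iff[of q p n h] by (simp add: local_ord_ao)

subsection \<open>Reduction\<close>

lemma semi_reduced_point: "q ^ 2 = poly f p \<Longrightarrow> semi_reduced f (frag_of (Affine p q))"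
  unfolding semi_reduced_def is_divisor_def
  by (auto simp: keys_frag_of split: if_splits)

lemma div_degree_frag_of: "div_degree (frag_of P) = 1"
  by (simp add: div_degree_def keys_frag_of)

lemma semi_reduced_0: "semi_reduced f 0"
  by (auto simp: semi_reduced_def is_divisor_def)

lemma semi_reduced_degree_le_1:
  assumes "semi_reduced f R" "div_degree R \<le> 1"
  obtains "R = 0" | p q where "R = frag_of (Affine p q)" "q ^ 2 = poly f p"
proof (cases "R = 0")
  case False
  then obtain P where P: "P \<in> Poly_Mapping.keys R" by fastforce
  from assms(1) have sr: "Poly_Mapping.keys R \<subseteq> curve_points f" "Infinity \<notin> Poly_Mapping.keys R"
      "\<And>P. 0 \<le> Poly_Mapping.lookup R P"
    by (auto simp: semi_reduced_def is_divisor_def)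
  have pos: "1 \<le> Poly_Mapping.lookup R Q" if "Q \<in> Poly_Mapping.keys R" for Q
    using sr(3)[of Q] that by (simp add: in_keys_iff)
  have deg: "div_degree R = Poly_Mapping.lookup R P + (\<Sum>Q\<in>Poly_Mapping.keys R - {P}. Poly_Mapping.lookup R Q)"
    unfolding div_degree_def using P by (simp add: sum.remove)
  have "int (card (Poly_Mapping.keys R - {P})) \<le> (\<Sum>Q\<in>Poly_Mapping.keys R - {P}. Poly_Mapping.lookup R Q)"
    using sum_mono[of "Poly_Mapping.keys R - {P}" "\<lambda>_. 1 :: int" "Poly_Mapping.lookup R"] pos by simp
  with deg pos[OF P] assms(2) have "card (Poly_Mapping.keys R - {P}) = 0" "Poly_Mapping.lookup R P = 1"
    by linarith+
  moreover from this(1) have "Poly_Mapping.keys R - {P} = {}"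
    by (metis card_0_eq finite_Diff finite_keys)
  ultimately have k: "Poly_Mapping.keys R = {P}" "Poly_Mapping.lookup R P = 1" using P by auto
  have "R = frag_of P"
  proof (rule poly_mapping_eqI)
    fix Q show "Poly_Mapping.lookup R Q = Poly_Mapping.lookup (frag_of P) Q"
      using k by (cases "Q = P") (auto simp: not_in_keys_iff_lookup_eq_zero[symmetric])
  qed
  moreover from P sr(1,2) have "P \<in> curve_points f" "P \<noteq> Infinity" by auto
  ultimately show ?thesis using that(2) by (auto elim: curve_cases)
qed (use that in blast)

text \<open>Justifies the definite description in \<open>reduction\<close>: the candidates are zero
  and single affine points, and neither two distinct points nor a point and \<open>O\<close> are
  equivalent.\<close>

lemma semi_reduced_unique:
  assumes "semi_reduced f R" "div_degree R \<le> 1" "semi_reduced f R'" "div_degree R' \<le> 1"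
    and pr: "princ ((R - frag_cmul (div_degree R) pinf) - (R' - frag_cmul (div_degree R') pinf))"
  shows "R = R'"
proof -
  have d0: "div_degree (0 :: 'a divisor) = 0" by (simp add: div_degree_def)
  show ?thesis using assms(1,2)
  proof (cases rule: semi_reduced_degree_le_1)
    case R: 1
    show ?thesis using assms(3,4)
    proof (cases rule: semi_reduced_degree_le_1)
      case (2 p q)
      with princ_uminus[OF pr] R have "princ (frag_of (Affine p q) - pinf)" 
        by (simp add: d0 div_degree_frag_of)
      with not_princ_point_infinity 2 show ?thesis by blast
    qed (use R in simp)
  next
    case R: (2 p q)
    show ?thesis using assms(3,4)
    proof (cases rule: semi_reduced_degree_le_1)
      case 1
      with pr R have "princ (frag_of (Affine p q) - pinf)"
        by (simp add: d0 div_degree_frag_of)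
      with not_princ_point_infinity R show ?thesis by blast
    next
      case (2 p' q')
      with pr R have "princ (frag_of (Affine p q) - frag_of (Affine p' q'))"
        by (simp add: div_degree_frag_of)
      with princ_point_point[OF R(2) 2(2)] R 2 show ?thesis by simp
    qed
  qed
qed

lemma reduction_eqI:
  assumes R: "semi_reduced f R" "div_degree R \<le> 1"
    and pr: "princ ((E - frag_cmul (div_degree E) pinf) - (R - frag_cmul (div_degree R) pinf))"
  shows "reduction f E = R"
  unfolding reduction_def
proof (rule the_equality)
  show "semi_reduced f R \<and> div_degree R \<le> 1 \<and>
     lin_equiv f (E - frag_cmul (div_degree E) pinf) (R - frag_cmul (div_degree R) pinf)"
    using assms by (simp add: lin_equiv_iff)
next
  fix R' assume R': "semi_reduced f R' \<and> div_degree R' \<le> 1 \<and>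
     lin_equiv f (E - frag_cmul (div_degree E) pinf) (R' - frag_cmul (div_degree R') pinf)"
  hence "princ ((E - frag_cmul (div_degree E) pinf) - (R' - frag_cmul (div_degree R') pinf))"
    by (simp add: lin_equiv_iff)
  from princ_diff[OF pr this]
  have "princ ((R' - frag_cmul (div_degree R') pinf) - (R - frag_cmul (div_degree R) pinf))"
    by (simp add: algebra_simps)
  with R R' show "R' = R" by (intro semi_reduced_unique) auto
qed

end

locale mumford = elliptic +
  fixes D :: "'a divisor" and u v :: "'a poly"
  assumes semi: "semi_reduced f D" and mum: "mumford_rep f D u v"
begin

section \<open>Multiplicities of a semi-reduced divisor and the polynomial \<open>u\<close>\<close>

definition mlt :: "'a point \<Rightarrow> nat" where
  "mlt P = nat (Poly_Mapping.lookup D P)"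

lemma lookup_D: "Poly_Mapping.lookup D P = int (mlt P)"
  using semi by (simp add: mlt_def semi_reduced_def)

lemma keys_D: "P \<in> Poly_Mapping.keys D \<longleftrightarrow> mlt P > 0"
  by (simp add: in_keys_iff lookup_D)

lemma keys_cases:
  assumes "mlt P > 0"
  obtains p q where "P = Affine p q" "q ^ 2 = poly f p"
proof -
  from assms have "P \<in> Poly_Mapping.keys D" by (simp add: keys_D)
  with semi have "P \<in> curve_points f" "P \<noteq> Infinity"
    by (auto simp: semi_reduced_def is_divisor_def)
  thus ?thesis using that by (auto elim: curve_cases)
qed

lemma mlt_Infinity [simp]: "mlt Infinity = 0"
  using keys_cases[of Infinity] by auto

lemma mlt_off_curve: "q ^ 2 \<noteq> poly f p \<Longrightarrow> mlt (Affine p q) = 0"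
  using keys_cases[of "Affine p q"] by auto

lemma mlt_fixed: "mlt (Affine p 0) > 0 \<Longrightarrow> mlt (Affine p 0) = 1"
proof -
  assume m: "mlt (Affine p 0) > 0"
  have "\<forall>P. 0 < Poly_Mapping.lookup D P \<longrightarrow>
        (if P = iota P then Poly_Mapping.lookup D P = 1 else Poly_Mapping.lookup D (iota P) = 0)"
    using semi unfolding semi_reduced_def by blast
  from this[rule_format, of "Affine p 0"] m show ?thesis by (simp add: lookup_D)
qed

lemma neg_eq_self: "- q = (q::'a) \<longleftrightarrow> q = 0"
  using two_neq_0 by (metis add.inverse_neutral eq_neg_iff_add_eq_0 mult_2 mult_eq_0_iff)

lemma mlt_iota: "mlt (Affine p q) > 0 \<Longrightarrow> q \<noteq> 0 \<Longrightarrow> mlt (Affine p (- q)) = 0"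
proof -
  assume m: "mlt (Affine p q) > 0" "q \<noteq> 0"
  have "\<forall>P. 0 < Poly_Mapping.lookup D P \<longrightarrow>
        (if P = iota P then Poly_Mapping.lookup D P = 1 else Poly_Mapping.lookup D (iota P) = 0)"
    using semi unfolding semi_reduced_def by blast
  from this[rule_format, of "Affine p q"] m neg_eq_self[of q] show ?thesis
    by (simp add: lookup_D)
qed

text \<open>Points of the curve with the same \<open>x\<close> are equal or opposite, and
  semi-reducedness excludes distinct opposite pairs. Hence inverting polynomials in \<open>x\<close>
  alone isolates a point of the support.\<close>

lemma same_x:
  assumes "mlt (Affine p q) > 0" "mlt (Affine p q') > 0"
  shows "q = q'"
proof -
  have "q ^ 2 = poly f p" "q' ^ 2 = poly f p" using assms mlt_off_curve by (metis less_irrefl)+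
  hence "q = q' \<or> q = - q'" using power2_eq_iff[of q q'] by simp
  thus ?thesis using mlt_iota[OF assms(2)] assms(1) by (cases "q' = 0") auto
qed

lemma u_eq: "u = (\<Prod>P\<in>Poly_Mapping.keys D. [:- xcoord P, 1:] ^ mlt P)"
  using mum by (simp add: mumford_rep_def mlt_def)

lemma u_neq_0: "u \<noteq> 0"
  unfolding u_eq by simp

lemma lead_coeff_u: "lead_coeff u = 1"
  unfolding u_eq lead_coeff_prod by (simp add: lead_coeff_power)

lemma degree_u: "int (degree u) = div_degree D"
proof -
  have "degree u = (\<Sum>P\<in>Poly_Mapping.keys D. mlt P)"
    unfolding u_eq by (subst degree_prod_eq_sum_degree) (simp_all add: degree_power_eq)
  thus ?thesis by (simp add: div_degree_def lookup_D)
qed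

lemma u_factor:
  assumes "mlt (Affine p q) > 0"
  obtains u' where "u = [:- p, 1:] ^ mlt (Affine p q) * u'" "poly u' p \<noteq> 0"
proof
  let ?u' = "\<Prod>P\<in>Poly_Mapping.keys D - {Affine p q}. [:- xcoord P, 1:] ^ mlt P"
  show "u = [:- p, 1:] ^ mlt (Affine p q) * ?u'"
    unfolding u_eq using assms by (subst prod.remove[of _ "Affine p q"]) (auto simp: keys_D)
  show "poly ?u' p \<noteq> 0"
  proof
    assume "poly ?u' p = 0"
    then obtain P where P: "P \<in> Poly_Mapping.keys D - {Affine p q}" "xcoord P = p"
      by (auto simp: poly_prod)
    then obtain q' where "P = Affine p q'" by (auto simp: keys_D elim: keys_cases)
    with P same_x[OF assms, of q'] show False by (auto simp: keys_D)
  qed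
qed

lemma order_u: "mlt (Affine p q) > 0 \<Longrightarrow> Polynomial.order p u = mlt (Affine p q)"
proof -
  assume "mlt (Affine p q) > 0"
  then obtain u' where u': "u = [:- p, 1:] ^ mlt (Affine p q) * u'" "poly u' p \<noteq> 0"
    by (rule u_factor)
  have "Polynomial.order p u = Polynomial.order p ([:- p, 1:] ^ mlt (Affine p q)) + Polynomial.order p u'"
    using u_neq_0 u'(1) order_mult by metis
  moreover have "Polynomial.order p u' = 0" using u'(2) by (rule order_0I)
  ultimately show ?thesis by (simp only: order_power_n_n)
qed

lemma u_root: "poly u p = 0 \<Longrightarrow> \<exists>q. mlt (Affine p q) > 0"
proof -
  assume "poly u p = 0"
  then obtain P where P: "mlt P > 0" "xcoord P = p"
    unfolding u_eq by (auto simp: poly_prod keys_D)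
  from P(1) obtain x y where "P = Affine x y" by (rule keys_cases)
  with P show ?thesis by auto
qed

text \<open>For \<open>q \<noteq> 0\<close> at most one summand is non-zero; for
  \<open>q = 0\<close> the two equal summands account for the ramification.\<close>

lemma ao_u:
  assumes c: "q ^ 2 = poly f p"
  shows "ao p q [:u:] = mlt (Affine p q) + mlt (Affine p (- q))"
proof (cases "\<exists>q. mlt (Affine p q) > 0")
  case False
  hence "poly u p \<noteq> 0" using u_root by blast
  thus ?thesis using False u_neq_0 by (simp add: ao_const[OF c] order_0I)
next
  case True
  then obtain q0 where q0: "mlt (Affine p q0) > 0" by blast
  hence "q0 ^ 2 = poly f p" using mlt_off_curve by (metis less_irrefl)
  hence qq: "q = q0 \<or> q = - q0" using c power2_eq_iff[of q q0] by simp
  have o: "ao p q [:u:] = (if q = 0 then 2 else 1) * mlt (Affine p q0)"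
    using u_neq_0 order_u[OF q0] by (simp add: ao_const[OF c])
  show ?thesis
  proof (cases "q0 = 0")
    case True
    with qq o show ?thesis by simp
  next
    case False
    with qq o mlt_iota[OF q0 False] show ?thesis by auto
  qed
qed

lemma vanish_v:
  assumes "mlt (Affine p q) > 0"
  shows "vanish C p q (unif p q) (mlt (Affine p q)) [:- v, 1:]"
proof -
  have c: "q ^ 2 = poly f p" using assms mlt_off_curve by (metis less_irrefl)
  have "enat (mlt (Affine p q)) \<le> affine_ord f (Affine p q) [:- v, 1:]"
    using mum assms unfolding mumford_rep_def mlt_def[symmetric] keys_D[symmetric] by blast
  thus ?thesis by (simp add: affine_ord_Affine vanish_iff[OF c])
qed

lemma poly_v: "mlt (Affine p q) > 0 \<Longrightarrow> poly v p = q"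
proof -
  assume m: "mlt (Affine p q) > 0"
  hence c: "q ^ 2 = poly f p" using mlt_off_curve by (metis less_irrefl)
  from vanish_eval2_eq_0[OF c vanish_v[OF m] m] show ?thesis by simp
qed

text \<open>For \<open>q \<noteq> 0\<close>, \<open>u\<close> is a power of \<open>x - p\<close>
  times a polynomial non-zero at \<open>p\<close>. For \<open>q = 0\<close> the multiplicity is 1,
  and \<open>y = (y - v) + v\<close> with \<open>v\<close> divisible by \<open>x - p\<close>. The
  unit \<open>w\<close> involves \<open>x\<close> only, as the patching requires.\<close>

lemma local_generators:
  assumes "mlt (Affine p q) > 0"
  shows "\<exists>w \<alpha> \<beta>. poly w p \<noteq> 0 \<and> [:w:] * unif p q ^ mlt (Affine p q) = \<alpha> * [:u:] + \<beta> * [:- v, 1:]"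
proof -
  obtain u' where u': "u = [:- p, 1:] ^ mlt (Affine p q) * u'" "poly u' p \<noteq> 0"
    using assms by (rule u_factor)
  show ?thesis
  proof (cases "q = 0")
    case False
    have "[:u':] * unif p q ^ mlt (Affine p q) = 1 * [:u:] + 0 * [:- v, 1:]"
      by (simp only: unif_def False if_False poly_const_pow const_poly_mult u'(1)) (simp add: mult.commute)
    with u'(2) show ?thesis by blast
  next
    case True
    from poly_v[OF assms] True have "poly v p = 0" by simp
    then obtain v' where v': "v = [:- p, 1:] * v'" using root_factor by blast
    have "mlt (Affine p q) = 1" using assms True mlt_fixed by simp
    with u'(1) have u: "u = [:- p, 1:] * u'" by simp
    have "u' * v = v' * u" unfolding v' u by (simp only: mult_ac)
    hence "[:u':] * unif p q ^ mlt (Affine p q) = [:v':] * [:u:] + [:u':] * [:- v, 1:]"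
      using True \<open>mlt (Affine p q) = 1\<close> by (simp add: unif_def mult.commute)
    with u'(2) show ?thesis by blast
  qed
qed

section \<open>The ideal generated by products of \<open>u\<close> and \<open>y - v\<close>\<close>

definition J :: "nat \<Rightarrow> 'a poly poly set" where
  "J k = ideal_gen (insert C {[:u:] ^ (k - i) * [:- v, 1:] ^ i | i. i \<le> k})"

lemma is_ideal_J: "is_ideal (J k)"
  unfolding J_def by (rule is_ideal_ideal_gen)

lemma C_in_J: "C \<in> J k"
  unfolding J_def by (rule ideal_gen_incl) simp

lemma gen_in_J: "i \<le> k \<Longrightarrow> [:u:] ^ (k - i) * [:- v, 1:] ^ i \<in> J k"
  unfolding J_def by (rule ideal_gen_incl) auto

lemma power_in_J: "(\<alpha> * [:u:] + \<beta> * [:- v, 1:]) ^ k \<in> J k"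
proof -
  have "(\<alpha> * [:u:] + \<beta> * [:- v, 1:]) ^ k
     = (\<Sum>i\<le>k. of_nat (k choose i) * (\<beta> * [:- v, 1:]) ^ i * (\<alpha> * [:u:]) ^ (k - i))"
    by (subst add.commute) (rule binomial_ring)
  also have "\<dots> = (\<Sum>i\<le>k. (of_nat (k choose i) * \<beta> ^ i * \<alpha> ^ (k - i)) * ([:u:] ^ (k - i) * [:- v, 1:] ^ i))"
    by (intro sum.cong refl) (simp only: power_mult_distrib mult_ac)
  also have "\<dots> \<in> J k"
    by (intro is_ideal_sum is_ideal_mult is_ideal_J gen_in_J) simp
  finally show ?thesis .
qed

lemma J_vanish:
  assumes "h \<in> J k" "mlt (Affine p q) > 0"
  shows "vanish C p q (unif p q) (k * mlt (Affine p q)) h"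
proof -
  let ?m = "mlt (Affine p q)"
  have c: "q ^ 2 = poly f p" using assms(2) mlt_off_curve by (metis less_irrefl)
  have "ao p q [:u:] \<ge> ?m" by (simp add: ao_u[OF c])
  hence u: "vanish C p q (unif p q) ?m [:u:]" using u_neq_0 by (subst vanish_ao[OF c]) auto
  have "vanish C p q (unif p q) (k * ?m) ([:u:] ^ (k - i) * [:- v, 1:] ^ i)" if "i \<le> k" for i
    using vanish_mult[OF vanish_power[OF u, of "k - i"] vanish_power[OF vanish_v[OF assms(2)], of i]] that
    by (simp flip: add_mult_distrib)
  hence "J k \<subseteq> {h. vanish C p q (unif p q) (k * ?m) h}"
    unfolding J_def by (intro ideal_gen_least is_ideal_vanish) (auto intro: vanishI[of 1 _ _ _ _ 0])
  with assms(1) show ?thesis by blast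
qed

text \<open>Vanishing supplies a unit \<open>s\<close> in \<open>x\<close> and \<open>y\<close>, but
  patching needs one in \<open>x\<close> alone. Modulo \<open>y - v\<close> the polynomial
  \<open>s\<close> agrees with \<open>s(x, v)\<close>, and \<open>(y - v) ^ k\<close> lies in
  \<open>J k\<close>, so the \<open>k\<close>-th power of \<open>s(x, v)\<close> can take the place
  of \<open>s\<close>. It is non-zero at \<open>p\<close> because \<open>v(p) = q\<close>.\<close>

lemma local_membership:
  assumes m: "mlt (Affine p q) > 0" and h: "vanish C p q (unif p q) (k * mlt (Affine p q)) h"
  shows "\<exists>w. poly w p \<noteq> 0 \<and> [:w:] * h \<in> J k"
proof -
  let ?m = "mlt (Affine p q)" and ?y = "[:- v, 1:]"
  obtain w \<alpha> \<beta> where w: "poly w p \<noteq> 0" "[:w:] * unif p q ^ ?m = \<alpha> * [:u:] + \<beta> * ?y"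
    using local_generators[OF m] by blast
  obtain s t where st: "eval2 s p q \<noteq> 0" "C dvd s * h - t * unif p q ^ (k * ?m)"
    using h by (auto simp: vanish_def)
  have "poly (s - [:poly s v:]) v = 0" by simp
  from root_factor[OF this] obtain t' where "s - [:poly s v:] = ?y * t'" by blast
  hence s: "[:poly s v:] - (- (?y * t')) = s" by (simp add: algebra_simps)
  \<comment> \<open>With \<open>A = s(x, v)\<close> and \<open>B = - (y - v) * t'\<close> one has
    \<open>A - B = s\<close>, so \<open>s\<close> divides \<open>A ^ k - B ^ k\<close>, while
    \<open>B ^ k\<close> lies in \<open>J k\<close>.\<close>
  have "s dvd [:poly s v:] ^ k - (- (?y * t')) ^ k"
    using diff_dvd_power_diff[of "[:poly s v:]" "- (?y * t')" k] unfolding s .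
  then obtain m' where m': "[:poly s v:] ^ k - (- (?y * t')) ^ k = s * m'" by (elim dvdE)
  have "[:w:] ^ k * unif p q ^ (k * ?m) = ([:w:] * unif p q ^ ?m) ^ k"
    by (simp only: power_mult_distrib power_mult[symmetric] mult.commute)
  hence "[:w:] ^ k * unif p q ^ (k * ?m) \<in> J k"
    using power_in_J w(2) by simp
  hence "t * ([:w:] ^ k * unif p q ^ (k * ?m)) + [:w:] ^ k * (s * h - t * unif p q ^ (k * ?m)) \<in> J k"
    by (rule is_ideal_add[OF is_ideal_J is_ideal_mult[OF is_ideal_J] is_ideal_mult[OF is_ideal_J]])
       (rule is_ideal_dvd[OF is_ideal_J C_in_J st(2)])
  also have "t * ([:w:] ^ k * unif p q ^ (k * ?m)) + [:w:] ^ k * (s * h - t * unif p q ^ (k * ?m)) = [:w:] ^ k * (s * h)"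
    by (simp add: algebra_simps)
  finally have 1: "[:w:] ^ k * (s * h) \<in> J k" .
  have y: "?y ^ k \<in> J k" using gen_in_J[of k k] by simp
  have "m' * ([:w:] ^ k * (s * h)) + ([:w:] ^ k * h * (- t') ^ k) * ?y ^ k \<in> J k"
    by (rule is_ideal_add[OF is_ideal_J is_ideal_mult[OF is_ideal_J 1] is_ideal_mult[OF is_ideal_J y]])
  also have "m' * ([:w:] ^ k * (s * h)) + ([:w:] ^ k * h * (- t') ^ k) * ?y ^ k
     = [:w:] ^ k * h * (s * m' + (- (?y * t')) ^ k)"
  proof -
    have "(- (?y * t')) ^ k = (- t') ^ k * ?y ^ k"
      by (metis mult_minus_left power_mult_distrib mult.commute)
    thus ?thesis by (simp only: distrib_left mult_ac)
  qed
  also have "\<dots> = [:w ^ k * poly s v ^ k:] * h"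
    unfolding m'[symmetric] by (simp add: poly_const_pow mult_ac)
  finally have "[:w ^ k * poly s v ^ k:] * h \<in> J k" .
  moreover have "poly (w ^ k * poly s v ^ k) p \<noteq> 0"
    using w(1) st(1) poly_v[OF m] by (simp add: poly_poly_eval2)
  ultimately show ?thesis by blast
qed

text \<open>For given \<open>h\<close>, the polynomials \<open>w\<close> in \<open>x\<close> with
  \<open>w * h \<in> J k\<close> form an ideal that contains \<open>u ^ k\<close>. By
  \<open>local_membership\<close> no root of \<open>u\<close> is common to all its members, so it
  contains 1.\<close>

lemma ideal_eq_J: "{h. \<forall>P. mlt P > 0 \<longrightarrow> enat (k * mlt P) \<le> affine_ord f P h} = J k"
proof (intro equalityI subsetI)
  fix h assume h: "h \<in> J k"
  have "enat (k * mlt P) \<le> affine_ord f P h" if P: "mlt P > 0" for P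
  proof -
    obtain p q where pq: "P = Affine p q" "q ^ 2 = poly f p" using P by (rule keys_cases)
    show ?thesis using J_vanish[OF h, of p q] P pq by (simp add: affine_ord_Affine vanish_iff)
  qed
  thus "h \<in> {h. \<forall>P. mlt P > 0 \<longrightarrow> enat (k * mlt P) \<le> affine_ord f P h}" by blast
next
  fix h assume "h \<in> {h. \<forall>P. mlt P > 0 \<longrightarrow> enat (k * mlt P) \<le> affine_ord f P h}"
  hence h: "enat (k * mlt P) \<le> affine_ord f P h" if "mlt P > 0" for P using that by blast
  let ?W = "{w. [:w:] * h \<in> J k}"
  have "is_ideal ?W"
    unfolding is_ideal_def
  proof (intro conjI ballI allI)
    show "0 \<in> ?W" using is_ideal_0[OF is_ideal_J] by simp
  next
    fix a b assume "a \<in> ?W" "b \<in> ?W"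
    hence "[:a:] * h + [:b:] * h \<in> J k" by (intro is_ideal_add[OF is_ideal_J]) auto
    also have "[:a:] * h + [:b:] * h = [:a + b:] * h" by (simp add: smult_add_left)
    finally show "a + b \<in> ?W" by simp
  next
    fix a r assume "a \<in> ?W"
    hence "[:a:] * h \<in> J k" by blast
    hence "[:r:] * ([:a:] * h) \<in> J k" by (rule is_ideal_mult[OF is_ideal_J])
    thus "r * a \<in> ?W" by (simp add: mult.commute)
  qed
  hence "1 \<in> ?W"
  proof (rule one_mem_ideal_if_no_common_root)
    have "h * [:u:] ^ k \<in> J k" using gen_in_J[of 0 k] by (intro is_ideal_mult is_ideal_J) simp
    thus "u ^ k \<in> ?W" by (simp add: poly_const_pow mult.commute)
    show "u ^ k \<noteq> 0" using u_neq_0 by simp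
  next
    fix p assume "poly (u ^ k) p = 0"
    hence "poly u p = 0" by simp
    then obtain q where q: "mlt (Affine p q) > 0" using u_root by blast
    hence c: "q ^ 2 = poly f p" using mlt_off_curve by (metis less_irrefl)
    have "vanish C p q (unif p q) (k * mlt (Affine p q)) h"
      using h[OF q] by (simp add: affine_ord_Affine vanish_iff[OF c])
    from local_membership[OF q this] show "\<exists>w\<in>?W. poly w p \<noteq> 0" by blast
  qed
  thus "h \<in> J k" by (simp add: one_pCons[symmetric])
qed

lemma ideal_tilde_eq: "k \<ge> 1 \<Longrightarrow> ideal_tilde f (frag_cmul (int k) D) = J k"
  unfolding ideal_eq_J[symmetric] ideal_tilde_def
  by (auto simp: keys_D lookup_D nat_mult_distrib)

subsection \<open>Norms of elements of the ideal\<close>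

lemma J_iff: "h \<in> J k \<longleftrightarrow> (\<forall>p q. mlt (Affine p q) > 0 \<longrightarrow> vanish C p q (unif p q) (k * mlt (Affine p q)) h)"
proof
  assume R: "\<forall>p q. mlt (Affine p q) > 0 \<longrightarrow> vanish C p q (unif p q) (k * mlt (Affine p q)) h"
  show "h \<in> J k"
    unfolding ideal_eq_J[symmetric]
  proof (intro CollectI allI impI)
    fix P assume P: "mlt P > 0"
    then obtain p q where pq: "P = Affine p q" "q ^ 2 = poly f p" by (rule keys_cases)
    show "enat (k * mlt P) \<le> affine_ord f P h"
      using R P pq by (simp add: affine_ord_Affine vanish_iff)
  qed
qed (use J_vanish in blast)

lemma J_ao:
  assumes "h \<in> J k" "\<not> C dvd h" "q ^ 2 = poly f p"
  shows "k * mlt (Affine p q) \<le> ao p q h"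
  using J_vanish[OF assms(1), of p q] vanish_ao[OF assms(3,2)] by (cases "mlt (Affine p q) = 0") auto

text \<open>Divisibility in \<open>K[x]\<close> is tested by orders on the curve, using
  \<open>poly_dvd_pair\<close> with second component 0: at opposite points the lower bounds for
  \<open>h\<close> add up to the order of \<open>u ^ k\<close>.\<close>

lemma u_power_dvd_nrm:
  assumes "h \<in> J k" "\<not> C dvd h"
  shows "u ^ k dvd nrm h"
proof -
  have "\<exists>c0 c1. nrm h = u ^ k * c0 \<and> 0 = u ^ k * c1"
  proof (rule poly_dvd_pair)
    show "u ^ k \<noteq> 0" using u_neq_0 by simp
    show "\<not> C dvd [:nrm h, 0:]" using assms(2) by (simp add: nrm_eq_0_iff)
    fix p q assume c: "q ^ 2 = poly f p"
    have "ao p q [:u ^ k:] = k * (mlt (Affine p q) + mlt (Affine p (- q)))"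
      using ao_power[OF c, of "[:u:]" k] u_neq_0 by (simp add: poly_const_pow ao_u[OF c])
    also have "\<dots> \<le> ao p q h + ao p (- q) h"
      using J_ao[OF assms c] J_ao[OF assms, of "- q" p] c by (simp add: distrib_left add_mono)
    also have "\<dots> = ao p q [:nrm h, 0:]" using ao_nrm[OF c assms(2)] by simp
    finally show "ao p q [:u ^ k:] \<le> ao p q [:nrm h, 0:]" .
  qed
  thus ?thesis by auto
qed

lemma degree_nrm_ge: "h \<in> J k \<Longrightarrow> \<not> C dvd h \<Longrightarrow> k * degree u \<le> degree (nrm h)"
  using dvd_imp_degree_le[OF u_power_dvd_nrm, of h k] u_neq_0
  by (simp add: nrm_eq_0_iff degree_power_eq)

lemma nrm_eq_smult_u:
  assumes "h \<in> J k" "\<not> C dvd h" "degree (nrm h) = k * degree u"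
  shows "nrm h = smult (lead_coeff (nrm h)) (u ^ k)"
proof -
  obtain c where c: "nrm h = u ^ k * c" using u_power_dvd_nrm[OF assms(1,2)] by (elim dvdE)
  have nz: "c \<noteq> 0" "u ^ k \<noteq> 0" using assms(2) c u_neq_0 by (auto simp flip: nrm_eq_0_iff)
  have "degree (u ^ k) = k * degree u" using u_neq_0 by (rule degree_power_eq)
  with nz have "degree c = 0" using assms(3) unfolding c by (simp add: degree_mult_eq)
  then obtain r where r: "c = [:r:]" by (rule degree_eq_zeroE)
  have "lead_coeff (nrm h) = r"
    unfolding c lead_coeff_mult lead_coeff_power lead_coeff_u r by simp
  moreover have "nrm h = smult r (u ^ k)" unfolding c r by simp
  ultimately show ?thesis by (simp only:)
qed

text \<open>The norm is a constant times \<open>u ^ k\<close>. So at opposite points the orders of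
  \<open>h\<close> are at least those of \<open>k * D\<close> and have the same sum, which forces
  equality at both.\<close>

lemma div_of_minimal:
  assumes "h \<in> J k" "\<not> C dvd h" "degree (nrm h) = k * degree u"
  shows "div_of f h = frag_cmul (int k) D - frag_cmul (int k * div_degree D) pinf"
proof (rule divisor_eqI)
  show "Poly_Mapping.lookup (div_of f h) Infinity =
    Poly_Mapping.lookup (frag_cmul (int k) D - frag_cmul (int k * div_degree D) pinf) Infinity"
    using assms by (simp add: lookup_div_infinity lookup_minus lookup_D degree_u[symmetric])
next
  fix p q
  show "Poly_Mapping.lookup (div_of f h) (Affine p q) =
    Poly_Mapping.lookup (frag_cmul (int k) D - frag_cmul (int k * div_degree D) pinf) (Affine p q)"
  proof (cases "q ^ 2 = poly f p")
    case False
    thus ?thesis using assms(2) by (simp add: lookup_div_affine lookup_minus lookup_D mlt_off_curve)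
  next
    case c: True
    have N: "nrm h \<noteq> 0" using assms(2) by (simp add: nrm_eq_0_iff)
    have l: "lead_coeff (nrm h) \<noteq> 0" using N by simp
    have "[:nrm h:] = [:[:lead_coeff (nrm h):]:] * [:u:] ^ k"
      by (subst nrm_eq_smult_u[OF assms]) (simp add: poly_const_pow)
    hence "ao p q [:nrm h:] = ao p q [:[:lead_coeff (nrm h):]:] + k * ao p q [:u:]"
      using ao_mult[OF c, of "[:[:lead_coeff (nrm h):]:]" "[:u:] ^ k"] ao_power[OF c, of "[:u:]" k] l u_neq_0
      by (auto simp: poly_const_pow)
    also have "ao p q [:[:lead_coeff (nrm h):]:] = 0"
      using l by (subst ao_eq_0_iff[OF c]) auto
    finally have "ao p q h + ao p (- q) h = k * mlt (Affine p q) + k * mlt (Affine p (- q))"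
      using ao_nrm[OF c assms(2)] by (simp add: ao_u[OF c] distrib_left)
    moreover have "k * mlt (Affine p q) \<le> ao p q h" "k * mlt (Affine p (- q)) \<le> ao p (- q) h"
      using J_ao[OF assms(1,2) c] J_ao[OF assms(1,2), of "- q" p] c by auto
    ultimately have "ao p q h = k * mlt (Affine p q)" by linarith
    thus ?thesis using assms(2) c by (simp add: lookup_div_affine lookup_minus lookup_D)
  qed
qed

end

section \<open>Monomial ideals and Groebner bases\<close>

definition mdvd :: "nat \<times> nat \<Rightarrow> nat \<times> nat \<Rightarrow> bool" where
  "mdvd d e \<longleftrightarrow> fst d \<le> fst e \<and> snd d \<le> snd e"

lemma mono_gt_trans: "a >\<^sub>2 b \<Longrightarrow> b >\<^sub>2 c \<Longrightarrow> a >\<^sub>2 c"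
  and mono_gt_irrefl: "\<not> a >\<^sub>2 a"
  and mono_gt_asym: "a >\<^sub>2 b \<Longrightarrow> \<not> b >\<^sub>2 a"
  by (auto simp: mono_gt_def)

lemma mono_gt_total: "a \<noteq> b \<Longrightarrow> a >\<^sub>2 b \<or> b >\<^sub>2 a"
  by (cases a; cases b) (auto simp: mono_gt_def)

lemma mdvd_mono_gt: "mdvd d e \<Longrightarrow> d = e \<or> e >\<^sub>2 d"
  by (cases d; cases e) (auto simp: mono_gt_def mdvd_def)

lemma exponents_iff: "e \<in> exponents h \<longleftrightarrow> coeff (coeff h (snd e)) (fst e) \<noteq> 0"
  by (cases e) (simp add: exponents_def)

lemma finite_exponents: "finite (exponents h)"
proof (rule finite_subset)
  show "exponents h \<subseteq> (\<Union>m\<in>{..degree h}. (\<lambda>l. (l, m)) ` {..degree (coeff h m)})"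
    using coeff_coeff_nz by (fastforce simp: exponents_def)
qed auto

lemma exponents_empty: "exponents h = {} \<longleftrightarrow> h = 0"
proof
  assume "exponents h = {}"
  hence "coeff (coeff h m) l = 0" for m l by (auto simp: exponents_def)
  thus "h = 0" by (intro poly_eqI) (simp add: poly_eq_iff)
qed (auto simp: exponents_def)

lemma ex_max_mono:
  "finite A \<Longrightarrow> A \<noteq> {} \<Longrightarrow> \<exists>e\<in>A. \<forall>e'\<in>A. e' = e \<or> e >\<^sub>2 e'"
proof (induction rule: finite_ne_induct)
  case (insert x A)
  then obtain e where e: "e \<in> A" "\<forall>e'\<in>A. e' = e \<or> e >\<^sub>2 e'" by blast
  show ?case
  proof (cases "x >\<^sub>2 e")
    case True
    have "e' = x \<or> x >\<^sub>2 e'" if "e' \<in> insert x A" for e'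
      using that e(2) True mono_gt_trans[OF True, of e'] by auto
    thus ?thesis by blast
  next
    case False
    hence "x = e \<or> e >\<^sub>2 x" using mono_gt_total by blast
    thus ?thesis using e by blast
  qed
qed simp

lemma multidegree_props:
  assumes "h \<noteq> 0"
  shows "multidegree h \<in> exponents h" "e \<in> exponents h \<Longrightarrow> e = multidegree h \<or> multidegree h >\<^sub>2 e"
proof -
  obtain e0 where e0: "e0 \<in> exponents h" "\<forall>e'\<in>exponents h. e' = e0 \<or> e0 >\<^sub>2 e'"
    using ex_max_mono[OF finite_exponents] assms exponents_empty by blast
  have "multidegree h = e0"
    unfolding multidegree_def
  proof (rule the_equality)
    fix e assume "e \<in> exponents h \<and> (\<forall>e'\<in>exponents h. e' = e \<or> e >\<^sub>2 e')"
    hence "e0 = e \<or> e >\<^sub>2 e0" "e = e0 \<or> e0 >\<^sub>2 e" using e0 by blast+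
    thus "e = e0" using mono_gt_asym[of e0 e] by blast
  qed (use e0 in blast)
  thus "multidegree h \<in> exponents h" "e \<in> exponents h \<Longrightarrow> e = multidegree h \<or> multidegree h >\<^sub>2 e"
    using e0 by simp_all
qed

lemma multidegree_eqI:
  assumes "e \<in> exponents h" "\<And>e'. e' \<in> exponents h \<Longrightarrow> e' = e \<or> e >\<^sub>2 e'"
  shows "multidegree h = e"
proof -
  have "h \<noteq> 0" using assms(1) by (auto simp: exponents_def)
  note m = multidegree_props[OF this]
  from m(2)[OF assms(1)] assms(2)[OF m(1)] show ?thesis using mono_gt_asym[of e] by blast
qed

lemma exponents_add: "exponents (g + h) \<subseteq> exponents g \<union> exponents h"
  by (auto simp: exponents_def)

lemma exponents_diff: "exponents (g - h) \<subseteq> exponents g \<union> exponents h"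
  by (auto simp: exponents_def)

lemma exponents_mult:
  assumes "e \<in> exponents (r * h)"
  shows "\<exists>d\<in>exponents h. mdvd d e"
proof -
  obtain l m where e: "e = (l, m)" by (cases e)
  have "(\<Sum>i\<le>m. coeff (coeff r i * coeff h (m - i)) l) \<noteq> 0"
    using assms by (simp add: e exponents_def coeff_mult coeff_sum)
  then obtain i where i: "coeff (coeff r i * coeff h (m - i)) l \<noteq> 0"
    by (rule sum.not_neutral_contains_not_neutral)
  then obtain j where "coeff (coeff r i) j * coeff (coeff h (m - i)) (l - j) \<noteq> 0"
    unfolding coeff_mult[of "coeff r i"] by (rule sum.not_neutral_contains_not_neutral)
  hence "(l - j, m - i) \<in> exponents h" by (auto simp: exponents_def)
  thus ?thesis by (rule bexI[rotated]) (simp add: e mdvd_def)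
qed

lemma mdvd_trans: "mdvd a b \<Longrightarrow> mdvd b c \<Longrightarrow> mdvd a c"
  by (auto simp: mdvd_def)

text \<open>Contains every ideal generated by monomials with exponents in \<open>E\<close>, so
  exponents of members can be bounded without expanding combinations of generators.\<close>

lemma is_ideal_monomial: "is_ideal {h. \<forall>e\<in>exponents h. \<exists>d\<in>E. mdvd d e}"
  unfolding is_ideal_def
proof (intro conjI ballI allI)
  show "0 \<in> {h :: 'a poly poly. \<forall>e\<in>exponents h. \<exists>d\<in>E. mdvd d e}"
    by (simp add: exponents_def)
next
  fix a b :: "'a poly poly"
  assume "a \<in> {h. \<forall>e\<in>exponents h. \<exists>d\<in>E. mdvd d e}" "b \<in> {h. \<forall>e\<in>exponents h. \<exists>d\<in>E. mdvd d e}"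
  thus "a + b \<in> {h. \<forall>e\<in>exponents h. \<exists>d\<in>E. mdvd d e}"
    using exponents_add[of a b] by blast
next
  fix a r :: "'a poly poly"
  assume a: "a \<in> {h. \<forall>e\<in>exponents h. \<exists>d\<in>E. mdvd d e}"
  have "\<exists>d\<in>E. mdvd d e" if "e \<in> exponents (r * a)" for e
    using exponents_mult[OF that] a mdvd_trans by blast
  thus "r * a \<in> {h. \<forall>e\<in>exponents h. \<exists>d\<in>E. mdvd d e}" by blast
qed

lemma exponents_term2: "exponents (term2 c e) = (if c = 0 then {} else {e})"
  by (cases e) (auto simp: exponents_def split: if_splits)

lemma mem_leading_ideal:
  assumes "h \<in> ideal_gen (leading_term ` G)" "e \<in> exponents h"
  shows "\<exists>g\<in>G. mdvd (multidegree g) e"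
proof -
  have "ideal_gen (leading_term ` G) \<subseteq> {h. \<forall>e\<in>exponents h. \<exists>d\<in>multidegree ` G. mdvd d e}"
  proof (intro ideal_gen_least is_ideal_monomial subsetI)
    fix t assume "t \<in> leading_term ` G"
    then obtain g where "g \<in> G" "t = leading_term g" by blast
    thus "t \<in> {h. \<forall>e\<in>exponents h. \<exists>d\<in>multidegree ` G. mdvd d e}"
      by (auto simp: leading_term_def exponents_term2 mdvd_def split: if_splits)
  qed
  with assms show ?thesis by blast
qed

lemma term2_mult: "term2 a (l, m) * term2 b (l', m') = term2 (a * b) (l + l', m + m')"
  by (simp add: mult_monom)

lemma mdvd_mem_leading_ideal:
  assumes "g \<in> G" "leading_coefficient g = 1" "mdvd (multidegree g) e"
  shows "term2 1 e \<in> ideal_gen (leading_term ` G)"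
proof -
  obtain l m where lm: "multidegree g = (l, m)" by (cases "multidegree g")
  obtain l' m' where e: "e = (l', m')" by (cases e)
  have "term2 1 e = term2 1 (l' - l, m' - m) * leading_term g"
    unfolding leading_term_def assms(2) lm term2_mult using assms(3) by (simp add: e lm mdvd_def)
  thus ?thesis
    using assms(1) by (metis is_ideal_mult[OF is_ideal_ideal_gen] ideal_gen_incl imageI)
qed

lemma groebner_divides:
  assumes "groebner_basis I G" "h \<in> I" "h \<noteq> 0"
  shows "\<exists>g\<in>G. mdvd (multidegree g) (multidegree h)"
proof -
  have "leading_term h \<in> ideal_gen (leading_term ` (I - {0}))"
    using assms by (intro ideal_gen_incl) auto
  hence "leading_term h \<in> ideal_gen (leading_term ` G)"
    using assms(1) by (simp add: groebner_basis_def)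
  moreover have "leading_coefficient h \<noteq> 0"
    using multidegree_props(1)[OF assms(3)]
    by (auto simp: leading_coefficient_def exponents_def split: prod.splits)
  hence "multidegree h \<in> exponents (leading_term h)"
    by (simp add: leading_term_def exponents_term2)
  ultimately show ?thesis by (rule mem_leading_ideal)
qed

section \<open>Leading monomials on the curve\<close>

context elliptic
begin

text \<open>\<open>y ^ 2\<close> and \<open>x ^ 3\<close> both have weight 6; the tie-break towards
  the smaller exponent of \<open>x\<close> lets \<open>y ^ 2\<close> lead.\<close>

lemma multidegree_C: "multidegree C = (0, 2)"
proof (rule multidegree_eqI)
  show "(0, 2) \<in> exponents C" by (simp add: exponents_def C_eq numeral_2_eq_2)
next
  fix e assume e: "e \<in> exponents C"
  obtain l m where lm: "e = (l, m)" by (cases e)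
  from e lm have "coeff (coeff C m) l \<noteq> 0" by (simp add: exponents_def)
  hence "(m = 2 \<and> l = 0) \<or> (m = 0 \<and> l \<le> 3)"
    using le_degree[of f l] degree_f
    by (auto simp: C_eq coeff_pCons numeral_2_eq_2 split: nat.splits if_splits)
  thus "e = (0, 2) \<or> (0, 2) >\<^sub>2 e" by (auto simp: lm mono_gt_def)
qed

lemma leading_coefficient_C: "leading_coefficient C = 1"
  by (simp add: leading_coefficient_def multidegree_C) (simp add: C_eq numeral_2_eq_2)

text \<open>The weights 2 and 3 are the pole orders of \<open>x\<close> and \<open>y\<close> at
  \<open>O\<close>, so a reduced element that is minimal for \<open>>\<^sub>2\<close> has minimal
  pole order.\<close>

lemma reduced_multidegree:
  assumes "\<not> C dvd [:b0, b1:]"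
  shows "wdeg (multidegree [:b0, b1:]) = degree (nrm [:b0, b1:])"
    and "snd (multidegree [:b0, b1:]) \<le> 1"
    and "lead_coeff (nrm [:b0, b1:]) = leading_coefficient [:b0, b1:] ^ 2
      \<or> lead_coeff (nrm [:b0, b1:]) = - (leading_coefficient [:b0, b1:] ^ 2)"
proof -
  let ?b = "[:b0, b1:]"
  obtain l0 m0 where lm: "degree (nrm ?b) = 2 * l0 + 3 * m0" "coeff (coeff ?b m0) l0 \<noteq> 0"
    "\<And>l m. coeff (coeff ?b m) l \<noteq> 0 \<Longrightarrow> 2 * l + 3 * m \<le> 2 * l0 + 3 * m0"
    "\<And>l m. coeff (coeff ?b m) l \<noteq> 0 \<Longrightarrow> 2 * l + 3 * m = 2 * l0 + 3 * m0 \<Longrightarrow> l = l0 \<and> m = m0"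
    "lead_coeff (nrm ?b) = coeff (coeff ?b m0) l0 ^ 2 \<or> lead_coeff (nrm ?b) = - (coeff (coeff ?b m0) l0 ^ 2)"
    using assms by (rule reduced_leading) blast
  have md: "multidegree ?b = (l0, m0)"
  proof (rule multidegree_eqI)
    show "(l0, m0) \<in> exponents ?b" using lm(2) by (simp add: exponents_def)
    fix e assume "e \<in> exponents ?b"
    then obtain l m where e: "e = (l, m)" "coeff (coeff ?b m) l \<noteq> 0" by (auto simp: exponents_def)
    show "e = (l0, m0) \<or> (l0, m0) >\<^sub>2 e"
      using lm(3,4)[OF e(2)] e(1) by (cases "2 * l + 3 * m = 2 * l0 + 3 * m0") (auto simp: mono_gt_def)
  qed
  show "wdeg (multidegree ?b) = degree (nrm ?b)" using lm(1) by (simp add: md)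
  show "snd (multidegree ?b) \<le> 1"
    using coeff_coeff_nz[OF lm(2)] by (simp add: md split: if_splits)
  show "lead_coeff (nrm ?b) = leading_coefficient ?b ^ 2 \<or> lead_coeff (nrm ?b) = - (leading_coefficient ?b ^ 2)"
    using lm(5) by (simp add: leading_coefficient_def md)
qed

text \<open>
  If \<open>g\<close> contained a monomial divisible by \<open>y\<^sup>2\<close>, reducedness would force its leading monomial to
  be \<open>y\<^sup>2\<close>; then the difference of \<open>g\<close> and \<open>y\<^sup>2 - f\<close> contradicts the minimality of \<open>g\<close>.
\<close>

lemma min_groebner_reduced:
  assumes I: "is_ideal I" "C \<in> I" and G: "reduced_groebner_basis I G"
    and g: "g \<in> G - {C}"
    and min: "\<forall>g'\<in>G - {C}. multidegree g' = multidegree g \<or> multidegree g' >\<^sub>2 multidegree g"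
  shows "g \<in> I" "leading_coefficient g = 1" "\<exists>b0 b1. g = [:b0, b1:]" "\<not> C dvd g"
    and "\<forall>a0 a1. [:a0, a1:] \<in> I \<longrightarrow> [:a0, a1:] \<noteq> 0 \<longrightarrow>
      multidegree [:a0, a1:] = multidegree g \<or> multidegree [:a0, a1:] >\<^sub>2 multidegree g"
proof -
  have gb: "groebner_basis I G" and lc: "\<And>g. g \<in> G \<Longrightarrow> leading_coefficient g = 1"
    and red: "\<And>g e. g \<in> G \<Longrightarrow> e \<in> exponents g \<Longrightarrow> term2 1 e \<notin> ideal_gen (leading_term ` (G - {g}))"
    using G by (auto simp: reduced_groebner_basis_def)
  have GI: "G \<subseteq> I" "0 \<notin> G" using gb by (auto simp: groebner_basis_def)
  show gI: "g \<in> I" and lcg: "leading_coefficient g = 1" using g GI lc by auto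
  have g0: "g \<noteq> 0" using g GI by auto
  have C0: "C \<noteq> 0" using C_not_dvd_1 C_prime[of 0 1] by (metis C_dvd_const dvd_0_left_iff one_neq_zero pCons_eq_0_iff dvd_refl C_eq)
  have nodiv: "g' = g" if "g' \<in> G" "e \<in> exponents g" "mdvd (multidegree g') e" for g' e
  proof (rule ccontr)
    assume "g' \<noteq> g"
    with that(1) have "term2 1 e \<in> ideal_gen (leading_term ` (G - {g}))"
      by (intro mdvd_mem_leading_ideal[OF _ lc that(3)]) auto
    with red that(2) g show False by blast
  qed
  have no2: "snd e < 2" if e: "e \<in> exponents g" for e
  proof (rule ccontr)
    assume "\<not> snd e < 2"
    hence d: "mdvd (0, 2) e" by (simp add: mdvd_def)
    obtain g' where g': "g' \<in> G" "mdvd (multidegree g') (0, 2)"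
      using groebner_divides[OF gb I(2) C0] multidegree_C by auto
    hence "g' = g" using nodiv e mdvd_trans d by blast
    with g' have md: "fst (multidegree g) = 0" "snd (multidegree g) \<le> 2" by (auto simp: mdvd_def)
    from multidegree_props(2)[OF g0 e] have "wdeg e \<le> wdeg (multidegree g)" by (auto simp: mono_gt_def)
    moreover have "wdeg (0, 2) \<le> wdeg e" using d by (cases e) (auto simp: mdvd_def)
    ultimately have "6 \<le> wdeg (multidegree g)" by simp
    hence md: "multidegree g = (0, 2)" using md by (cases "multidegree g") auto
    let ?h = "g - C"
    have h: "?h \<in> I" "?h \<noteq> 0" using I gI g is_ideal_diff by auto
    have cz: "coeff (coeff ?h 2) 0 = 0"
      using lcg leading_coefficient_C by (simp add: leading_coefficient_def md multidegree_C)
    have h2: "(0, 2) >\<^sub>2 multidegree ?h"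
    proof -
      have "multidegree ?h \<in> exponents g \<union> exponents C"
        using multidegree_props(1)[OF h(2)] exponents_diff by blast
      hence "multidegree ?h = (0, 2) \<or> (0, 2) >\<^sub>2 multidegree ?h"
        using multidegree_props(2)[OF g0, of "multidegree ?h"] multidegree_props(2)[OF C0, of "multidegree ?h"]
        unfolding md multidegree_C by blast
      moreover have "multidegree ?h \<noteq> (0, 2)"
        using multidegree_props(1)[OF h(2)] cz by (auto simp: exponents_def)
      ultimately show ?thesis by blast
    qed
    obtain g'' where g'': "g'' \<in> G" "mdvd (multidegree g'') (multidegree ?h)"
      using groebner_divides[OF gb h] by blast
    have le: "(0, 2) >\<^sub>2 multidegree g''"
      using h2 mdvd_mono_gt[OF g''(2)] mono_gt_trans[OF h2, of "multidegree g''"] by metis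
    hence "g'' \<noteq> C" using multidegree_C mono_gt_irrefl by metis
    with g'' min[rule_format, of g''] have "multidegree g'' = (0, 2) \<or> multidegree g'' >\<^sub>2 (0, 2)"
      unfolding md by blast
    with le show False using mono_gt_asym mono_gt_irrefl by metis
  qed
  have "degree g \<le> 1"
  proof (rule ccontr)
    assume d: "\<not> degree g \<le> 1"
    hence "lead_coeff g \<noteq> 0" by auto
    hence "lead_coeff (lead_coeff g) \<noteq> 0" by simp
    hence "(degree (lead_coeff g), degree g) \<in> exponents g" by (simp add: exponents_def)
    from no2[OF this] d show False by simp
  qed
  hence "g = [:coeff g 0, coeff g 1:]"
    by (intro poly_eqI) (auto simp: coeff_pCons coeff_eq_0 split: nat.splits)
  thus ge: "\<exists>b0 b1. g = [:b0, b1:]" by blast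
  then obtain b0 b1 where "g = [:b0, b1:]" by blast
  thus "\<not> C dvd g" using g0 by (auto simp: C_dvd_deg1)
  show "\<forall>a0 a1. [:a0, a1:] \<in> I \<longrightarrow> [:a0, a1:] \<noteq> 0 \<longrightarrow>
      multidegree [:a0, a1:] = multidegree g \<or> multidegree [:a0, a1:] >\<^sub>2 multidegree g"
  proof (intro allI impI)
    fix a0 a1 assume a: "[:a0, a1:] \<in> I" "[:a0, a1:] \<noteq> 0"
    obtain g' where g': "g' \<in> G" "mdvd (multidegree g') (multidegree [:a0, a1:])"
      using groebner_divides[OF gb a] by blast
    have "snd (multidegree [:a0, a1:]) \<le> 1"
      using a(2) by (intro reduced_multidegree) (auto simp: C_dvd_deg1)
    \<comment> \<open>The leading monomial \<open>y ^ 2\<close> of \<open>C\<close> cannot divide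
      one of \<open>y\<close>-degree at most 1, so the minimality of \<open>g\<close> applies to
      \<open>g'\<close>.\<close>
    hence "g' \<noteq> C" using g'(2) multidegree_C by (auto simp: mdvd_def)
    with min[rule_format, of g'] g' have "multidegree g' = multidegree g \<or> multidegree g' >\<^sub>2 multidegree g"
      by blast
    with mdvd_mono_gt[OF g'(2)] mono_gt_trans[of "multidegree [:a0, a1:]" "multidegree g'" "multidegree g"]
    show "multidegree [:a0, a1:] = multidegree g \<or> multidegree [:a0, a1:] >\<^sub>2 multidegree g"
      by metis
  qed
qed

text \<open>With \<open>m \<le> 1\<close> the weight \<open>3 * m + 2 * l\<close> determines the
  monomial, so \<open>g\<close> and \<open>b\<close> have the same leading monomial. Cancelling it
  by a multiple of \<open>b\<close> leaves a reduced element of \<open>I\<close> below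
  \<open>g\<close>, which must be zero.\<close>

lemma minimal_reduced_proportional:
  assumes I: "is_ideal I" and g: "g = [:g0, g1:]" "g \<in> I" "\<not> C dvd g" and b: "b = [:b0, b1:]" "b \<in> I" "\<not> C dvd b"
    and deg: "degree (nrm g) = degree (nrm b)"
    and min: "\<forall>a0 a1. [:a0, a1:] \<in> I \<longrightarrow> [:a0, a1:] \<noteq> 0 \<longrightarrow>
      multidegree [:a0, a1:] = multidegree g \<or> multidegree [:a0, a1:] >\<^sub>2 multidegree g"
  shows "\<exists>c. c \<noteq> 0 \<and> g = [:[:c:]:] * b"
proof -
  have g0: "g \<noteq> 0" and b0: "b \<noteq> 0" using g(3) b(3) by auto
  have wg: "wdeg (multidegree g) = degree (nrm g)" "snd (multidegree g) \<le> 1"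
    using g(3) unfolding g(1) by (rule reduced_multidegree(1,2))+
  have wb: "wdeg (multidegree b) = degree (nrm b)" "snd (multidegree b) \<le> 1"
    using b(3) unfolding b(1) by (rule reduced_multidegree(1,2))+
  have md: "multidegree b = multidegree g"
  proof -
    have w: "wdeg (multidegree b) = wdeg (multidegree g)" using wb(1) wg(1) deg by simp
    obtain l m l' m' where lm: "multidegree b = (l, m)" "multidegree g = (l', m')" by (cases "multidegree b"; cases "multidegree g")
    have "3 * m + 2 * l = 3 * m' + 2 * l'" "m \<le> 1" "m' \<le> 1" using w wb(2) wg(2) lm by auto
    hence "m = m' \<and> l = l'" by presburger
    thus ?thesis using lm by simp
  qed
  let ?lc = "\<lambda>h. coeff (coeff h (snd (multidegree g))) (fst (multidegree g))"
  define c where "c = ?lc g / ?lc b"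
  have nz: "?lc g \<noteq> 0" "?lc b \<noteq> 0"
    using multidegree_props(1)[OF g0] multidegree_props(1)[OF b0]
    by (auto simp: exponents_def md split: prod.splits)
  hence c0: "c \<noteq> 0" by (simp add: c_def)
  define h where "h = g - [:[:c:]:] * b"
  have hI: "h \<in> I" unfolding h_def using I g(2) b(2) by (auto intro!: is_ideal_diff simp del: mult_pCons_left intro: is_ideal_mult)
  have hred: "h = [:g0 - smult c b0, g1 - smult c b1:]" by (simp add: h_def g(1) b(1))
  have hz: "?lc h = 0" using nz by (simp add: h_def c_def)
  have "h = 0"
  proof (rule ccontr)
    assume h0: "h \<noteq> 0"
    have "exponents ([:[:c:]:] * b) \<subseteq> exponents b" by (auto simp: exponents_def)
    hence "multidegree h \<in> exponents g \<union> exponents b"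
      using multidegree_props(1)[OF h0] exponents_diff[of g "[:[:c:]:] * b"] unfolding h_def by blast
    hence "multidegree h = multidegree g \<or> multidegree g >\<^sub>2 multidegree h"
      using multidegree_props(2)[OF g0, of "multidegree h"] multidegree_props(2)[OF b0, of "multidegree h"]
      unfolding md by blast
    moreover have "multidegree h \<noteq> multidegree g"
      using multidegree_props(1)[OF h0] hz by (auto simp: exponents_iff)
    ultimately show False using min hI h0 mono_gt_asym unfolding hred by blast
  qed
  hence "g = [:[:c:]:] * b" unfolding h_def by (metis eq_iff_diff_eq_0)
  with c0 show ?thesis by blast
qed

end

section \<open>Multiples of a torsion point\<close>

locale torsion = mumford +
  fixes T :: "'a point" and n :: nat
  assumes T_curve: "T \<in> curve_points f" and T_affine: "T \<noteq> Infinity"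
    and order_T: "has_torsion_order f T n"
    and D_equiv: "lin_equiv f (D - frag_cmul (div_degree D) pinf) (frag_of T - pinf)"
    and multiples_notin: "1 \<le> k \<Longrightarrow> k \<le> n - 1 \<Longrightarrow> point_mult f k T \<notin> Poly_Mapping.keys D"
begin

lemma n_ge_2: "2 \<le> n"
proof -
  have "point_mult f 1 T = T" using T_affine by (cases T) (simp_all add: point_mult_def)
  hence "n \<noteq> 1" "n \<noteq> 0" using order_T T_affine by (auto simp: has_torsion_order_def)
  thus ?thesis by simp
qed

lemma point_mult_n: "point_mult f n T = Infinity"
  using order_T by (simp add: has_torsion_order_def)

lemma point_mult_less_n: "1 \<le> k \<Longrightarrow> k < n \<Longrightarrow> point_mult f k T \<noteq> Infinity"
  using order_T by (simp add: has_torsion_order_def)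

lemma point_mult_affine:
  assumes "1 \<le> k" "k < n"
  obtains p q where "point_mult f k T = Affine p q" "q ^ 2 = poly f p"
  using point_mult_less_n[OF assms] point_mult_princ[OF T_curve, of k] by (auto elim: curve_cases)

abbreviation kD :: "nat \<Rightarrow> 'a divisor" where
  "kD k \<equiv> frag_cmul (int k) D"

lemma princ_kD:
  "princ ((kD k - frag_cmul (int k * div_degree D) pinf) - (frag_of (point_mult f k T) - pinf))"
proof -
  have "princ (frag_cmul (int k) ((D - frag_cmul (div_degree D) pinf) - (frag_of T - pinf)))"
    using D_equiv by (intro princ_cmul) (simp add: lin_equiv_iff)
  moreover have "frag_cmul (int k) ((D - frag_cmul (div_degree D) pinf) - (frag_of T - pinf))
      + (frag_cmul (int k) (frag_of T - pinf) - (frag_of (point_mult f k T) - pinf))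
    = (kD k - frag_cmul (int k * div_degree D) pinf) - (frag_of (point_mult f k T) - pinf)"
    by (rule poly_mapping_eqI) (simp add: lookup_add lookup_minus algebra_simps)
  ultimately show ?thesis
    using princ_add conjunct2[OF point_mult_princ[OF T_curve, of k]] by metis
qed

lemma reduction_kD:
  assumes "1 \<le> k" "k \<le> n"
  shows "reduction f (kD k) = (if k = n then 0 else frag_of (point_mult f k T))"
proof (cases "k = n")
  case True
  have "div_degree (0 :: 'a divisor) = 0" by (simp add: div_degree_def)
  thus ?thesis using princ_kD[of n] semi_reduced_0 True
    by (simp, intro reduction_eqI) (simp_all add: point_mult_n div_degree_cmul)
next
  case False
  with assms obtain p q where "point_mult f k T = Affine p q" "q ^ 2 = poly f p"
    using point_mult_affine[of k] by auto
  thus ?thesis using princ_kD[of k] semi_reduced_point False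
    by (simp, intro reduction_eqI) (simp_all add: div_degree_frag_of div_degree_cmul)
qed

lemma inj_iota: "inj (iota :: 'a point \<Rightarrow> 'a point)"
proof (rule injI)
  fix P Q :: "'a point" assume "iota P = iota Q"
  thus "P = Q" by (cases P; cases Q) auto
qed

lemma lookup_iota_pullback: "Poly_Mapping.lookup (iota_pullback E) P = Poly_Mapping.lookup E (iota P :: 'a point)"
  unfolding iota_pullback_def by (simp add: map_key.rep_eq[OF inj_iota])

lemma iota_iota [simp]: "iota (iota P) = (P :: 'a point)"
  by (cases P) auto

lemma iota_curve: "iota P \<in> curve_points f \<longleftrightarrow> P \<in> curve_points f"
  by (cases P) auto

text \<open>The added point \<open>[-k]T\<close> is opposite to \<open>[k]T\<close>, which is not in
  the support of \<open>D\<close> by hypothesis, so no new opposite pair arises. A fixed point of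
  \<open>iota\<close> in \<open>D\<close> acquires multiplicity \<open>k\<close>, whence the
  condition for \<open>k > 1\<close>.\<close>

lemma semi_reduced_kD:
  assumes k: "1 \<le> k" "k \<le> n" and fixed: "k = 1 \<or> (\<forall>P\<in>Poly_Mapping.keys D. iota P \<noteq> P)"
  shows "semi_reduced f (kD k + iota_pullback (reduction f (kD k)))"
proof -
  define R where "R = reduction f (kD k)"
  have R: "R = 0 \<or> (\<exists>Q. R = frag_of Q \<and> Q \<in> curve_points f \<and> Q \<noteq> Infinity \<and> mlt Q = 0)"
  proof (cases "k = n")
    case True
    thus ?thesis using reduction_kD[OF k] by (simp add: R_def)
  next
    case False
    hence k': "k < n" "k \<le> n - 1" using k by auto
    have "mlt (point_mult f k T) = 0" using multiples_notin[OF k(1) k'(2)] by (simp add: keys_D)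
    moreover have "R = frag_of (point_mult f k T)"
      using reduction_kD[OF k] False by (simp add: R_def)
    moreover have "point_mult f k T \<in> curve_points f" using point_mult_princ[OF T_curve] by blast
    ultimately show ?thesis using point_mult_less_n[OF k(1) k'(1)] by blast
  qed
  let ?E = "kD k + iota_pullback R"
  have l: "Poly_Mapping.lookup ?E P = int k * int (mlt P) + Poly_Mapping.lookup R (iota P)" for P
    by (simp add: lookup_add lookup_D lookup_iota_pullback)
  have R0: "0 \<le> Poly_Mapping.lookup R P" for P using R by auto
  have Rinf: "Poly_Mapping.lookup R Infinity = 0" using R by auto
  have m: "(if P = iota P then mlt P \<le> 1 else mlt P = 0 \<or> mlt (iota P) = 0)" for P
  proof (cases P)
    case (Affine p q)
    thus ?thesis using mlt_fixed[of p] mlt_iota[of p q] neg_eq_self[of q]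
      by (cases "q = 0"; cases "mlt (Affine p q) = 0") auto
  qed simp
  have mk: "P = iota P \<Longrightarrow> mlt P > 0 \<Longrightarrow> k = 1" for P
    using fixed keys_D[of P] by metis
  show ?thesis
    unfolding R_def[symmetric] semi_reduced_def is_divisor_def
  proof (intro conjI allI impI)
    show "Poly_Mapping.keys ?E \<subseteq> curve_points f"
    proof
      fix P assume "P \<in> Poly_Mapping.keys ?E"
      hence "mlt P > 0 \<or> Poly_Mapping.lookup R (iota P) \<noteq> 0" by (auto simp: in_keys_iff l)
      thus "P \<in> curve_points f"
      proof
        assume "mlt P > 0"
        then obtain p q where "P = Affine p q" "q ^ 2 = poly f p" by (rule keys_cases)
        thus ?thesis by simp
      next
        assume "Poly_Mapping.lookup R (iota P) \<noteq> 0"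
        hence "iota P \<in> curve_points f" using R by (auto split: if_splits)
        thus ?thesis by (simp add: iota_curve)
      qed
    qed
    show "Infinity \<notin> Poly_Mapping.keys ?E" using Rinf by (simp add: in_keys_iff l)
    fix P
    show "0 \<le> Poly_Mapping.lookup ?E P" using R0 by (simp add: l)
    assume pos: "0 < Poly_Mapping.lookup ?E P"
    show "if P = iota P then Poly_Mapping.lookup ?E P = 1 else Poly_Mapping.lookup ?E (iota P) = 0"
    proof (cases "P = iota P")
      case True
      show ?thesis
      proof (cases "mlt P = 0")
        case z: True
        thus ?thesis using True R pos by (auto simp: l split: if_splits)
      next
        case nz: False
        hence "mlt P = 1" "k = 1" using m[of P] mk[of P] True by auto
        moreover have "Poly_Mapping.lookup R (iota P) = 0" using R nz True by auto
        ultimately show ?thesis unfolding l using True by simp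
      qed
    next
      case ne: False
      show ?thesis
      proof (cases "mlt P = 0")
        case True
        hence Q: "R = frag_of (iota P)" "mlt (iota P) = 0" using pos R by (auto simp: l split: if_splits)
        thus ?thesis unfolding l using ne by simp
      next
        case False
        hence "mlt (iota P) = 0" using m[of P] ne by auto
        moreover have "Poly_Mapping.lookup R P = 0" using R False by auto
        ultimately show ?thesis unfolding l using ne by simp
      qed
    qed
  qed
qed

text \<open>For \<open>k < n\<close> the vertical line through \<open>[k]T\<close> trades
  \<open>- [k]T\<close> for \<open>+ [-k]T\<close> and makes the divisor effective away from
  \<open>O\<close>. The price is one more pole, the \<open>+ 1\<close> in the norm degree.\<close>

lemma exists_reduced_function:
  assumes "1 \<le> k" "k \<le> n"
  obtains b0 b1 where "\<not> C dvd [:b0, b1:]" "[:b0, b1:] \<in> J k"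
    "div_of f [:b0, b1:] = (if k = n then kD n - frag_cmul (int n * div_degree D) pinf
       else kD k + frag_of (iota (point_mult f k T)) - frag_cmul (int k * div_degree D + 1) pinf)"
    "degree (nrm [:b0, b1:]) = (if k = n then k * degree u else k * degree u + 1)"
proof -
  define E where "E = (if k = n then kD n - frag_cmul (int n * div_degree D) pinf
       else kD k + frag_of (iota (point_mult f k T)) - frag_cmul (int k * div_degree D + 1) pinf)"
  have E: "princ E \<and> (\<forall>P. P \<noteq> Infinity \<longrightarrow> int k * int (mlt P) \<le> Poly_Mapping.lookup E P)
     \<and> Poly_Mapping.lookup E Infinity = - int (if k = n then k * degree u else k * degree u + 1)"
  proof (cases "k = n")
    case True
    thus ?thesis using princ_kD[of n]
      by (auto simp: E_def point_mult_n lookup_minus lookup_D degree_u[symmetric])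
  next
    case False
    with assms obtain p q where pq: "point_mult f k T = Affine p q" "q ^ 2 = poly f p"
      using point_mult_affine[of k] by auto
    have "princ (((kD k - frag_cmul (int k * div_degree D) pinf) - (frag_of (Affine p q) - pinf)) + div_of f [:[:- p, 1:]:])"
      using princ_kD[of k] pq by (intro princ_add princ_div_of) simp_all
    also have "((kD k - frag_cmul (int k * div_degree D) pinf) - (frag_of (Affine p q) - pinf)) + div_of f [:[:- p, 1:]:] = E"
      unfolding div_of_vertical[OF pq(2)] E_def
      by (rule divisor_eqI) (auto simp: False pq lookup_add lookup_minus)
    finally show ?thesis
      using False by (auto simp: E_def pq lookup_add lookup_minus lookup_D degree_u[symmetric])
  qed
  obtain b0 b1 where b: "\<not> C dvd [:b0, b1:]" "E = div_of f [:b0, b1:]"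
  proof (rule princ_effective[OF conjunct1[OF E]])
    fix P :: "'a point" assume "P \<noteq> Infinity"
    hence "int k * int (mlt P) \<le> Poly_Mapping.lookup E P" using E by blast
    moreover have "0 \<le> int k * int (mlt P)" by simp
    ultimately show "0 \<le> Poly_Mapping.lookup E P" by linarith
  qed
  have "[:b0, b1:] \<in> J k"
    unfolding J_iff
  proof (intro allI impI)
    fix p q assume m: "mlt (Affine p q) > 0"
    hence c: "q ^ 2 = poly f p" using mlt_off_curve by (metis less_irrefl)
    have "int k * int (mlt (Affine p q)) \<le> Poly_Mapping.lookup E (Affine p q)" using E by blast
    also have "\<dots> = int (ao p q [:b0, b1:])" using b c by (simp add: lookup_div_affine)
    finally have "k * mlt (Affine p q) \<le> ao p q [:b0, b1:]" by (simp flip: of_nat_mult)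
    thus "vanish C p q (unif p q) (k * mlt (Affine p q)) [:b0, b1:]"
      by (simp add: vanish_ao[OF c b(1)])
  qed
  moreover have "degree (nrm [:b0, b1:]) = (if k = n then k * degree u else k * degree u + 1)"
    using conjunct2[OF conjunct2[OF E]] b lookup_div_infinity[OF b(1)] by simp
  ultimately show ?thesis using that b unfolding E_def by metis
qed

lemma min_groebner:
  assumes k: "1 \<le> k" "k \<le> n" and g: "min_groebner_element f (kD k) g"
  obtains b0 b1 where "g = [:b0, b1:]" "\<not> C dvd g" "leading_coefficient g = 1" "g \<in> J k"
    "div_of f g = (if k = n then kD n - frag_cmul (int n * div_degree D) pinf
       else kD k + frag_of (iota (point_mult f k T)) - frag_cmul (int k * div_degree D + 1) pinf)"
    "degree (nrm g) = (if k = n then k * degree u else k * degree u + 1)"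
proof -
  from g obtain G where G: "reduced_groebner_basis (J k) G" "g \<in> G - {C}"
    "\<forall>g'\<in>G - {C}. multidegree g' = multidegree g \<or> multidegree g' >\<^sub>2 multidegree g"
    unfolding min_groebner_element_def ideal_tilde_eq[OF k(1)] C_def[symmetric] by blast
  note mg = min_groebner_reduced[OF is_ideal_J C_in_J G]
  from mg(3) obtain g0 g1 where g01: "g = [:g0, g1:]" by blast
  obtain b0 b1 where b: "\<not> C dvd [:b0, b1:]" "[:b0, b1:] \<in> J k"
    "div_of f [:b0, b1:] = (if k = n then kD n - frag_cmul (int n * div_degree D) pinf
       else kD k + frag_of (iota (point_mult f k T)) - frag_cmul (int k * div_degree D + 1) pinf)"
    "degree (nrm [:b0, b1:]) = (if k = n then k * degree u else k * degree u + 1)"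
    using exists_reduced_function[OF k] by blast
  let ?b = "[:b0, b1:]"
  have "?b \<noteq> 0" using b(1) by auto
  hence "multidegree ?b = multidegree g \<or> multidegree ?b >\<^sub>2 multidegree g"
    using mg(5) b(2) by blast
  hence "wdeg (multidegree g) \<le> wdeg (multidegree ?b)" by (auto simp: mono_gt_def)
  moreover have "wdeg (multidegree g) = degree (nrm g)" "wdeg (multidegree ?b) = degree (nrm ?b)"
    using reduced_multidegree(1)[of g0 g1] mg(4) reduced_multidegree(1)[OF b(1)] by (simp_all add: g01)
  ultimately have le: "degree (nrm g) \<le> degree (nrm ?b)" by simp
  have ge: "k * degree u \<le> degree (nrm g)" by (rule degree_nrm_ge[OF mg(1,4)])
  have deg: "degree (nrm g) = degree (nrm ?b)"
  proof (cases "k = n")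
    case True
    with le ge b(4) show ?thesis by simp
  next
    case False
    \<comment> \<open>The only other value between the two bounds. It would make \<open>[k]T\<close>
      equivalent to \<open>O\<close>.\<close>
    have "degree (nrm g) \<noteq> k * degree u"
    proof
      assume "degree (nrm g) = k * degree u"
      from div_of_minimal[OF mg(1,4) this] princ_div_of[OF mg(4)]
      have "princ (kD k - frag_cmul (int k * div_degree D) pinf)" by simp
      from princ_diff[OF this princ_kD[of k]] have "princ (frag_of (point_mult f k T) - pinf)" by simp
      moreover obtain p q where "point_mult f k T = Affine p q" "q ^ 2 = poly f p"
        using point_mult_affine[of k] k False by auto
      ultimately show False using not_princ_point_infinity by metis
    qed
    with le ge b(4) False show ?thesis by simp
  qed
  obtain c where c: "c \<noteq> 0" "g = [:[:c:]:] * ?b"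
    using minimal_reduced_proportional[OF is_ideal_J g01 mg(1,4) refl b(2,1) deg mg(5)] by blast
  have "div_of f g = div_of f [:[:c:]:] + div_of f ?b"
    unfolding c(2) by (rule div_of_mult) (use c b in auto)
  moreover have "div_of f [:[:c:]:] = 0"
  proof (rule divisor_eqI)
    show "Poly_Mapping.lookup (div_of f [:[:c:]:]) Infinity = Poly_Mapping.lookup 0 Infinity"
      using c(1) by (simp add: lookup_div_infinity power2_eq_square)
    fix p q
    show "Poly_Mapping.lookup (div_of f [:[:c:]:]) (Affine p q) = Poly_Mapping.lookup 0 (Affine p q)"
      using c(1) by (simp add: lookup_div_affine ao_eq_0_iff)
  qed
  ultimately show ?thesis using that[OF g01 mg(4,2,1)] deg b(3,4) by simp
qed

text \<open>\<open>u\<close> is monic, and the leading coefficient of the norm is plus or minus the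
  square of that of the reduced basis element, which is 1. This is why the constant lies in the
  ground field although \<open>u\<close>, \<open>b0\<close>, \<open>b1\<close> are defined over the
  closure.\<close>

lemma norm_equation:
  assumes "min_groebner_element f (kD n) [:b0, b1:]"
  shows "\<exists>r. (r = 1 \<or> r = -1) \<and> b0 ^ 2 - b1 ^ 2 * f = smult r (u ^ n)"
proof -
  let ?g = "[:b0, b1:]"
  have n: "1 \<le> n" using n_ge_2 by simp
  obtain c0 c1 where g: "?g = [:c0, c1:]" "\<not> C dvd ?g" "leading_coefficient ?g = 1" "?g \<in> J n"
    "degree (nrm ?g) = (if n = n then n * degree u else n * degree u + 1)"
    using min_groebner[OF n order.refl assms] by blast
  hence "nrm ?g = smult (lead_coeff (nrm ?g)) (u ^ n)" by (intro nrm_eq_smult_u) simp_all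
  moreover have "lead_coeff (nrm ?g) = 1 \<or> lead_coeff (nrm ?g) = -1"
    using reduced_multidegree(3)[OF g(2)] unfolding g(3) by simp
  ultimately show ?thesis unfolding nrm_reduced mult.commute[of f] by blast
qed

text \<open>
  If \<open>b0 = 0\<close> or \<open>b1 = 0\<close>, then the divisor of \<open>b0 + b1 * y\<close> is invariant under \<open>iota\<close>, so \<open>D\<close> is
  supported in fixed points of \<open>iota\<close> and \<open>2 * D\<close> is the divisor of \<open>u\<close> up to a multiple of \<open>O\<close>.
\<close>

lemma both_components_nonzero:
  assumes "min_groebner_element f (kD n) [:b0, b1:]" "2 < n"
  shows "b0 \<noteq> 0 \<and> b1 \<noteq> 0"
proof (rule ccontr)
  assume z: "\<not> (b0 \<noteq> 0 \<and> b1 \<noteq> 0)"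
  let ?g = "[:b0, b1:]"
  have n: "1 \<le> n" using n_ge_2 by simp
  obtain c0 c1 where g: "\<not> C dvd ?g"
    "div_of f ?g = (if n = n then kD n - frag_cmul (int n * div_degree D) pinf
       else kD n + frag_of (iota (point_mult f n T)) - frag_cmul (int n * div_degree D + 1) pinf)"
    using min_groebner[OF n order.refl assms(1)] by blast
  have ao: "ao p q ?g = n * mlt (Affine p q)" if "q ^ 2 = poly f p" for p q
    using arg_cong[OF g(2), of "\<lambda>E. Poly_Mapping.lookup E (Affine p q)"] that g(1)
    by (simp add: lookup_div_affine lookup_minus lookup_D flip: of_nat_mult)
  have sym: "mlt (Affine p (- q)) = mlt (Affine p q)" for p q
  proof (cases "q ^ 2 = poly f p")
    case False
    thus ?thesis by (simp add: mlt_off_curve)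
  next
    case c: True
    hence c': "(- q) ^ 2 = poly f p" by simp
    \<comment> \<open>Sign \<open>1\<close> if \<open>b1 = 0\<close>, sign \<open>-1\<close> if
      \<open>b0 = 0\<close>.\<close>
    have "cj ?g = [:[:1:]:] * ?g \<or> cj ?g = [:[:-1:]:] * ?g" using z by auto
    then obtain e :: 'a where "e = 1 \<or> e = -1" and e2: "cj ?g = [:[:e:]:] * ?g" by blast
    hence "e \<noteq> 0" by auto
    note e = this e2
    have "ao p (- q) [:[:e:]:] = 0" using e(1) by (simp add: ao_eq_0_iff[OF c'])
    hence "ao p (- q) (cj ?g) = ao p (- q) ?g"
      unfolding e(2) using ao_mult[OF c', of "[:[:e:]:]" ?g] e(1) g(1) by simp
    hence "n * mlt (Affine p (- q)) = n * mlt (Affine p q)"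
      using ao_cj[OF c g(1)] ao[OF c] ao[OF c'] by simp
    thus ?thesis using n by simp
  qed
  have "div_of f [:u:] = kD 2 - frag_cmul (int 2 * div_degree D) pinf"
  proof (rule divisor_eqI)
    show "Poly_Mapping.lookup (div_of f [:u:]) Infinity
      = Poly_Mapping.lookup (kD 2 - frag_cmul (int 2 * div_degree D) pinf) Infinity"
      using u_neq_0 by (simp add: lookup_div_infinity lookup_minus lookup_D degree_u[symmetric] degree_power_eq)
    fix p q
    show "Poly_Mapping.lookup (div_of f [:u:]) (Affine p q)
      = Poly_Mapping.lookup (kD 2 - frag_cmul (int 2 * div_degree D) pinf) (Affine p q)"
      using u_neq_0 mlt_off_curve[of q p]
      by (auto simp: lookup_div_affine lookup_minus lookup_D ao_u sym)
  qed
  moreover have "princ (div_of f [:u:])" using u_neq_0 by (intro princ_div_of) simp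
  ultimately have "princ (frag_of (point_mult f 2 T) - pinf)"
    using princ_diff[OF _ princ_kD[of 2], of "div_of f [:u:]"] by simp
  \<comment> \<open>By \<open>2 < n\<close> the point \<open>[2]T\<close> is different from
    \<open>O\<close>.\<close>
  moreover obtain p q where "point_mult f 2 T = Affine p q" "q ^ 2 = poly f p"
    using point_mult_affine[of 2] assms(2) by auto
  ultimately show False using not_princ_point_infinity by metis
qed

end

section \<open>Quasi-toric relations\<close>

text \<open>Names the degree, so that it can be matched in sums and added in products; the zero
  polynomial has every degree.\<close>

definition hdeg :: "nat \<Rightarrow> 'a::comm_ring_1 poly poly poly \<Rightarrow> bool" where
  "hdeg d F \<longleftrightarrow> (\<forall>i j k. coeff (coeff (coeff F k) j) i \<noteq> 0 \<longrightarrow> i + j + k = d)"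

lemma hdeg_homogeneous: "hdeg d F \<Longrightarrow> homogeneous F"
  by (auto simp: hdeg_def homogeneous_def)

lemma hdeg_add: "hdeg d F \<Longrightarrow> hdeg d G \<Longrightarrow> hdeg d (F + G)"
  by (auto simp: hdeg_def) (metis add.right_neutral)

lemma hdeg_sum: "(\<And>x. x \<in> A \<Longrightarrow> hdeg d (F x)) \<Longrightarrow> hdeg d (sum F A)"
  by (induction A rule: infinite_finite_induct) (auto intro: hdeg_add, auto simp: hdeg_def)

lemma hdeg_uminus: "hdeg d F \<Longrightarrow> hdeg d (- F)"
  by (auto simp: hdeg_def)

lemma hdeg_mult:
  assumes "hdeg d F" "hdeg e G"
  shows "hdeg (d + e) (F * G)"
  unfolding hdeg_def
proof (intro allI impI)
  fix i j k assume nz: "coeff (coeff (coeff (F * G) k) j) i \<noteq> 0"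
  have "(\<Sum>c\<le>k. coeff (coeff (coeff F c * coeff G (k - c)) j) i) \<noteq> 0"
    using nz by (simp add: coeff_mult[of F] coeff_sum)
  then obtain c where c: "c \<le> k" "coeff (coeff (coeff F c * coeff G (k - c)) j) i \<noteq> 0"
    by (rule sum.not_neutral_contains_not_neutral) auto
  hence "(\<Sum>b\<le>j. coeff (coeff (coeff F c) b * coeff (coeff G (k - c)) (j - b)) i) \<noteq> 0"
    by (simp add: coeff_mult[of "coeff F c"] coeff_sum)
  then obtain b where b: "b \<le> j" "coeff (coeff (coeff F c) b * coeff (coeff G (k - c)) (j - b)) i \<noteq> 0"
    by (rule sum.not_neutral_contains_not_neutral) auto
  from b(2) obtain a where a: "a \<le> i" "coeff (coeff (coeff F c) b) a * coeff (coeff (coeff G (k - c)) (j - b)) (i - a) \<noteq> 0"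
    unfolding coeff_mult[of "coeff (coeff F c) b"]
    by (rule sum.not_neutral_contains_not_neutral) auto
  hence "coeff (coeff (coeff F c) b) a \<noteq> 0" "coeff (coeff (coeff G (k - c)) (j - b)) (i - a) \<noteq> 0" by auto
  hence "a + b + c = d" "(i - a) + (j - b) + (k - c) = e" using assms by (auto simp: hdeg_def)
  thus "i + j + k = d + e" using a(1) b(1) c(1) by linarith
qed

lemma hdeg_monom: "hdeg (l + m + j) (monom (monom (monom c l) m) j)"
  by (auto simp: hdeg_def split: if_splits)

lemma hdeg_const: "hdeg 0 [:[:[:c:]:]:]"
  using hdeg_monom[of 0 0 0 c] by (simp add: monom_0)

lemma hdeg_1: "hdeg 0 1"
  using hdeg_const[of 1] by (simp add: one_pCons)

lemma hdeg_Z_power: "hdeg d ([:0, 1:] ^ d)"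
  using hdeg_monom[of 0 0 d 1] by (simp add: monom_eq_const_mult one_pCons[symmetric] monom_altdef)

lemma hdeg_homogenize: "hdeg (total_degree h) (homogenize h)"
  unfolding homogenize_def
proof (intro hdeg_sum)
  fix m l assume "m \<in> {..degree h}" "l \<in> {..degree (coeff h m)}"
  hence "l + m \<le> total_degree h" by (intro total_degree_ge) auto
  hence "l + m + (total_degree h - l - m) = total_degree h" by simp
  thus "hdeg (total_degree h) (monom (monom (monom (coeff (coeff h m) l) l) m) (total_degree h - l - m))"
    using hdeg_monom by metis
qed

text \<open>Setting \<open>Z = 1\<close> undoes homogenization, which shows that the forms built
  below are non-zero.\<close>

lemma poly_homogenize_1: "poly (homogenize h) 1 = h"
proof -
  have "(\<Sum>l\<le>degree (coeff h m). monom (monom (coeff (coeff h m) l) l) m) = monom (coeff h m) m" for m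
  proof -
    have "monom (coeff h m) m = monom (\<Sum>l\<le>degree (coeff h m). monom (coeff (coeff h m) l) l) m"
      by (simp add: poly_as_sum_of_monoms)
    also have "\<dots> = (\<Sum>l\<le>degree (coeff h m). monom (monom (coeff (coeff h m) l) l) m)"
      by (rule poly_eqI) (simp add: coeff_sum)
    finally show ?thesis ..
  qed
  thus ?thesis by (simp add: homogenize_def poly_sum poly_monom poly_as_sum_of_monoms)
qed

lemma homogenize_eq_0: "homogenize h = 0 \<Longrightarrow> h = 0"
  using poly_homogenize_1[of h] by simp

lemma eval3_simps [simp]:
  "eval3 1 p q r = 1" "eval3 (F * G) p q r = eval3 F p q r * eval3 G p q r"
  "eval3 (- F) p q r = - eval3 F p q r" "eval3 (F ^ n) p q r = eval3 F p q r ^ n"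
  "eval3 [:[:[:c:]:]:] p q r = c" "eval3 [:0, 1:] p q r = r"
  by (simp_all add: eval3_def)

lemma proj_curve_mult_Z:
  assumes "c \<noteq> 0"
  shows "proj_curve ([:[:[:c:]:]:] * [:0, 1:] ^ e * F) = (if e = 0 then proj_curve F else proj_curve F \<union> line_at_infinity)"
  using assms by (auto simp: proj_curve_def line_at_infinity_def simp del: mult_pCons_left mult_pCons_right)

text \<open>For \<open>n = 2\<close> any \<open>h\<close> works: \<open>(h + 1)\<^sup>2 - (h - 1)\<^sup>2 = 4 * h\<close>.\<close>

lemma quasi_toric_2_2_2:
  assumes "total_degree h \<noteq> 0" "h \<noteq> 1" "h \<noteq> -1" "h \<noteq> 0"
  shows "quasi_toric 2 2 2 (proj_curve (homogenize h) \<union> line_at_infinity)"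
proof -
  let ?d = "total_degree h" and ?H = "homogenize h" and ?Z = "[:0, 1:] :: complex poly poly poly"
  let ?A = "?H + ?Z ^ ?d" and ?B = "?H - ?Z ^ ?d"
  \<comment> \<open>From \<open>(H + Z ^ d) ^ 2 - (H - Z ^ d) ^ 2 = 4 * Z ^ d * H\<close>; as
    \<open>d > 0\<close>, the factor \<open>Z ^ d\<close> contributes the line at infinity.\<close>
  let ?F = "[:[:[:-4:]:]:] * ?Z ^ ?d * ?H"
  have "poly ?A 1 = h + 1" "poly ?B 1 = h - 1" by (simp_all add: poly_homogenize_1)
  moreover have "h + 1 \<noteq> 0" using assms(3) by (metis add_eq_0_iff2)
  ultimately have "poly ?A 1 \<noteq> 0" "poly ?B 1 \<noteq> 0" using assms(2) by simp_all
  hence nz: "?A \<noteq> 0" "?B \<noteq> 0" using poly_0 by metis+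
  have "?H \<noteq> 0" using assms(4) homogenize_eq_0 by blast
  hence F0: "?F \<noteq> 0" by simp
  have hA: "hdeg ?d ?A" "hdeg ?d ?B"
    using hdeg_add[OF hdeg_homogenize hdeg_Z_power, of h]
      hdeg_add[OF hdeg_homogenize hdeg_uminus[OF hdeg_Z_power], of h] by simp_all
  have hF: "hdeg (0 + ?d + ?d) ?F"
    by (intro hdeg_mult hdeg_const hdeg_Z_power hdeg_homogenize)
  have four: "[:[:[:-4:]:]:] = (- 4 :: complex poly poly poly)"
    by (simp add: numeral_poly)
  have eq: "?A ^ 2 * 1 + ?B ^ 2 * (- 1) + 1 ^ 2 * ?F = 0"
    unfolding four by (simp add: power2_eq_square algebra_simps)
  have curve: "proj_curve (?H) \<union> line_at_infinity = proj_curve (1 * (- 1) * ?F)"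
  proof -
    have "proj_curve (1 * (- 1) * ?F) = proj_curve ?F"
      by (simp only: proj_curve_def eval3_simps) simp
    thus ?thesis using proj_curve_mult_Z[of "-4" ?d ?H] assms(1) by simp
  qed
  have one: "(1 :: complex poly poly poly) \<noteq> 0" "(- 1 :: complex poly poly poly) \<noteq> 0"
    by simp_all
  have "\<forall>H\<in>{1, - 1, ?F, ?A, ?B, 1}. H \<noteq> 0 \<and> homogeneous H"
    using one nz F0 hdeg_homogeneous[OF hA(1)] hdeg_homogeneous[OF hA(2)] hdeg_homogeneous[OF hF]
      hdeg_homogeneous[OF hdeg_1[where 'a = complex]]
      hdeg_homogeneous[OF hdeg_uminus[OF hdeg_1[where 'a = complex]]]
    by (simp only: ball_simps simp_thms)
  thus ?thesis
    unfolding quasi_toric_def using eq curve by blast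
qed

text \<open>Powers of \<open>Z\<close> bring the three terms to the common degree \<open>N\<close>;
  together with \<open>r\<close> and the homogenized \<open>h\<close> they form \<open>F1\<close>,
  \<open>F2\<close>, \<open>F3\<close>. The line at infinity is added when some padding exponent is
  positive, hence the two alternatives.\<close>

lemma quasi_toric_relation:
  assumes nz: "b0 \<noteq> 0" "b1 \<noteq> 0" "u \<noteq> 0" "h \<noteq> 0" "r \<noteq> 0"
    and eq: "b0 ^ 2 - b1 ^ 2 * h = smult [:r:] (u ^ n)"
  shows "quasi_toric 2 n 2 (proj_curve (homogenize h)) \<or>
         quasi_toric 2 n 2 (proj_curve (homogenize h) \<union> line_at_infinity)"
proof -
  let ?Z = "[:0, 1:] :: complex poly poly poly"
  let ?z = "to_fract ?Z"
  define N where "N = Max {2 * total_degree b0, n * total_degree u, 2 * total_degree b1 + total_degree h}"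
  have N: "2 * total_degree b0 \<le> N" "n * total_degree u \<le> N" "2 * total_degree b1 + total_degree h \<le> N"
    unfolding N_def by simp_all
  define e1 where "e1 = N - 2 * total_degree b0"
  define e2 where "e2 = N - n * total_degree u"
  define e3 where "e3 = N - (2 * total_degree b1 + total_degree h)"
  let ?r = "[:[:[:r:]:]:]"
  let ?F1 = "?Z ^ e1" and ?F2 = "- (?r * ?Z ^ e2)" and ?F3 = "- (?Z ^ e3 * homogenize h)"
  have ne: "?F1 \<noteq> 0" "?F2 \<noteq> 0" "?F3 \<noteq> 0" "homogenize b0 \<noteq> 0" "homogenize b1 \<noteq> 0" "homogenize u \<noteq> 0"
    using nz homogenize_eq_0 by auto
  have hom: "homogeneous ?F1" "homogeneous ?F2" "homogeneous ?F3"
    "homogeneous (homogenize b0)" "homogeneous (homogenize b1)" "homogeneous (homogenize u)"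
    by (intro hdeg_homogeneous[OF hdeg_Z_power]
       hdeg_homogeneous[OF hdeg_uminus[OF hdeg_mult[OF hdeg_const hdeg_Z_power]]]
       hdeg_homogeneous[OF hdeg_uminus[OF hdeg_mult[OF hdeg_Z_power hdeg_homogenize]]]
       hdeg_homogeneous[OF hdeg_homogenize])+
  have r: "dehom [:[:r:]:] = to_fract ?r"
    by (simp add: dehom_def map_poly_pCons)
  have sm: "smult [:r:] (u ^ n) = [:[:r:]:] * u ^ n" by simp
  have de: "dehom b0 ^ 2 - dehom b1 ^ 2 * dehom h = to_fract ?r * dehom u ^ n"
    using arg_cong[OF eq, of dehom] unfolding sm
    by (simp only: is_hom_diff[OF is_hom_dehom] is_hom_power[OF is_hom_dehom] is_homD(4)[OF is_hom_dehom] r)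
  have p1: "?z ^ N = (?z ^ total_degree b0) ^ 2 * ?z ^ e1"
    unfolding e1_def power_mult[symmetric] power_add[symmetric] using N by (simp add: mult.commute)
  have p2: "?z ^ N = (?z ^ total_degree u) ^ n * ?z ^ e2"
    unfolding e2_def power_mult[symmetric] power_add[symmetric] using N by (simp add: mult.commute)
  have p3: "?z ^ N = (?z ^ total_degree b1) ^ 2 * ?z ^ total_degree h * ?z ^ e3"
    unfolding e3_def power_mult[symmetric] power_add[symmetric] using N by (simp add: mult.commute)
  have "to_fract (homogenize b0 ^ 2 * ?F1 + homogenize u ^ n * ?F2 + homogenize b1 ^ 2 * ?F3)
    = ((?z ^ total_degree b0) ^ 2 * ?z ^ e1) * dehom b0 ^ 2
      - ((?z ^ total_degree u) ^ n * ?z ^ e2) * (to_fract ?r * dehom u ^ n)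
      - ((?z ^ total_degree b1) ^ 2 * ?z ^ total_degree h * ?z ^ e3) * (dehom b1 ^ 2 * dehom h)"
    by (simp only: to_fract_add to_fract_mult to_fract_uminus is_hom_power[OF is_hom_to_fract]
        to_fract_homogenize power_mult_distrib)
       (simp only: mult_minus_left mult_minus_right diff_conv_add_uminus add.assoc mult_ac)
  also have "\<dots> = ?z ^ N * (dehom b0 ^ 2 - dehom b1 ^ 2 * dehom h - to_fract ?r * dehom u ^ n)"
    unfolding p1[symmetric] p2[symmetric] p3[symmetric] by (simp add: algebra_simps)
  also have "\<dots> = 0" unfolding de by simp
  finally have rel: "homogenize b0 ^ 2 * ?F1 + homogenize u ^ n * ?F2 + homogenize b1 ^ 2 * ?F3 = 0"
    by (simp only: to_fract_eq_0_iff)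
  have "?F1 * ?F2 * ?F3 = ?r * ?Z ^ (e1 + e2 + e3) * homogenize h"
    by (simp only: power_add mult_minus_left mult_minus_right minus_minus mult_ac)
  hence curve: "proj_curve (?F1 * ?F2 * ?F3)
      = (if e1 + e2 + e3 = 0 then proj_curve (homogenize h) else proj_curve (homogenize h) \<union> line_at_infinity)"
    using proj_curve_mult_Z[OF nz(5)] by metis
  have "quasi_toric 2 n 2 (proj_curve (?F1 * ?F2 * ?F3))"
    unfolding quasi_toric_def
    by (rule exI[of _ ?F1], rule exI[of _ ?F2], rule exI[of _ ?F3], rule exI[of _ "homogenize b0"],
        rule exI[of _ "homogenize u"], rule exI[of _ "homogenize b1"])
       (simp only: ball_simps ne hom rel simp_thms)
  thus ?thesis unfolding curve by (auto split: if_splits)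
qed

section \<open>Torsion data\<close>

lemma weierstrass_ac_eq: "weierstrass_ac a b c = [:to_ac c, to_ac b, to_ac a, 1:]"
  by (simp add: weierstrass_ac_def weierstrass_def map_poly_pCons)

lemma torsion_data_torsion:
  fixes a b c :: "'k::field"
  assumes "torsion_data a b c xT yT n D u v"
  shows "torsion (weierstrass_ac a b c) D u v (point_ac xT yT) n"
proof -
  note td = assms[unfolded torsion_data_def Let_def]
  have "(2 :: 'k alg_closure) \<noteq> 0"
  proof
    assume "(2 :: 'k alg_closure) = 0"
    hence "of_nat 2 = (0 :: 'k alg_closure)" by simp
    hence "CHAR('k alg_closure) dvd 2" by (simp only: of_nat_eq_0_iff_char_dvd)
    hence d: "CHAR('k) dvd 2" by simp
    \<comment> \<open>The value 1 is impossible in a field.\<close>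
    have "CHAR('k) = 1 \<or> CHAR('k) = 2"
      using d two_is_prime_nat by (auto simp: prime_nat_iff)
    thus False using td by auto
  qed
  moreover have "degree (weierstrass_ac a b c) = 3" by (simp add: weierstrass_ac_eq)
  moreover have "coeff (weierstrass_ac a b c) 3 = 1" by (simp add: weierstrass_ac_eq numeral_3_eq_3)
  ultimately have "elliptic (weierstrass_ac a b c)"
    using td by (intro elliptic.intro) auto
  moreover have "mumford_axioms (weierstrass_ac a b c) D u v"
    using td by (intro mumford_axioms.intro) auto
  moreover have "torsion_axioms (weierstrass_ac a b c) D (point_ac xT yT) n"
    using td by (intro torsion_axioms.intro) (auto simp: point_ac_def)
  ultimately show ?thesis by (intro torsion.intro mumford.intro)
qed

theorem mainTheorem4:
  shows
    "(\<forall>(a::'k::field) b c xT yT n D u v. torsion_data a b c xT yT n D u v \<longrightarrow>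
        (let f = weierstrass_ac a b c; T = point_ac xT yT in
          (\<forall>k. 1 \<le> k \<and> k \<le> n \<longrightarrow>
             ((k = 1 \<or> (\<forall>P\<in>Poly_Mapping.keys D. iota P \<noteq> P)) \<longrightarrow>
                semi_reduced f (frag_cmul (int k) D
                                + iota_pullback (reduction f (frag_cmul (int k) D)))) \<and>
             reduction f (frag_cmul (int k) D)
               = (if k = n then 0 else frag_of (point_mult f k T)) \<and>
             ideal_tilde f (frag_cmul (int k) D)
               = ideal_gen (insert (curve_eq f) {[:u:] ^ (k - i) * [:- v, 1:] ^ i | i. i \<le> k}) \<and>
             (\<forall>g. min_groebner_element f (frag_cmul (int k) D) g \<longrightarrow>
                (\<exists>b0 b1. g = [:b0, b1:]) \<and>
                div_of f g = frag_cmul (int k) D + frag_of (iota (point_mult f k T))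
                  - frag_cmul (int k * div_degree D + 1) (frag_of Infinity))) \<and>
          (\<forall>g. min_groebner_element f (frag_cmul (int n) D) g \<longrightarrow>
             div_of f g = frag_cmul (int n) D
               - frag_cmul (int n * div_degree D) (frag_of Infinity) \<and>
             (\<exists>b0 b1. g = [:b0, b1:] \<and>
                (\<exists>r::'k. r \<noteq> 0 \<and> b0 ^ 2 - b1 ^ 2 * f = smult (to_ac r) (u ^ n))))))
     \<and>
     (\<forall>(a::complex poly) b c xT yT n D u v b0 b1 (r::complex).
        torsion_data (to_fract a) (to_fract b) (to_fract c) xT yT n D (map_poly const_ac u) v \<longrightarrow>
        min_groebner_element (weierstrass_ac (to_fract a) (to_fract b) (to_fract c))
          (frag_cmul (int n) D) [:map_poly const_ac b0, map_poly const_ac b1:] \<longrightarrow>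
        r \<noteq> 0 \<longrightarrow>
        b0 ^ 2 - b1 ^ 2 * weierstrass a b c = smult [:r:] (u ^ n) \<longrightarrow>
        quasi_toric 2 n 2 (proj_curve (homogenize (weierstrass a b c))) \<or>
        quasi_toric 2 n 2 (proj_curve (homogenize (weierstrass a b c)) \<union> line_at_infinity))"
proof (intro conjI allI impI)
  fix a b c xT yT :: 'k and n D u v
  assume "torsion_data a b c xT yT n D u v"
  then interpret torsion "weierstrass_ac a b c" D u v "point_ac xT yT" n
    by (rule torsion_data_torsion)
  show "let f = weierstrass_ac a b c; T = point_ac xT yT in
          (\<forall>k. 1 \<le> k \<and> k \<le> n \<longrightarrow>
             ((k = 1 \<or> (\<forall>P\<in>Poly_Mapping.keys D. iota P \<noteq> P)) \<longrightarrow>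
                semi_reduced f (frag_cmul (int k) D
                                + iota_pullback (reduction f (frag_cmul (int k) D)))) \<and>
             reduction f (frag_cmul (int k) D)
               = (if k = n then 0 else frag_of (point_mult f k T)) \<and>
             ideal_tilde f (frag_cmul (int k) D)
               = ideal_gen (insert (curve_eq f) {[:u:] ^ (k - i) * [:- v, 1:] ^ i | i. i \<le> k}) \<and>
             (\<forall>g. min_groebner_element f (frag_cmul (int k) D) g \<longrightarrow>
                (\<exists>b0 b1. g = [:b0, b1:]) \<and>
                div_of f g = frag_cmul (int k) D + frag_of (iota (point_mult f k T))
                  - frag_cmul (int k * div_degree D + 1) (frag_of Infinity))) \<and>
          (\<forall>g. min_groebner_element f (frag_cmul (int n) D) g \<longrightarrow>
             div_of f g = frag_cmul (int n) D
               - frag_cmul (int n * div_degree D) (frag_of Infinity) \<and>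
             (\<exists>b0 b1. g = [:b0, b1:] \<and>
                (\<exists>r::'k. r \<noteq> 0 \<and> b0 ^ 2 - b1 ^ 2 * f = smult (to_ac r) (u ^ n))))"
    unfolding Let_def
  proof (intro conjI allI impI; (elim conjE)?)
    fix k assume k: "1 \<le> k" "k \<le> n"
    show "k = 1 \<or> (\<forall>P\<in>Poly_Mapping.keys D. iota P \<noteq> P) \<Longrightarrow>
        semi_reduced (weierstrass_ac a b c) (kD k + iota_pullback (reduction (weierstrass_ac a b c) (kD k)))"
      by (rule semi_reduced_kD[OF k])
    show "reduction (weierstrass_ac a b c) (kD k)
        = (if k = n then 0 else frag_of (point_mult (weierstrass_ac a b c) k (point_ac xT yT)))"
      by (rule reduction_kD[OF k])
    show "ideal_tilde (weierstrass_ac a b c) (kD k)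
        = ideal_gen (insert (curve_eq (weierstrass_ac a b c)) {[:u:] ^ (k - i) * [:- v, 1:] ^ i | i. i \<le> k})"
      using ideal_tilde_eq[OF k(1)] by (simp only: J_def C_def)
    fix g assume g: "min_groebner_element (weierstrass_ac a b c) (kD k) g"
    obtain b0 b1 where gb: "g = [:b0, b1:]"
      "div_of (weierstrass_ac a b c) g = (if k = n then kD n - frag_cmul (int n * div_degree D) pinf
       else kD k + frag_of (iota (point_mult (weierstrass_ac a b c) k (point_ac xT yT)))
         - frag_cmul (int k * div_degree D + 1) pinf)"
      using min_groebner[OF k g] by blast
    show "\<exists>b0 b1. g = [:b0, b1:]" using gb(1) by blast
    show "div_of (weierstrass_ac a b c) g
        = kD k + frag_of (iota (point_mult (weierstrass_ac a b c) k (point_ac xT yT)))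
          - frag_cmul (int k * div_degree D + 1) pinf"
      \<comment> \<open>For \<open>k = n\<close> the point \<open>[-k]T\<close> is \<open>O\<close>
        and cancels one copy of \<open>O\<close> in the pole part.\<close>
      unfolding gb(2) by (auto simp: point_mult_n frag_cmul_distrib)
  next
    fix g assume g: "min_groebner_element (weierstrass_ac a b c) (kD n) g"
    have n: "1 \<le> n" using n_ge_2 by simp
    obtain b0 b1 where gb: "g = [:b0, b1:]"
      "div_of (weierstrass_ac a b c) g = (if n = n then kD n - frag_cmul (int n * div_degree D) pinf
       else kD n + frag_of (iota (point_mult (weierstrass_ac a b c) n (point_ac xT yT)))
         - frag_cmul (int n * div_degree D + 1) pinf)"
      using min_groebner[OF n order.refl g] by blast
    show "div_of (weierstrass_ac a b c) g = kD n - frag_cmul (int n * div_degree D) pinf"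
      using gb(2) by simp
    obtain r where r: "r = 1 \<or> r = -1" "b0 ^ 2 - b1 ^ 2 * weierstrass_ac a b c = smult r (u ^ n)"
      using norm_equation g gb(1) by blast
    hence "r = to_ac 1 \<or> r = to_ac (-1)" by simp
    with r(2) have "\<exists>r::'k. r \<noteq> 0 \<and> b0 ^ 2 - b1 ^ 2 * weierstrass_ac a b c = smult (to_ac r) (u ^ n)"
      by (metis neg_equal_0_iff_equal one_neq_zero)
    with gb(1) show "\<exists>b0 b1. g = [:b0, b1:] \<and>
        (\<exists>r::'k. r \<noteq> 0 \<and> b0 ^ 2 - b1 ^ 2 * weierstrass_ac a b c = smult (to_ac r) (u ^ n))"
      by blast
  qed
next
  fix a b c :: "complex poly" and xT yT :: "complex poly fract" and n D u v b0 b1 and r :: complex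
  assume td: "torsion_data (to_fract a) (to_fract b) (to_fract c) xT yT n D (map_poly const_ac u) v"
    and g: "min_groebner_element (weierstrass_ac (to_fract a) (to_fract b) (to_fract c))
          (frag_cmul (int n) D) [:map_poly const_ac b0, map_poly const_ac b1:]"
    and r: "r \<noteq> 0" and eq: "b0 ^ 2 - b1 ^ 2 * weierstrass a b c = smult [:r:] (u ^ n)"
  interpret torsion "weierstrass_ac (to_fract a) (to_fract b) (to_fract c)" D "map_poly const_ac u" v "point_ac xT yT" n
    using td by (rule torsion_data_torsion)
  let ?f = "weierstrass a b c"
  have deg: "degree ?f = 3" by (simp add: weierstrass_def)
  hence f0: "?f \<noteq> 0" by auto
  show "quasi_toric 2 n 2 (proj_curve (homogenize ?f)) \<or>
        quasi_toric 2 n 2 (proj_curve (homogenize ?f) \<union> line_at_infinity)"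
  \<comment> \<open>For \<open>n = 2\<close> the norm equation may degenerate: if \<open>D\<close>
    is the sum of the two points of order 2 other than \<open>T\<close>, then \<open>g\<close> is
    \<open>u\<close> and \<open>b1 = 0\<close>.\<close>
  proof (cases "n = 2")
    case True
    have "0 + 3 \<le> total_degree ?f" using deg by (intro total_degree_ge) auto
    moreover have "?f \<noteq> 1" "?f \<noteq> -1" using deg by auto
    ultimately show ?thesis using f0 True quasi_toric_2_2_2[of ?f] by simp
  next
    case False
    hence "2 < n" using n_ge_2 by simp
    from both_components_nonzero[OF g this] u_neq_0
    have "b0 \<noteq> 0" "b1 \<noteq> 0" "u \<noteq> 0" by auto
    thus ?thesis using quasi_toric_relation f0 r eq by blast
  qed
qed

end
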